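(* Let $k\ge2$ and let $g_1,\dots,g_k$ be real analytic functions on an interval $U\subset\mathbb{R}$, linearly independent over $\mathbb{R}$. Let $x_0\in U$ be a point at which the Wronskian $W(g_1,\dots,g_k)(x_0)\neq0$. Then there is an interval $I_0$ centred at $x_0$ and positive constants $K_0,\alpha$ such that for any interval $J\subset I_0$ there is a constant $\delta=\delta(J)>0$ such that for any positive $\theta_1,\dots,\theta_k$ the set $$\Big\{x\in J:\ \exists(a_1,\dots,a_k)\in\mathbb Z^k\setminus\{0\}\ \text{with}\ |a_1g_1^{(i-1)}(x)+\dots+a_kg_k^{(i-1)}(x)|<\theta_i\ \ \forall\,i=1,\dots,k\Big\}$$ has Lebesgue measure at most $K_0\big(1+(\delta^{-1}\widetilde\Theta)^\alpha\big)\theta^\alpha|J|$, where $|J|$ is the length of $J$, $\theta=(\theta_1\cdots\theta_k)^{1/k}$ and $\widetilde\Theta=\max_{1\le r\le k-1}\theta_1\cdots\theta_r/\theta^r$.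
   Context: $g^{(i)}$ denotes the $i$-th derivative, $g^{(0)}=g$. *)

theory Defs
  imports "HOL-Analysis.Analysis" "Jordan_Normal_Form.Determinant"
begin

text \<open>
  The power series at a point of \<open>S\<close> has to represent \<open>f\<close> on a full neighbourhood of that point
  in the real line. For open \<open>S\<close> this is the usual notion; if \<open>S\<close> contains an end point, it says
  that \<open>f\<close> (a total function) is an analytic extension of its restriction to \<open>S\<close>, so that
  \<^const>\<open>deriv\<close> computes the right derivatives at the end point as well.
\<close>

definition real_analytic_on :: "(real \<Rightarrow> real) \<Rightarrow> real set \<Rightarrow> bool"
  where "real_analytic_on f S \<longleftrightarrow>
    (\<forall>x\<in>S. \<exists>r>0. \<exists>c :: nat \<Rightarrow> real. \<forall>y\<in>ball x r. (\<lambda>n. c n * (y - x) ^ n) sums f y)"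

text \<open>Families \<open>g\<^sub>1, \<dots>, g\<^sub>k\<close> are functions on \<^typ>\<open>nat\<close> whose values outside \<open>{1..k}\<close> are ignored.\<close>

definition lin_indep_functions_on :: "nat \<Rightarrow> (nat \<Rightarrow> real \<Rightarrow> real) \<Rightarrow> real set \<Rightarrow> bool"
  where "lin_indep_functions_on k g S \<longleftrightarrow>
    (\<forall>c :: nat \<Rightarrow> real. (\<forall>x\<in>S. (\<Sum>j=1..k. c j * g j x) = 0) \<longrightarrow> (\<forall>j\<in>{1..k}. c j = 0))"

text \<open>Matrix indices start at \<open>0\<close>, so row \<open>i\<close> holds the \<open>i\<close>-th derivatives and column \<open>j\<close>
  belongs to \<open>g\<^bsub>j+1\<^esub>\<close>.\<close>

definition wronskian :: "nat \<Rightarrow> (nat \<Rightarrow> real \<Rightarrow> real) \<Rightarrow> real \<Rightarrow> real"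
  where "wronskian k g x =
    Determinant.det (Matrix.mat k k (\<lambda>(i, j). (deriv ^^ i) (g (Suc j)) x))"

definition small_combination_set ::
    "nat \<Rightarrow> (nat \<Rightarrow> real \<Rightarrow> real) \<Rightarrow> (nat \<Rightarrow> real) \<Rightarrow> real set \<Rightarrow> real set"
  where "small_combination_set k g \<theta> J =
    {x \<in> J. \<exists>a :: nat \<Rightarrow> int. (\<exists>j\<in>{1..k}. a j \<noteq> 0) \<and>
       (\<forall>i\<in>{1..k}. \<bar>\<Sum>j=1..k. real_of_int (a j) * (deriv ^^ (i - 1)) (g j) x\<bar> < \<theta> i)}"

definition geometric_mean :: "nat \<Rightarrow> (nat \<Rightarrow> real) \<Rightarrow> real"
  where "geometric_mean k \<theta> = (\<Prod>i=1..k. \<theta> i) powr (1 / real k)"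

definition Theta_tilde :: "nat \<Rightarrow> (nat \<Rightarrow> real) \<Rightarrow> real"
  where "Theta_tilde k \<theta> =
    Max ((\<lambda>r. (\<Prod>i=1..r. \<theta> i) / geometric_mean k \<theta> ^ r) ` {1..k - 1})"

end

theory Submission
  imports Defs
begin

text \<open>
  The estimate is an instance of the quantitative non-divergence of Kleinbock and Margulis in one
  variable. Put \<open>h(x) = diag(\<theta>/\<theta>\<^sub>1, \<dots>, \<theta>/\<theta>\<^sub>k) G(x)\<close>, where \<open>G\<close> is the Wronskian matrix: a point \<open>x\<close>
  belongs to the set only if the lattice \<open>h(x) \<int>\<^sup>k\<close> has a non-zero vector of length less than \<open>\<theta>\<close>.
  The size of \<open>h(x) \<Delta>\<close>, for a sublattice \<open>\<Delta>\<close> of \<open>\<int>\<^sup>k\<close> of rank \<open>r\<close>, is the largest \<open>r \<times> r\<close> minor of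
  \<open>h(x)\<close> applied to a basis. These minors lie in a fixed finite-dimensional space of analytic
  functions, so near \<open>x\<^sub>0\<close> their sublevel sets obey a power law with uniform constants. The minor
  formed by the first \<open>r\<close> rows is a Wronskian multiplied by \<open>\<theta>\<^sup>r / (\<theta>\<^sub>1 \<cdots> \<theta>\<^sub>r)\<close>, and compactness bounds
  its supremum over \<open>J\<close> from below, uniformly in \<open>\<Delta>\<close>. An induction on the length of flags of
  sublattices, with a stopping-time decomposition into dyadic intervals, then controls the set of
  points at which \<open>h(x) \<int>\<^sup>k\<close> has a short vector.
\<close>

subsection \<open>Determinants of square arrays\<close>

text \<open>Infinitely many sublattices compete, so every estimate has to be uniform in the lattice.
  For the power law this works because the row scaling and the lattice basis enter only through the
  coefficients of the minors, and the law is homogeneous in these coefficients; hence neither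
  \<open>\<theta>\<close> nor \<open>J\<close> influences its constants. For the lower bound, a
  basis is normalised by its largest minor. This minor is a non-zero integer, so dividing it out
  only makes the bound harder, and what remains lies in finitely many compact sets of real matrices.
  Only this step depends on \<open>J\<close>, so only \<delta> does. Rank k is special: the scaling
  has determinant 1 because \<theta> is a geometric mean, so the Wronskian itself bounds the size
  from below near the centre, and that bound goes into the constant in front. Ranks 1 to k-1 produce
  the maximum in the statement. The threshold for flags is the least of 1, the rank-k bound and
  \<delta> divided by that maximum; the possible values of its reciprocal give the two summands of
  the estimate. Sizes are maxima of minors, so adjoining one short vector is a column expansion. It
  costs a factor at most k, the origin of \<open>real k * \<tau>\<close>.\<close>

definition fdet :: "nat \<Rightarrow> (nat \<Rightarrow> nat \<Rightarrow> real) \<Rightarrow> real"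
  where "fdet n A = Determinant.det (Matrix.mat n n (\<lambda>(i, j). A i j))"

lemma fdet_cong:
  assumes "\<And>i j. i < n \<Longrightarrow> j < n \<Longrightarrow> A i j = B i j"
  shows "fdet n A = fdet n B"
  unfolding fdet_def by (rule arg_cong[where f = Determinant.det], rule eq_matI) (auto simp: assms)

lemma fdet_0 [simp]: "fdet 0 A = 1"
  unfolding fdet_def by (rule det_dim_zero) auto

lemma fdet_leibniz:
  "fdet n A = (\<Sum>p | p permutes {0..<n}. signof p * (\<Prod>i = 0..<n. A i (p i)))"
proof -
  have "fdet n A = (\<Sum>p | p permutes {0..<n}. signof p * (\<Prod>i = 0..<n. Matrix.mat n n (\<lambda>(i, j). A i j) $$ (i, p i)))"
    unfolding fdet_def by (rule det_def') simp
  also have "\<dots> = (\<Sum>p | p permutes {0..<n}. signof p * (\<Prod>i = 0..<n. A i (p i)))"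
  proof (intro sum.cong refl arg_cong2[where f = "(*)"] prod.cong)
    fix p i assume "p \<in> {p. p permutes {0..<n}}" "i \<in> {0..<n}"
    then have "p i < n" "i < n" using permutes_in_image[of p "{0..<n}" i] by auto
    then show "Matrix.mat n n (\<lambda>(i, j). A i j) $$ (i, p i) = A i (p i)" by simp
  qed
  finally show ?thesis .
qed

lemma fdet_mult:
  "fdet n (\<lambda>i j. \<Sum>l<n. A i l * B l j) = fdet n A * fdet n B"
proof -
  let ?A = "Matrix.mat n n (\<lambda>(i, j). A i j)" and ?B = "Matrix.mat n n (\<lambda>(i, j). B i j)"
  have "Matrix.mat n n (\<lambda>(i, j). \<Sum>l<n. A i l * B l j) = ?A * ?B"
    by (rule eq_matI) (auto simp: scalar_prod_def lessThan_atLeast0)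
  then show ?thesis
    unfolding fdet_def by (simp add: det_mult[of ?A n ?B])
qed

lemma fdet_kernel:
  assumes "fdet n A \<noteq> 0" and "\<And>i. i < n \<Longrightarrow> (\<Sum>j<n. A i j * c j) = 0" and "j < n"
  shows "c j = 0"
proof (rule ccontr)
  assume "c j \<noteq> 0"
  let ?A = "Matrix.mat n n (\<lambda>(i, j). A i j)" and ?c = "Matrix.vec n c"
  have "?c \<noteq> 0\<^sub>v n"
  proof
    assume "?c = 0\<^sub>v n"
    then have "vec_index ?c j = vec_index (0\<^sub>v n) j" by simp
    with \<open>j < n\<close> \<open>c j \<noteq> 0\<close> show False by simp
  qed
  moreover have "?A *\<^sub>v ?c = 0\<^sub>v n"
    by (rule eq_vecI) (auto simp: scalar_prod_def lessThan_atLeast0[symmetric] assms(2))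
  ultimately have "Determinant.det ?A = 0"
    by (subst det_0_iff_vec_prod_zero_field[of _ n]) (auto intro!: bexI[of _ ?c] exI[of _ ?c])
  with assms(1) show False by (simp add: fdet_def)
qed

lemma fdet_expand_row:
  "fdet (Suc n) A =
    (\<Sum>j<Suc n. A n j * ((-1) ^ (n + j) * fdet n (\<lambda>i' j'. A i' (if j' < j then j' else Suc j'))))"
proof -
  let ?A = "Matrix.mat (Suc n) (Suc n) (\<lambda>(i, j). A i j)"
  have "fdet (Suc n) A = (\<Sum>j<Suc n. ?A $$ (n, j) * cofactor ?A n j)"
    unfolding fdet_def by (rule laplace_expansion_row) auto
  also have "\<dots> = (\<Sum>j<Suc n. A n j * ((-1) ^ (n + j) * fdet n (\<lambda>i' j'. A i' (if j' < j then j' else Suc j'))))"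
  proof (intro sum.cong refl arg_cong2[where f = "(*)"])
    fix j assume j: "j \<in> {..<Suc n}"
    then show "?A $$ (n, j) = A n j" by simp
    have "mat_delete ?A n j = Matrix.mat n n (\<lambda>(i', j'). A i' (if j' < j then j' else Suc j'))"
      using j by (intro eq_matI) (auto simp: mat_delete_def)
    then show "cofactor ?A n j = (-1) ^ (n + j) * fdet n (\<lambda>i' j'. A i' (if j' < j then j' else Suc j'))"
      by (simp add: cofactor_def fdet_def)
  qed
  finally show ?thesis .
qed

lemma fdet_expand_column:
  "fdet (Suc n) A =
    (\<Sum>i<Suc n. A i n * ((-1) ^ (i + n) * fdet n (\<lambda>i' j'. A (if i' < i then i' else Suc i') j')))"
proof -
  let ?A = "Matrix.mat (Suc n) (Suc n) (\<lambda>(i, j). A i j)"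
  have "fdet (Suc n) A = (\<Sum>i<Suc n. ?A $$ (i, n) * cofactor ?A i n)"
    unfolding fdet_def by (rule laplace_expansion_column) auto
  also have "\<dots> = (\<Sum>i<Suc n. A i n * ((-1) ^ (i + n) * fdet n (\<lambda>i' j'. A (if i' < i then i' else Suc i') j')))"
  proof (intro sum.cong refl arg_cong2[where f = "(*)"])
    fix i assume i: "i \<in> {..<Suc n}"
    then show "?A $$ (i, n) = A i n" by simp
    have "mat_delete ?A i n = Matrix.mat n n (\<lambda>(i', j'). A (if i' < i then i' else Suc i') j')"
      using i by (intro eq_matI) (auto simp: mat_delete_def)
    then show "cofactor ?A i n = (-1) ^ (i + n) * fdet n (\<lambda>i' j'. A (if i' < i then i' else Suc i') j')"
      by (simp add: cofactor_def fdet_def)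
  qed
  finally show ?thesis .
qed

lemma fdet_identical_rows:
  assumes "i < n" "i' < n" "i \<noteq> i'" and "\<And>j. j < n \<Longrightarrow> A i j = A i' j"
  shows "fdet n A = 0"
  unfolding fdet_def
  by (rule det_identical_rows[of _ n i i']) (use assms in \<open>auto intro!: eq_vecI\<close>)

lemma fdet_transpose: "fdet n (\<lambda>i j. A j i) = fdet n A"
proof -
  let ?A = "Matrix.mat n n (\<lambda>(i, j). A i j)"
  have "Matrix.mat n n (\<lambda>(i, j). A j i) = transpose_mat ?A" by (rule eq_matI) auto
  then show ?thesis unfolding fdet_def by (simp add: Determinant.det_transpose[of ?A n])
qed

text \<open>Linearity in row \<open>m\<close>: each summand with \<open>l\<close> different from
  \<open>m\<close> repeats a row and contributes zero. It is obtained from the column version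
  through the transpose.\<close>

lemma fdet_cramer:
  assumes "m < n"
  shows "fdet n (\<lambda>i j. if i = m then \<Sum>l<n. c l * A l j else A i j) = c m * fdet n A"
proof -
  let ?A = "Matrix.mat n n (\<lambda>(i, j). A j i)" and ?c = "Matrix.vec n c"
  have "replace_col ?A (?A *\<^sub>v ?c) m =
      Matrix.mat n n (\<lambda>(j, i). if i = m then \<Sum>l<n. c l * A l j else A i j)"
    by (rule eq_matI) (auto simp: replace_col_def scalar_prod_def lessThan_atLeast0 mult.commute
        intro!: sum.cong)
  then have "Determinant.det (Matrix.mat n n (\<lambda>(j, i). if i = m then \<Sum>l<n. c l * A l j else A i j))
      = c m * Determinant.det ?A"
    using cramer_lemma_mat[of ?A n ?c m] assms by simp
  then show ?thesis
    using fdet_transpose[of n A]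
      fdet_transpose[of n "\<lambda>i j. if i = m then \<Sum>l<n. c l * A l j else A i j"]
    by (simp add: fdet_def)
qed

lemma fdet_inverse:
  assumes "fdet n A \<noteq> 0"
  shows "\<exists>B. \<forall>i<n. \<forall>j<n. (\<Sum>l<n. A i l * B l j) = (if i = j then 1 else 0) \<and>
    (\<Sum>l<n. B i l * A l j) = (if i = j then 1 else 0)"
proof -
  let ?A = "Matrix.mat n n (\<lambda>(i, j). A i j)"
  define B where "B = (\<lambda>i j. adj_mat ?A $$ (i, j) / fdet n A)"
  have adj: "adj_mat ?A \<in> carrier_mat n n"
    "?A * adj_mat ?A = fdet n A \<cdot>\<^sub>m 1\<^sub>m n" "adj_mat ?A * ?A = fdet n A \<cdot>\<^sub>m 1\<^sub>m n"
    using adj_mat[of ?A n] by (auto simp: fdet_def)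
  have dims: "dim_row (adj_mat ?A) = n" "dim_col (adj_mat ?A) = n" using adj(1) by auto
  show ?thesis
  proof (intro exI[of _ B] allI impI conjI)
    fix i j assume ij: "i < n" "j < n"
    have "(?A * adj_mat ?A) $$ (i, j) = (\<Sum>l<n. A i l * adj_mat ?A $$ (l, j))"
      using ij dims by (simp add: scalar_prod_def lessThan_atLeast0)
    moreover have "(fdet n A \<cdot>\<^sub>m 1\<^sub>m n) $$ (i, j) = (if i = j then fdet n A else 0)"
      using ij by simp
    ultimately have "(\<Sum>l<n. A i l * adj_mat ?A $$ (l, j)) = (if i = j then fdet n A else 0)"
      using adj(2) by simp
    then show "(\<Sum>l<n. A i l * B l j) = (if i = j then 1 else 0)"
      using assms by (simp add: B_def sum_divide_distrib[symmetric])
    have "(adj_mat ?A * ?A) $$ (i, j) = (\<Sum>l<n. adj_mat ?A $$ (i, l) * A l j)"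
      using ij dims by (simp add: scalar_prod_def lessThan_atLeast0)
    moreover have "(fdet n A \<cdot>\<^sub>m 1\<^sub>m n) $$ (i, j) = (if i = j then fdet n A else 0)"
      using ij by simp
    ultimately have "(\<Sum>l<n. adj_mat ?A $$ (i, l) * A l j) = (if i = j then fdet n A else 0)"
      using adj(3) by simp
    then show "(\<Sum>l<n. B i l * A l j) = (if i = j then 1 else 0)"
      using assms by (simp add: B_def sum_divide_distrib[symmetric])
  qed
qed

lemma signof_Ints: "(signof p :: real) \<in> \<int>"
  by (simp add: sign_def)

lemma fdet_Ints:
  assumes "\<And>i j. i < n \<Longrightarrow> j < n \<Longrightarrow> A i j \<in> \<int>"
  shows "fdet n A \<in> \<int>"
  unfolding fdet_leibniz
proof (intro Ints_sum Ints_mult Ints_prod signof_Ints)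
  fix p i assume "p \<in> {p. p permutes {0..<n}}" "i \<in> {0..<n}"
  then have "p i < n" "i < n" using permutes_in_image[of p "{0..<n}" i] by auto
  then show "A i (p i) \<in> \<int>" by (simp add: assms)
qed

lemma continuous_on_fdet:
  assumes "\<And>i j. i < n \<Longrightarrow> j < n \<Longrightarrow> continuous_on S (\<lambda>x. A x i j)"
  shows "continuous_on S (\<lambda>x. fdet n (A x))"
  unfolding fdet_leibniz
proof (intro continuous_intros)
  fix p i assume "p \<in> {p. p permutes {0..<n}}" "i \<in> {0..<n}"
  then have "p i < n" "i < n" using permutes_in_image[of p "{0..<n}" i] by auto
  then show "continuous_on S (\<lambda>x. A x i (p i))" by (simp add: assms)
qed

lemma field_differentiable_finite_prod:
  fixes f :: "'i \<Rightarrow> real \<Rightarrow> real"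
  assumes "\<And>i. i \<in> I \<Longrightarrow> f i field_differentiable (at x)"
  shows "(\<lambda>x. \<Prod>i\<in>I. f i x) field_differentiable (at x)"
  using assms
  by (induction I rule: infinite_finite_induct) (auto intro!: derivative_intros field_differentiable_mult)

lemma field_differentiable_fdet:
  fixes A :: "real \<Rightarrow> nat \<Rightarrow> nat \<Rightarrow> real"
  assumes "\<And>i j. i < n \<Longrightarrow> j < n \<Longrightarrow> (\<lambda>x. A x i j) field_differentiable (at x)"
  shows "(\<lambda>x. fdet n (A x)) field_differentiable (at x)"
  unfolding fdet_leibniz
proof (intro field_differentiable_sum field_differentiable_mult field_differentiable_const field_differentiable_finite_prod)
  fix p i assume "p \<in> {p. p permutes {0..<n}}" "i \<in> {0..<n}"
  then have "p i < n" "i < n" using permutes_in_image[of p "{0..<n}" i] by auto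
  then show "(\<lambda>x. A x i (p i)) field_differentiable (at x)" by (simp add: assms)
qed

subsection \<open>Sublevel sets of functions in a finite-dimensional space of power series\<close>

text \<open>By the mean value theorem between consecutive points, half as many separated points remain at
  which the derivative is small.\<close>

lemma sublevel_separated:
  fixes F :: "nat \<Rightarrow> real \<Rightarrow> real" and x :: "nat \<Rightarrow> real"
  assumes "is_interval B"
    and "\<And>i y. y \<in> B \<Longrightarrow> (F i has_real_derivative F (Suc i) y) (at y)"
    and "\<And>u v. u \<in> B \<Longrightarrow> v \<in> B \<Longrightarrow> \<bar>u - v\<bar> \<le> L"
    and "0 < t" "t \<le> L" "1 \<le> M"
    and "\<And>m. m < 2 ^ j \<Longrightarrow> x m \<in> B" "\<And>m. m < 2 ^ j \<Longrightarrow> \<bar>F 0 (x m)\<bar> \<le> \<epsilon>"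
    and "\<And>m. Suc m < 2 ^ j \<Longrightarrow> x m + t \<le> x (Suc m)"
    and "\<And>y. y \<in> B \<Longrightarrow> c \<le> \<bar>F j y\<bar>" "\<And>y. y \<in> B \<Longrightarrow> \<bar>F j y\<bar> \<le> M * c"
    and "y \<in> B"
  shows "\<bar>F 0 y\<bar> \<le> (M + real j) * (2 * L / t) ^ j * \<epsilon>"
  using assms(2,7-)
proof (induction j arbitrary: F x \<epsilon> y)
  case 0
  \<comment> \<open>At order zero one point with a small value suffices: the two-sided bound carries
    it to all of \<open>B\<close> at the price of the factor \<open>M\<close>.\<close>
  have "c \<le> \<epsilon>" using "0.prems"(2-5)[of 0] "0.prems"(5)[of "x 0"] by force
  then have "M * c \<le> M * \<epsilon>" using \<open>1 \<le> M\<close> by (simp add: mult_left_mono)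
  then show ?case using "0.prems"(6)[OF "0.prems"(7)] by simp
next
  case (Suc j)
  note dF = Suc.prems(1) and xB = Suc.prems(2) and xe = Suc.prems(3) and xs = Suc.prems(4)
  have between: "z \<in> B" if "u \<in> B" "v \<in> B" "u \<le> z" "z \<le> v" for u v z
    using mem_is_interval_1_I[OF \<open>is_interval B\<close> that] .
  have idx: "2 * m < 2 ^ Suc j" "Suc (2 * m) < 2 ^ Suc j" if "m < 2 ^ j" for m
    using that by auto
  have "\<exists>z. x (2 * m) < z \<and> z < x (Suc (2 * m)) \<and>
      F 0 (x (Suc (2 * m))) - F 0 (x (2 * m)) = (x (Suc (2 * m)) - x (2 * m)) * F 1 z" if "m < 2 ^ j" for m
  proof (rule MVT2)
    show "x (2 * m) < x (Suc (2 * m))" using xs[of "2 * m"] idx[OF that] \<open>0 < t\<close> by simp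
    fix z assume "x (2 * m) \<le> z" "z \<le> x (Suc (2 * m))"
    then have "z \<in> B" using between xB idx[OF that] by blast
    then show "(F 0 has_real_derivative F 1 z) (at z)" using dF[of z 0] by simp
  qed
  then obtain w where w: "\<And>m. m < 2 ^ j \<Longrightarrow> x (2 * m) < w m \<and> w m < x (Suc (2 * m)) \<and>
      F 0 (x (Suc (2 * m))) - F 0 (x (2 * m)) = (x (Suc (2 * m)) - x (2 * m)) * F 1 (w m)" by metis
  have xe0: "\<bar>F 0 (x 0)\<bar> \<le> \<epsilon>" using xe[of 0] by simp
  then have e0: "0 \<le> \<epsilon>" by simp
  \<comment> \<open>The points are paired as \<open>2 * m\<close>, \<open>2 * m + 1\<close>. Two
    values at most \<epsilon> over a gap at least \<open>t\<close> give slope at most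
    \<open>2 * \<epsilon> / t\<close> at the intermediate point \<open>w m\<close>.\<close>
  have "\<bar>F (Suc 0) z\<bar> \<le> (M + real j) * (2 * L / t) ^ j * (2 * \<epsilon> / t)" if "z \<in> B" for z
  proof (rule Suc.IH[of "\<lambda>i. F (Suc i)" w "2 * \<epsilon> / t"])
    show "(F (Suc i) has_real_derivative F (Suc (Suc i)) y) (at y)" if "y \<in> B" for i y
      using dF that .
    fix m :: nat
    assume m: "m < 2 ^ j"
    show "w m \<in> B" using between[OF xB xB, of "2 * m" "Suc (2 * m)"] idx[OF m] w[OF m] by auto
    have "\<bar>F 0 (x (Suc (2 * m))) - F 0 (x (2 * m))\<bar> \<le> 2 * \<epsilon>"
      using xe[OF idx(1)[OF m]] xe[OF idx(2)[OF m]] by linarith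
    moreover have "\<bar>F 0 (x (Suc (2 * m))) - F 0 (x (2 * m))\<bar> = (x (Suc (2 * m)) - x (2 * m)) * \<bar>F 1 (w m)\<bar>"
      using w[OF m] by (simp add: abs_mult)
    moreover have "t * \<bar>F 1 (w m)\<bar> \<le> (x (Suc (2 * m)) - x (2 * m)) * \<bar>F 1 (w m)\<bar>"
      using xs[of "2 * m"] idx[OF m] by (intro mult_right_mono) auto
    ultimately have "t * \<bar>F 1 (w m)\<bar> \<le> 2 * \<epsilon>" by linarith
    then show "\<bar>F (Suc 0) (w m)\<bar> \<le> 2 * \<epsilon> / t"
      using \<open>0 < t\<close> by (simp add: field_simps)
  next
    fix m :: nat
    assume m: "Suc m < 2 ^ j"
    \<comment> \<open>The gap between two consecutive pairs lies between \<open>w m\<close> and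
      \<open>w (Suc m)\<close>, so the separation \<open>t\<close> is inherited.\<close>
    have "x (Suc (2 * m)) + t \<le> x (Suc (Suc (2 * m)))" using xs[of "Suc (2 * m)"] m by simp
    then show "w m + t \<le> w (Suc m)" using w[of m] w[of "Suc m"] m by simp
  next
    show "c \<le> \<bar>F (Suc j) y\<bar>" "\<bar>F (Suc j) y\<bar> \<le> M * c" if "y \<in> B" for y
      using Suc.prems(5,6) that by auto
    show "z \<in> B" using that .
  qed
  moreover define D where "D = (M + real j) * (2 * L / t) ^ j * (2 * \<epsilon> / t)"
  ultimately have D: "\<bar>F 1 z\<bar> \<le> D" if "z \<in> B" for z using that by auto
  have x0: "x 0 \<in> B" using xB by simp
  have "\<bar>F 0 y - F 0 (x 0)\<bar> \<le> D * \<bar>y - x 0\<bar>"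
  proof (rule field_differentiable_bound[of B "F 0" "F 1" D y "x 0", unfolded real_norm_def])
    show "convex B" using \<open>is_interval B\<close> by (simp add: is_interval_convex)
    show "(F 0 has_field_derivative F 1 z) (at z within B)" if "z \<in> B" for z
      using dF[OF that, of 0] by (auto intro: has_field_derivative_at_within)
  qed (use D x0 Suc.prems(7) in auto)
  moreover have "D * \<bar>y - x 0\<bar> \<le> D * L"
    using assms(3)[OF Suc.prems(7) x0] D[OF x0] by (intro mult_left_mono) auto
  ultimately have "\<bar>F 0 y\<bar> \<le> \<epsilon> + D * L" using xe0 by linarith
  moreover have "D * L = (M + real j) * (2 * L / t) ^ Suc j * \<epsilon>"
    by (simp add: D_def field_simps)
  \<comment> \<open>Since \<open>2 * L / t\<close> is at least 1, the starting value \<epsilon> is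
    absorbed; this raises \<open>M + real j\<close> to \<open>M + real (Suc j)\<close>.\<close>
  moreover have "\<epsilon> * 1 \<le> \<epsilon> * (2 * L / t) ^ Suc j"
    using \<open>0 < t\<close> \<open>t \<le> L\<close> e0 by (intro mult_left_mono one_le_power) auto
  ultimately have "\<bar>F 0 y\<bar> \<le> \<epsilon> * (2 * L / t) ^ Suc j + (M + real j) * (2 * L / t) ^ Suc j * \<epsilon>"
    by linarith
  also have "\<dots> = (M + real (Suc j)) * (2 * L / t) ^ Suc j * \<epsilon>"
    by (simp only: of_nat_Suc ring_distribs mult_1_left add_ac mult_ac)
  finally show ?case .
qed

text \<open>Greedy choice from the left: take a point close to the infimum and discard everything
  within distance \<open>t\<close> to its right.\<close>

lemma separated_points:
  fixes E :: "real set" and t :: real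
  assumes "E \<in> lmeasurable" "bdd_below E" "0 < t" "real m * t < measure lebesgue E"
  shows "\<exists>x. (\<forall>i\<le>m. x i \<in> E) \<and> (\<forall>i<m. x i + t \<le> x (Suc i))"
  using assms
proof (induction m arbitrary: E)
  case 0
  then have "E \<noteq> {}" by auto
  then obtain z where "z \<in> E" by blast
  then show ?case by (intro exI[of _ "\<lambda>_. z"]) auto
next
  case (Suc m)
  \<comment> \<open>Half of the surplus of measure. One half pays for an infimum that need not be
    attained, the other keeps the inequality strict for the induction.\<close>
  define \<eta> where "\<eta> = (measure lebesgue E - real (Suc m) * t) / 2"
  have "\<eta> > 0" using Suc.prems by (simp add: \<eta>_def)
  have "0 \<le> real (Suc m) * t" using \<open>0 < t\<close> by simp
  then have "measure lebesgue E > 0" using Suc.prems(4) by linarith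
  then have ne: "E \<noteq> {}" by auto
  then obtain x0 where x0: "x0 \<in> E" "x0 < Inf E + \<eta>"
    using cInf_lessD[of E "Inf E + \<eta>"] \<open>\<eta> > 0\<close> by auto
  define E' where "E' = E \<inter> {x0 + t..}"
  have E': "E' \<in> lmeasurable"
    unfolding E'_def using Suc.prems(1) by (intro fmeasurable_Int_fmeasurable) auto
  have "E \<subseteq> E' \<union> {Inf E..x0 + t}"
    using cInf_lower[OF _ Suc.prems(2)] by (auto simp: E'_def)
  then have "measure lebesgue E \<le> measure lebesgue (E' \<union> {Inf E..x0 + t})"
    using E' Suc.prems(1) by (intro measure_mono_fmeasurable) auto
  also have "\<dots> \<le> measure lebesgue E' + measure lebesgue {Inf E..x0 + t}"
    using E' by (intro measure_Un_le) auto
  also have "measure lebesgue {Inf E..x0 + t} = x0 + t - Inf E"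
    using cInf_lower[OF x0(1) Suc.prems(2)] \<open>0 < t\<close> by simp
  finally have "measure lebesgue E' > measure lebesgue E - t - \<eta>" using x0 by linarith
  moreover have "measure lebesgue E - t - \<eta> = real m * t + \<eta>"
    by (simp add: \<eta>_def field_simps)
  ultimately have "real m * t < measure lebesgue E'" using \<open>\<eta> > 0\<close> by linarith
  moreover have "bdd_below E'" using Suc.prems(2) by (auto simp: E'_def)
  ultimately obtain x where x: "\<And>i. i \<le> m \<Longrightarrow> x i \<in> E'" "\<And>i. i < m \<Longrightarrow> x i + t \<le> x (Suc i)"
    using Suc.IH[OF E' _ \<open>0 < t\<close>] by blast
  define x' where "x' = (\<lambda>i. case i of 0 \<Rightarrow> x0 | Suc i \<Rightarrow> x i)"
  have "x' i \<in> E" if "i \<le> Suc m" for i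
    using that x0 x(1) by (auto simp: x'_def E'_def split: nat.split)
  moreover have "x' i + t \<le> x' (Suc i)" if "i < Suc m" for i
    using that x(1)[of 0] x(2) by (auto simp: x'_def E'_def split: nat.split)
  ultimately show ?case by blast
qed

lemma sublevel_lmeasurable:
  fixes f :: "real \<Rightarrow> real"
  assumes "continuous_on {a..<b} f"
  shows "{x \<in> {a..<b}. \<bar>f x\<bar> < \<epsilon>} \<in> lmeasurable"
proof -
  have "f \<in> borel_measurable (restrict_space borel {a..<b})"
    using assms by (rule borel_measurable_continuous_on_restrict)
  then have "{x \<in> space (restrict_space borel {a..<b}). \<bar>f x\<bar> < \<epsilon>} \<in> sets (restrict_space borel {a..<b})"
    by measurable
  then have "{x \<in> {a..<b}. \<bar>f x\<bar> < \<epsilon>} \<in> sets (restrict_space borel {a..<b})"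
    by (simp add: space_restrict_space)
  then have "{x \<in> {a..<b}. \<bar>f x\<bar> < \<epsilon>} \<in> sets lborel"
    using sets_restrict_space_iff[of "{a..<b}" borel] by simp
  then have "{x \<in> {a..<b}. \<bar>f x\<bar> < \<epsilon>} \<in> sets lebesgue"
    by (rule sets_completionI_sets)
  moreover have "bounded {x \<in> {a..<b}. \<bar>f x\<bar> < \<epsilon>}"
    by (rule bounded_subset[of "{a..<b}"]) auto
  ultimately show ?thesis
    by (intro bounded_set_imp_lmeasurable)
qed

text \<open>A sublevel set of measure \<open>s\<close> contains \<open>2 ^ j\<close> points with
  gaps \<open>s / 2 ^ j\<close>, to which the separated-points estimate applies. Replacing
  \<open>j\<close> by the upper bound \<open>n\<close> makes the exponent independent of the
  derivative that is bounded below; the product form also covers \<open>s = 0\<close>.\<close>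

lemma sublevel_measure_le:
  fixes F :: "nat \<Rightarrow> real \<Rightarrow> real"
  assumes "\<And>i y. y \<in> {a..<b} \<Longrightarrow> (F i has_real_derivative F (Suc i) y) (at y)"
    and "\<And>y. y \<in> {a..<b} \<Longrightarrow> c \<le> \<bar>F j y\<bar>" "\<And>y. y \<in> {a..<b} \<Longrightarrow> \<bar>F j y\<bar> \<le> M * c"
    and "1 \<le> M" "0 < \<epsilon>" "j \<le> n" "0 < n" "y \<in> {a..<b}"
  shows "\<bar>F 0 y\<bar> * measure lebesgue {x \<in> {a..<b}. \<bar>F 0 x\<bar> < \<epsilon>} ^ n
    \<le> (M + real n) * 2 ^ (Suc n * n) * \<epsilon> * (b - a) ^ n"
proof -
  define E where "E = {x \<in> {a..<b}. \<bar>F 0 x\<bar> < \<epsilon>}"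
  define s where "s = measure lebesgue E"
  have "continuous_on {a..<b} (F 0)"
    using assms(1)[of _ 0] by (meson DERIV_continuous_on has_field_derivative_at_within)
  then have E: "E \<in> lmeasurable" unfolding E_def by (rule sublevel_lmeasurable)
  have ab: "a < b" using assms(8) by auto
  have bdd: "bdd_below E" by (rule bdd_belowI[of _ a]) (auto simp: E_def)
  have sL: "s \<le> b - a"
  proof -
    have "{a..<b} \<in> lmeasurable" by (rule bounded_set_imp_lmeasurable) auto
    moreover have "E \<subseteq> {a..<b}" by (auto simp: E_def)
    ultimately have "s \<le> measure lebesgue {a..<b}"
      unfolding s_def using E by (intro measure_mono_fmeasurable) auto
    then show ?thesis using ab by simp
  qed
  show ?thesis
  proof (cases "s = 0")
    case True
    then have "\<bar>F 0 y\<bar> * measure lebesgue {x \<in> {a..<b}. \<bar>F 0 x\<bar> < \<epsilon>} ^ n = 0"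
      using \<open>0 < n\<close> unfolding s_def E_def by simp
    also have "0 \<le> (M + real n) * 2 ^ (Suc n * n) * \<epsilon> * (b - a) ^ n"
      using assms(4,5) ab by (intro mult_nonneg_nonneg) auto
    finally show ?thesis .
  next
    case False
    then have s: "0 < s" by (simp add: s_def zero_less_measure_iff)
    \<comment> \<open>\<open>2 ^ j\<close> points have only \<open>2 ^ j - 1\<close> gaps, so the
      total length of the gaps stays strictly below \<open>s\<close>.\<close>
    define t where "t = s / 2 ^ j"
    have "s * 1 \<le> s * 2 ^ j" using s by (intro mult_left_mono) auto
    then have t: "0 < t" "t \<le> s" using s by (auto simp: t_def field_simps)
    have "real (2 ^ j - 1) * t < s" using s by (simp add: t_def field_simps of_nat_diff)
    then obtain x where x: "\<And>i. i \<le> 2 ^ j - 1 \<Longrightarrow> x i \<in> E" "\<And>i. i < 2 ^ j - 1 \<Longrightarrow> x i + t \<le> x (Suc i)"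
      using separated_points[OF E bdd t(1), of "2 ^ j - 1"] by (auto simp: s_def)
    have le: "\<bar>F 0 y\<bar> \<le> (M + real j) * (2 * (b - a) / t) ^ j * \<epsilon>"
    proof (rule sublevel_separated[of "{a..<b}" F "b - a" t M j x \<epsilon> c])
      show "is_interval {a..<b}" by (rule is_interval_co)
      show "x m \<in> {a..<b}" "\<bar>F 0 (x m)\<bar> \<le> \<epsilon>" if "m < 2 ^ j" for m
      proof -
        have "m \<le> 2 ^ j - 1" using that by linarith
        then show "x m \<in> {a..<b}" "\<bar>F 0 (x m)\<bar> \<le> \<epsilon>" using x(1) by (force simp: E_def)+
      qed
      show "x m + t \<le> x (Suc m)" if "Suc m < 2 ^ j" for m
        using that by (intro x(2)) linarith
      show "\<bar>u - v\<bar> \<le> b - a" if "u \<in> {a..<b}" "v \<in> {a..<b}" for u v using that by auto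
      show "t \<le> b - a" using t sL by simp
      show "0 < t" "1 \<le> M" "y \<in> {a..<b}" by fact+
      show "(F i has_real_derivative F (Suc i) y) (at y)" if "y \<in> {a..<b}" for i y
        using that by (rule assms(1))
      show "c \<le> \<bar>F j y\<bar>" "\<bar>F j y\<bar> \<le> M * c" if "y \<in> {a..<b}" for y
        using assms(2,3)[OF that] .
    qed
    \<comment> \<open>The base for \<open>j = n\<close>. It is at least 1 because \<open>s\<close>
      is at most \<open>b - a\<close>, so the exponent may also be raised from \<open>j\<close> to
      \<open>n\<close>.\<close>
    define q where "q = 2 * 2 ^ n * (b - a) / s"
    have "(2 * (b - a) / t) ^ j \<le> q ^ j"
    proof (rule power_mono)
      have "2 * (b - a) / t = 2 * 2 ^ j * (b - a) / s" by (simp add: t_def)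
      also have "\<dots> \<le> q" unfolding q_def using \<open>j \<le> n\<close> ab s
        by (intro divide_right_mono mult_right_mono mult_left_mono power_increasing) auto
      finally show "2 * (b - a) / t \<le> q" .
    qed (use t ab in auto)
    also have "\<dots> \<le> q ^ n"
    proof (rule power_increasing[OF \<open>j \<le> n\<close>])
      have "1 * s \<le> (2 * 2 ^ n) * (b - a)"
        using sL s one_le_power[of "2 :: real" "Suc n"] by (intro mult_mono) auto
      then show "1 \<le> q" using s by (simp add: q_def field_simps)
    qed
    finally have "(M + real j) * (2 * (b - a) / t) ^ j * \<epsilon> \<le> (M + real n) * q ^ n * \<epsilon>"
      using assms(4-6) t(1) ab by (intro mult_right_mono mult_mono) auto
    with le have "\<bar>F 0 y\<bar> * s ^ n \<le> ((M + real n) * q ^ n * \<epsilon>) * s ^ n"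
      using s by (intro mult_right_mono) auto
    also have "\<dots> = (M + real n) * (q * s) ^ n * \<epsilon>" by (simp add: power_mult_distrib)
    also have "q * s = 2 ^ Suc n * (b - a)" using s by (simp add: q_def)
    also have "(2 ^ Suc n * (b - a)) ^ n = 2 ^ (Suc n * n) * (b - a) ^ n"
      by (simp only: power_mult_distrib power_mult)
    finally show ?thesis by (simp add: s_def E_def mult_ac)
  qed
qed

section \<open>Linear combinations of convergent power series\<close>

lemma fps_conv_radius_lincomb:
  fixes \<Psi> :: "'i \<Rightarrow> real fps"
  assumes "\<And>n. n \<in> N \<Longrightarrow> r \<le> fps_conv_radius (\<Psi> n)"
  shows "r \<le> fps_conv_radius (\<Sum>n\<in>N. fps_const (a n) * \<Psi> n)"
  using assms
proof (induction N rule: infinite_finite_induct)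
  case (insert n N)
  have "r \<le> fps_conv_radius (fps_const (a n) * \<Psi> n)"
    using insert.prems by (intro order_trans[OF _ fps_conv_radius_mult]) auto
  then have "r \<le> fps_conv_radius (fps_const (a n) * \<Psi> n + (\<Sum>n\<in>N. fps_const (a n) * \<Psi> n))"
    using insert by (intro order_trans[OF _ fps_conv_radius_add]) auto
  then show ?case using insert.hyps by simp
qed auto

lemma eval_fps_lincomb:
  fixes \<Psi> :: "'i \<Rightarrow> real fps"
  assumes "\<And>n. n \<in> N \<Longrightarrow> r \<le> fps_conv_radius (\<Psi> n)" and "ereal (norm z) < r"
  shows "eval_fps (\<Sum>n\<in>N. fps_const (a n) * \<Psi> n) z = (\<Sum>n\<in>N. a n * eval_fps (\<Psi> n) z)"
  using assms
proof (induction N rule: infinite_finite_induct)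
  case (insert n N)
  have n: "ereal (norm z) < fps_conv_radius (\<Psi> n)"
    using insert.prems by (auto intro: less_le_trans)
  moreover have "min (fps_conv_radius (fps_const (a n))) (fps_conv_radius (\<Psi> n)) \<le> fps_conv_radius (fps_const (a n) * \<Psi> n)"
    by (rule fps_conv_radius_mult)
  ultimately have "ereal (norm z) < fps_conv_radius (fps_const (a n) * \<Psi> n)"
    by (auto intro: less_le_trans)
  moreover have "ereal (norm z) < fps_conv_radius (\<Sum>n\<in>N. fps_const (a n) * \<Psi> n)"
    using insert.prems by (intro less_le_trans[OF _ fps_conv_radius_lincomb[of N r]]) auto
  ultimately show ?case
    using insert n by (simp add: eval_fps_add eval_fps_mult)
qed auto

lemma fps_conv_radius_deriv_funpow:
  fixes F :: "real fps"
  shows "fps_conv_radius F \<le> fps_conv_radius ((fps_deriv ^^ m) F)"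
  by (induction m) (auto intro: order_trans fps_conv_radius_deriv)

lemma fps_deriv_funpow_nth_0:
  fixes F :: "real fps"
  shows "fps_nth ((fps_deriv ^^ m) F) 0 = fact m * fps_nth F m"
proof (induction m arbitrary: F)
  case (Suc m)
  have "fps_nth ((fps_deriv ^^ Suc m) F) 0 = fact m * fps_nth (fps_deriv F) m"
    by (simp only: funpow_Suc_right o_apply Suc)
  then show ?case by (simp add: algebra_simps)
qed simp

text \<open>Gaussian elimination on the Taylor coefficients.\<close>

lemma fps_echelon_basis:
  fixes F :: "'i \<Rightarrow> real fps"
  assumes "finite A" and "\<And>i. i \<in> A \<Longrightarrow> r \<le> fps_conv_radius (F i)"
  shows "\<exists>N \<Psi>. finite N \<and> (\<forall>n\<in>N. r \<le> fps_conv_radius (\<Psi> n)) \<and>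
    (\<forall>n\<in>N. \<forall>l\<in>N. fps_nth (\<Psi> n) l = (if n = l then 1 else 0)) \<and>
    (\<forall>i\<in>A. F i = (\<Sum>n\<in>N. fps_const (fps_nth (F i) n) * \<Psi> n))"
  using assms
proof (induction A rule: finite_induct)
  case empty
  show ?case by (rule exI[of _ "{}"]) auto
next
  case (insert a A)
  then obtain N \<Psi> where N: "finite N" "\<And>n. n \<in> N \<Longrightarrow> r \<le> fps_conv_radius (\<Psi> n)"
    "\<And>n l. n \<in> N \<Longrightarrow> l \<in> N \<Longrightarrow> fps_nth (\<Psi> n) l = (if n = l then 1 else 0)"
    "\<And>i. i \<in> A \<Longrightarrow> F i = (\<Sum>n\<in>N. fps_const (fps_nth (F i) n) * \<Psi> n)"
    by (metis insertCI)
  define S where "S = (\<Sum>n\<in>N. fps_const (fps_nth (F a) n) * \<Psi> n)"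
  define \<phi> where "\<phi> = F a - S"
  have Fa: "F a = \<phi> + S" by (simp add: \<phi>_def)
  show ?case
  proof (cases "\<phi> = 0")
    case True
    then have "F a = S" by (simp add: \<phi>_def)
    then show ?thesis using N unfolding S_def by (intro exI[of _ N] exI[of _ \<Psi>]) auto
  next
    case False
    then obtain l where l: "fps_nth \<phi> l \<noteq> 0" by (auto simp: fps_eq_iff)
    have \<phi>N: "fps_nth \<phi> m = 0" if "m \<in> N" for m
    proof -
      have "fps_nth S m = (\<Sum>n\<in>N. if n = m then fps_nth (F a) n else 0)"
        unfolding S_def fps_sum_nth using that by (intro sum.cong) (auto simp: N(3))
      then show ?thesis using that N(1) by (simp add: \<phi>_def)
    qed
    then have "l \<notin> N" using l by auto
    define \<psi> where "\<psi> = fps_const (1 / fps_nth \<phi> l) * \<phi>"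
    have \<phi>_eq: "\<phi> = fps_const (fps_nth \<phi> l) * \<psi>"
      using l by (simp add: \<psi>_def mult.assoc[symmetric])
    \<comment> \<open>The new pivot \<open>l\<close> is cleared from the old vectors. The old pivots
      survive, because \<open>\<phi>\<close>, and hence \<open>\<psi>\<close>, has zero coefficients
      there.\<close>
    define \<Psi>' where "\<Psi>' = (\<lambda>n. if n = l then \<psi> else \<Psi> n - fps_const (fps_nth (\<Psi> n) l) * \<psi>)"
    have "r \<le> fps_conv_radius S" unfolding S_def using N(2) by (rule fps_conv_radius_lincomb)
    then have "r \<le> fps_conv_radius \<phi>"
      using insert.prems[of a] unfolding \<phi>_def by (intro order_trans[OF _ fps_conv_radius_diff]) auto
    then have r\<psi>: "r \<le> fps_conv_radius \<psi>"
      unfolding \<psi>_def by (intro order_trans[OF _ fps_conv_radius_mult]) auto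
    then have "r \<le> fps_conv_radius (fps_const c * \<psi>)" for c
      by (intro order_trans[OF _ fps_conv_radius_mult]) auto
    then have r\<Psi>: "r \<le> fps_conv_radius (\<Psi> n - fps_const (fps_nth (\<Psi> n) l) * \<psi>)" if "n \<in> N" for n
      using N(2)[OF that] by (intro order_trans[OF _ fps_conv_radius_diff]) auto
    \<comment> \<open>Comparing coefficients at the pivot \<open>l\<close> determines
      \<open>h\<close>, so an expansion in the old basis and \<open>\<psi>\<close> turns into one
      whose coefficients are again read off at the pivots.\<close>
    have span: "H = (\<Sum>n\<in>insert l N. fps_const (fps_nth H n) * \<Psi>' n)"
      if H: "H = fps_const h * \<psi> + (\<Sum>n\<in>N. fps_const (fps_nth H n) * \<Psi> n)" for H h
    proof -
      have "fps_nth H l = h * fps_nth \<psi> l + (\<Sum>n\<in>N. fps_nth H n * fps_nth (\<Psi> n) l)"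
        by (subst H) (simp add: fps_sum_nth)
      moreover have "fps_nth \<psi> l = 1" using l by (simp add: \<psi>_def)
      ultimately have "fps_nth H l = h + (\<Sum>n\<in>N. fps_nth H n * fps_nth (\<Psi> n) l)" by simp
      then have const: "fps_const (fps_nth H l)
          = fps_const h + (\<Sum>n\<in>N. fps_const (fps_nth H n) * fps_const (fps_nth (\<Psi> n) l))"
        by (simp add: fps_eq_iff fps_sum_nth)
      have "(\<Sum>n\<in>N. fps_const (fps_nth H n) * \<Psi>' n)
          = (\<Sum>n\<in>N. fps_const (fps_nth H n) * \<Psi> n - fps_const (fps_nth H n) * fps_const (fps_nth (\<Psi> n) l) * \<psi>)"
        using \<open>l \<notin> N\<close> by (intro sum.cong) (auto simp: \<Psi>'_def ring_distribs mult.assoc)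
      also have "\<dots> = (\<Sum>n\<in>N. fps_const (fps_nth H n) * \<Psi> n)
          - (\<Sum>n\<in>N. fps_const (fps_nth H n) * fps_const (fps_nth (\<Psi> n) l)) * \<psi>"
        by (simp add: sum_subtractf sum_distrib_right)
      finally have "(\<Sum>n\<in>insert l N. fps_const (fps_nth H n) * \<Psi>' n)
          = fps_const h * \<psi> + (\<Sum>n\<in>N. fps_const (fps_nth H n) * \<Psi> n)"
        using \<open>l \<notin> N\<close> N(1) const by (simp add: \<Psi>'_def ring_distribs)
      then show ?thesis using H by simp
    qed
    show ?thesis
    proof (intro exI[of _ "insert l N"] exI[of _ \<Psi>'] conjI ballI)
      show "finite (insert l N)" using N by simp
      show "r \<le> fps_conv_radius (\<Psi>' n)" if "n \<in> insert l N" for n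
        using that r\<psi> r\<Psi> by (auto simp: \<Psi>'_def)
      show "fps_nth (\<Psi>' n) m = (if n = m then 1 else 0)" if "n \<in> insert l N" "m \<in> insert l N" for n m
        using that l \<phi>N N(3) by (auto simp: \<Psi>'_def \<psi>_def)
      show "F i = (\<Sum>n\<in>insert l N. fps_const (fps_nth (F i) n) * \<Psi>' n)" if "i \<in> insert a A" for i
      proof (cases "i = a")
        case True
        have "F a = fps_const (fps_nth \<phi> l) * \<psi> + (\<Sum>n\<in>N. fps_const (fps_nth (F a) n) * \<Psi> n)"
          using Fa \<phi>_eq by (simp add: S_def)
        then show ?thesis using True span by blast
      next
        case False
        then have "F i = fps_const 0 * \<psi> + (\<Sum>n\<in>N. fps_const (fps_nth (F i) n) * \<Psi> n)"
          using that N(4)[of i] by simp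
        then show ?thesis using span by blast
      qed
    qed
  qed
qed

text \<open>In the echelon basis let \<open>j\<close> be the pivot of the coefficient of largest
  modulus. At \<open>x0\<close> the derivative of order \<open>j\<close> sees only that coefficient,
  and on a neighbourhood fixed by the basis alone it stays comparable with it. The ratio of the
  upper to the lower bound then does not depend on the function.\<close>

theorem analytic_span_sublevel_measure:
  fixes F :: "'i \<Rightarrow> real fps" and x0 :: real
  assumes "finite A" and rad: "\<And>i. i \<in> A \<Longrightarrow> ereal R \<le> fps_conv_radius (F i)" and "0 < R"
  shows "\<exists>R'>0. R' \<le> R \<and> (\<exists>n>0. \<exists>C\<ge>1. \<forall>c a b \<epsilon> y f. {a..<b} \<subseteq> {x0 - R'<..<x0 + R'} \<longrightarrow>
    y \<in> {a..<b} \<longrightarrow> 0 < \<epsilon> \<longrightarrow> (\<forall>x\<in>{a..<b}. f x = (\<Sum>i\<in>A. c i * eval_fps (F i) (x - x0))) \<longrightarrow>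
      \<bar>f y\<bar> * measure lebesgue {x \<in> {a..<b}. \<bar>f x\<bar> < \<epsilon>} ^ n \<le> C * \<epsilon> * (b - a) ^ n)"
proof -
  obtain N \<Psi> where N: "finite N" "\<And>n. n \<in> N \<Longrightarrow> ereal R \<le> fps_conv_radius (\<Psi> n)"
    "\<And>n l. n \<in> N \<Longrightarrow> l \<in> N \<Longrightarrow> fps_nth (\<Psi> n) l = (if n = l then 1 else 0)"
    "\<And>i. i \<in> A \<Longrightarrow> F i = (\<Sum>n\<in>N. fps_const (fps_nth (F i) n) * \<Psi> n)"
    using fps_echelon_basis[OF assms(1), of "ereal R" F] rad by metis
  define e where "e = (\<lambda>m n z. eval_fps ((fps_deriv ^^ m) (\<Psi> n)) z)"
  have rad': "ereal (norm z) < fps_conv_radius ((fps_deriv ^^ m) (\<Psi> n))" if "n \<in> N" "\<bar>z\<bar> < R" for m n z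
  proof -
    have "ereal (norm z) < ereal R" using that by simp
    also have "\<dots> \<le> fps_conv_radius ((fps_deriv ^^ m) (\<Psi> n))"
      using N(2)[OF that(1)] fps_conv_radius_deriv_funpow by (rule order_trans)
    finally show ?thesis .
  qed
  have de: "(e m n has_real_derivative e (Suc m) n z) (at z)" if "n \<in> N" "\<bar>z\<bar> < R" for m n z
    using has_field_derivative_eval_fps[OF rad'[OF that, of m], of UNIV] by (simp add: e_def)
  have e0: "e m n 0 = (if n = m then fact m else 0)" if "n \<in> N" "m \<in> N" for m n
    using N(3)[OF that] by (simp add: e_def eval_fps_at_0 fps_deriv_funpow_nth_0)
  \<comment> \<open>Chosen so that \<open>card N\<close> errors of size \<open>B * \<eta>\<close>
    add up to at most \<open>B / 2\<close>.\<close>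
  define \<eta> where "\<eta> = 1 / (2 * (real (card N) + 1))"
  have \<eta>: "0 < \<eta>" "real (card N) * \<eta> \<le> 1 / 2" by (auto simp: \<eta>_def field_simps)
  have "\<forall>\<^sub>F z in nhds 0. \<forall>p\<in>N \<times> N. dist (e (fst p) (snd p) z) (e (fst p) (snd p) 0) < \<eta>"
  proof (rule eventually_ball_finite)
    show "finite (N \<times> N)" using N(1) by simp
    show "\<forall>p\<in>N \<times> N. \<forall>\<^sub>F z in nhds 0. dist (e (fst p) (snd p) z) (e (fst p) (snd p) 0) < \<eta>"
    proof
      fix p assume "p \<in> N \<times> N"
      then have "isCont (e (fst p) (snd p)) 0"
        using \<open>0 < R\<close> by (intro DERIV_isCont[OF de]) auto
      then have "(e (fst p) (snd p) \<longlongrightarrow> e (fst p) (snd p) 0) (nhds 0)"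
        by (simp add: continuous_at tendsto_nhds_iff)
      then show "\<forall>\<^sub>F z in nhds 0. dist (e (fst p) (snd p) z) (e (fst p) (snd p) 0) < \<eta>"
        using \<eta>(1) by (rule tendstoD)
    qed
  qed
  then obtain r where r: "0 < r" "\<And>z m n. \<bar>z\<bar> < r \<Longrightarrow> m \<in> N \<Longrightarrow> n \<in> N \<Longrightarrow> \<bar>e m n z - e m n 0\<bar> < \<eta>"
    by (force simp: eventually_nhds_metric dist_real_def)
  define R' where "R' = min r R"
  \<comment> \<open>Bounds all pivots; the successor keeps the exponent positive even if
    \<open>N\<close> is empty or contains only 0.\<close>
  define n where "n = Suc (Max (insert 0 N))"
  \<comment> \<open>With the lower bound \<open>B / 2\<close> for the derivative,
    \<open>M * (B / 2)\<close> equals \<open>B * fact n + B / 2\<close>, the upper bound found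
    below.\<close>
  define M :: real where "M = 2 * fact n + 1"
  have nN: "m \<le> n" if "m \<in> N" for m
    unfolding n_def using N(1) that by (intro le_SucI Max_ge) auto
  have M1: "1 \<le> M" by (simp add: M_def)
  define C where "C = (M + real n) * 2 ^ (Suc n * n)"
  show ?thesis
  proof (intro exI conjI allI impI)
    show "0 < R'" "R' \<le> R" using r(1) \<open>0 < R\<close> by (auto simp: R'_def)
    show "0 < n" by (simp add: n_def)
    have "1 * 1 \<le> C" unfolding C_def using M1 one_le_power[of "2 :: real"] by (intro mult_mono) auto
    then show "1 \<le> C" by simp
  next
    fix c :: "'i \<Rightarrow> real" and a b \<epsilon> y :: real and f :: "real \<Rightarrow> real"
    assume ab: "{a..<b} \<subseteq> {x0 - R'<..<x0 + R'}" and y: "y \<in> {a..<b}" and "0 < \<epsilon>"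
      and f: "\<forall>x\<in>{a..<b}. f x = (\<Sum>i\<in>A. c i * eval_fps (F i) (x - x0))"
    define \<beta> where "\<beta> = (\<lambda>n. \<Sum>i\<in>A. c i * fps_nth (F i) n)"
    define H where "H = (\<lambda>m x. \<Sum>n\<in>N. \<beta> n * e m n (x - x0))"
    have z: "\<bar>x - x0\<bar> < r" "\<bar>x - x0\<bar> < R" if "x \<in> {a..<b}" for x
      using ab that by (force simp: R'_def)+
    have fH: "f x = H 0 x" if "x \<in> {a..<b}" for x
    proof -
      have "f x = (\<Sum>i\<in>A. c i * (\<Sum>n\<in>N. fps_nth (F i) n * e 0 n (x - x0)))"
      proof (subst f[rule_format, OF that], intro sum.cong refl arg_cong2[where f = "(*)"])
        fix i assume "i \<in> A"
        have "eval_fps (F i) (x - x0) = eval_fps (\<Sum>n\<in>N. fps_const (fps_nth (F i) n) * \<Psi> n) (x - x0)"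
          using N(4)[OF \<open>i \<in> A\<close>] by simp
        also have "\<dots> = (\<Sum>n\<in>N. fps_nth (F i) n * eval_fps (\<Psi> n) (x - x0))"
          using N(2) z(2)[OF that] by (intro eval_fps_lincomb[where r = "ereal R"]) auto
        finally show "eval_fps (F i) (x - x0) = (\<Sum>n\<in>N. fps_nth (F i) n * e 0 n (x - x0))"
          by (simp add: e_def)
      qed
      also have "\<dots> = (\<Sum>n\<in>N. \<Sum>i\<in>A. c i * (fps_nth (F i) n * e 0 n (x - x0)))"
        unfolding sum_distrib_left by (rule sum.swap)
      finally show ?thesis by (simp add: H_def \<beta>_def sum_distrib_right mult.assoc)
    qed
    have dH: "(H m has_real_derivative H (Suc m) x) (at x)" if "x \<in> {a..<b}" for m x
    proof -
      have "((\<lambda>x. e m n (x - x0)) has_real_derivative e (Suc m) n (x - x0)) (at x)" if "n \<in> N" for n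
      proof -
        have "(e m n has_real_derivative e (Suc m) n (x - x0)) (at (x - x0))"
          using de[OF \<open>n \<in> N\<close> z(2)] \<open>x \<in> {a..<b}\<close> .
        then show ?thesis
          using DERIV_shift[of "e m n" "e (Suc m) n (x - x0)" x "- x0"] by simp
      qed
      then show ?thesis unfolding H_def by (intro DERIV_sum DERIV_cmult) auto
    qed
    have E: "{x \<in> {a..<b}. \<bar>f x\<bar> < \<epsilon>} = {x \<in> {a..<b}. \<bar>H 0 x\<bar> < \<epsilon>}" using fH by auto
    show "\<bar>f y\<bar> * measure lebesgue {x \<in> {a..<b}. \<bar>f x\<bar> < \<epsilon>} ^ n \<le> C * \<epsilon> * (b - a) ^ n"
    proof (cases "\<forall>n\<in>N. \<beta> n = 0")
      case True
      then have "f y = 0" using fH[OF y] by (simp add: H_def)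
      then show ?thesis using \<open>0 < \<epsilon>\<close> y M1 by (auto simp: C_def)
    next
      case False
      define B where "B = Max ((\<lambda>n. \<bar>\<beta> n\<bar>) ` N)"
      have B: "\<bar>\<beta> n\<bar> \<le> B" if "n \<in> N" for n
        unfolding B_def using N(1) that by (intro Max_ge) auto
      have "B > 0" using False B by (meson abs_le_zero_iff not_le order_trans)
      have "B \<in> (\<lambda>n. \<bar>\<beta> n\<bar>) ` N" unfolding B_def using N(1) False by (intro Max_in) auto
      then obtain j where j: "j \<in> N" "\<bar>\<beta> j\<bar> = B" by auto
      \<comment> \<open>At the centre only the basis element with pivot \<open>j\<close> has a
        non-zero coefficient of order \<open>j\<close>; elsewhere the deviation is controlled by
        \<open>\<eta>\<close>.\<close>
      have near: "\<bar>H j x - \<beta> j * fact j\<bar> \<le> B / 2" if "x \<in> {a..<b}" for x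
      proof -
        have "(\<Sum>n\<in>N. \<beta> n * e j n 0) = (\<Sum>n\<in>N. if n = j then \<beta> j * fact j else 0)"
          using j(1) by (intro sum.cong) (auto simp: e0)
        then have "H j x - \<beta> j * fact j = (\<Sum>n\<in>N. \<beta> n * (e j n (x - x0) - e j n 0))"
          using N(1) j(1) by (simp add: H_def right_diff_distrib sum_subtractf)
        also have "\<bar>\<dots>\<bar> \<le> (\<Sum>n\<in>N. B * \<eta>)"
        proof (rule order_trans[OF sum_abs], rule sum_mono)
          fix n assume "n \<in> N"
          then show "\<bar>\<beta> n * (e j n (x - x0) - e j n 0)\<bar> \<le> B * \<eta>"
            unfolding abs_mult using B r(2)[OF z(1)[OF that] j(1)] \<open>0 < B\<close>
            by (intro mult_mono) (auto intro: less_imp_le)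
        qed
        also have "\<dots> = B * (real (card N) * \<eta>)" by simp
        also have "\<dots> \<le> B * (1 / 2)" using \<eta>(2) \<open>0 < B\<close> by (intro mult_left_mono) auto
        finally show ?thesis by simp
      qed
      have fj: "\<bar>\<beta> j * fact j\<bar> = B * fact j" using j by (simp add: abs_mult)
      have "B * 1 \<le> B * fact j" using \<open>0 < B\<close> fact_ge_1[of j, where 'a = real] by (intro mult_left_mono) auto
      then have lo: "B / 2 \<le> \<bar>H j x\<bar>" if "x \<in> {a..<b}" for x
        using near[OF that] fj by linarith
      have "B * fact j \<le> B * fact n" using \<open>0 < B\<close> nN[OF j(1)] by (intro mult_left_mono fact_mono) auto
      then have hi: "\<bar>H j x\<bar> \<le> M * (B / 2)" if "x \<in> {a..<b}" for x
      proof -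
        have "\<bar>H j x\<bar> \<le> B * fact n + B / 2"
          using near[OF that] fj \<open>B * fact j \<le> B * fact n\<close> by linarith
        then show ?thesis by (simp add: M_def field_simps)
      qed
      show ?thesis
        unfolding E unfolding fH[OF y] C_def
        by (rule sublevel_measure_le[OF dH lo hi M1 \<open>0 < \<epsilon>\<close> nN[OF j(1)] _ y]) (auto simp: n_def)
    qed
  qed
qed

subsection \<open>Marked points\<close>

text \<open>Indexing by a floor makes the cells of one level a partition by definition and turns
  nesting into integer division.\<close>

definition dyadic_cell :: "real \<Rightarrow> real \<Rightarrow> nat \<Rightarrow> int \<Rightarrow> real set"
  where "dyadic_cell a b m i = {x. \<lfloor>(x - a) / (b - a) * 2 ^ m\<rfloor> = i}"

lemma dyadic_cell_eq:
  assumes "a < b"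
  shows "dyadic_cell a b m i =
    {a + of_int i * (b - a) / 2 ^ m ..< a + of_int i * (b - a) / 2 ^ m + (b - a) / 2 ^ m}"
proof -
  have "(x - a) / (b - a) * 2 ^ m \<ge> of_int i \<longleftrightarrow> a + of_int i * (b - a) / 2 ^ m \<le> x"
    "(x - a) / (b - a) * 2 ^ m < of_int i + 1 \<longleftrightarrow> x < a + of_int i * (b - a) / 2 ^ m + (b - a) / 2 ^ m" for x
  proof -
    have "a + of_int i * (b - a) / 2 ^ m + (b - a) / 2 ^ m = a + (of_int i + 1) * (b - a) / 2 ^ m"
      by (simp add: add_divide_distrib ring_distribs diff_divide_distrib)
    then show "(x - a) / (b - a) * 2 ^ m < of_int i + 1 \<longleftrightarrow>
        x < a + of_int i * (b - a) / 2 ^ m + (b - a) / 2 ^ m"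
      using assms by (simp only:) (simp add: field_simps)
  qed (use assms in \<open>simp add: field_simps\<close>)
  then show ?thesis by (auto simp: dyadic_cell_def floor_eq_iff)
qed

lemma dyadic_cell_0: "a < b \<Longrightarrow> dyadic_cell a b 0 0 = {a..<b}"
  by (simp add: dyadic_cell_eq)

lemma dyadic_cell_mono:
  assumes "l \<le> m" and "y \<in> dyadic_cell a b m i"
  shows "y \<in> dyadic_cell a b l (i div 2 ^ (m - l))"
proof -
  let ?z = "(y - a) / (b - a)"
  have "(2 :: real) ^ m = 2 ^ l * 2 ^ (m - l)"
    using assms(1) by (simp add: power_add[symmetric])
  then have "?z * 2 ^ l = ?z * 2 ^ m / of_int (2 ^ (m - l))"
    by simp
  then have "\<lfloor>?z * 2 ^ l\<rfloor> = \<lfloor>?z * 2 ^ m\<rfloor> div 2 ^ (m - l)"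
    by (simp only: floor_divide_real_eq_div[OF zero_le_power[OF zero_le_numeral]])
  then show ?thesis using assms(2) by (simp add: dyadic_cell_def)
qed

lemma dyadic_cell_unique: "y \<in> dyadic_cell a b m i \<Longrightarrow> y \<in> dyadic_cell a b m j \<Longrightarrow> i = j"
  by (simp add: dyadic_cell_def)

text \<open>Each step adds one exceptional set for the new flag member to those of the remaining
  flag. The factor 2 is the ratio of the length of a parent cell to that of the selected
  cell.\<close>

fun marking_const :: "nat \<Rightarrow> real"
  where
    "marking_const 0 = 0"
  | "marking_const (Suc n) = 2 * (marking_const n + 1)"

lemma marking_const_nonneg: "0 \<le> marking_const n"
  by (induction n) auto

text \<open>The marked points of Kleinbock and Margulis, with an abstract relation in place of
  strict inclusion of subspaces. The last conjunct is a maximality condition: whatever could extend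
  the flag is already at least \<rho> at \<open>x\<close>. The empty flag marks the points where all
  of \<open>P\<close> is at least \<rho>.\<close>

definition marked :: "('p \<Rightarrow> 'p \<Rightarrow> bool) \<Rightarrow> ('p \<Rightarrow> real \<Rightarrow> real) \<Rightarrow> real \<Rightarrow> real \<Rightarrow> 'p set \<Rightarrow> real \<Rightarrow> bool"
  where "marked cmp \<psi> \<epsilon> \<rho> P x \<longleftrightarrow>
    (\<exists>F\<subseteq>P. (\<forall>p\<in>F. \<forall>q\<in>F. p = q \<or> cmp p q) \<and>
      (\<forall>p\<in>F. \<epsilon> \<le> \<psi> p x \<and> \<psi> p x < \<rho>) \<and> (\<forall>q\<in>P. (\<forall>p\<in>F. cmp q p) \<longrightarrow> \<rho> \<le> \<psi> q x))"

text \<open>A point is marked by a flag \<open>F\<close> of pairwise comparable indices. The induction is on the number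
  of ranks: on a maximal dyadic cell where some \<open>\<psi> p\<close> stays below \<open>\<rho>\<close>, the index \<open>p\<close> joins the
  flag, and the hypothesis is applied on the parent cell, where by maximality no function stays
  below \<open>\<rho>\<close>.\<close>

lemma marked_points:
  fixes \<psi> :: "'p \<Rightarrow> real \<Rightarrow> real" and cmp :: "'p \<Rightarrow> 'p \<Rightarrow> bool" and rk :: "'p \<Rightarrow> nat"
  assumes cmp_sym: "\<And>p q. cmp p q \<Longrightarrow> cmp q p"
    and cmp_rk: "\<And>p q. cmp p q \<Longrightarrow> rk p \<noteq> rk q"
    and cont: "\<And>p. p \<in> P\<^sub>0 \<Longrightarrow> continuous_on {lo..<hi} (\<psi> p)"
    and good: "\<And>p a b y. p \<in> P\<^sub>0 \<Longrightarrow> lo \<le> a \<Longrightarrow> a < b \<Longrightarrow> b \<le> hi \<Longrightarrow> y \<in> {a..<b} \<Longrightarrow> \<rho> \<le> \<psi> p y \<Longrightarrow>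
      \<exists>S\<in>sets lebesgue. {x \<in> {a..<b}. \<psi> p x < \<epsilon>} \<subseteq> S \<and> emeasure lebesgue S \<le> ennreal (\<eta> * (b - a))"
    and "0 \<le> \<eta>"
    and "P \<subseteq> P\<^sub>0" "finite (rk ` P)" "card (rk ` P) \<le> n" "lo \<le> a" "a < b" "b \<le> hi"
    and "\<And>p. p \<in> P \<Longrightarrow> \<exists>y\<in>{a..<b}. \<rho> \<le> \<psi> p y"
  shows "\<exists>N\<in>sets lebesgue. emeasure lebesgue N \<le> ennreal (marking_const n * \<eta> * (b - a)) \<and>
    (\<forall>x\<in>{a..<b} - N. marked cmp \<psi> \<epsilon> \<rho> P x)"
  using assms(6-)
proof (induction n arbitrary: P a b)
  case 0
  then have "P = {}" by auto
  then show ?case by (intro bexI[of _ "{}"]) (auto simp: marked_def)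
next
  case (Suc n)
  note ab = \<open>a < b\<close>
  let ?K = "marking_const n"
  define c where "c = dyadic_cell a b"
  have c_eq: "c m i = {a + of_int i * (b - a) / 2 ^ m ..< a + of_int i * (b - a) / 2 ^ m + (b - a) / 2 ^ m}" for m i
    unfolding c_def using ab by (rule dyadic_cell_eq)
  have c0: "c 0 0 = {a..<b}" unfolding c_def using ab by (rule dyadic_cell_0)
  have c_mono: "y \<in> c l (i div 2 ^ (m - l))" if "l \<le> m" "y \<in> c m i" for l m y i
    using dyadic_cell_mono that unfolding c_def .
  have c_unique: "i = j" if "y \<in> c m i" "y \<in> c m j" for m y i j
    using dyadic_cell_unique that unfolding c_def .
  define idx where "idx = (\<lambda>m x. \<lfloor>(x - a) / (b - a) * 2 ^ m\<rfloor>)"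
  have idx: "x \<in> c m (idx m x)" for m x by (simp add: c_def idx_def dyadic_cell_def)
  have c_sub: "c m i \<subseteq> {a..<b}" if "x \<in> {a..<b}" "x \<in> c m i" for m i x
  proof -
    have "i div 2 ^ (m - 0) = 0" using c_mono[of 0 m x i] c_unique[of x 0 _ 0] that c0 by auto
    then show ?thesis using c_mono[of 0 m _ i] c0 by auto
  qed
  define bad where "bad = (\<lambda>m i. c m i \<subseteq> {a..<b} \<and> (\<exists>p\<in>P. \<forall>y\<in>c m i. \<psi> p y < \<rho>))"
  \<comment> \<open>In a pair \<open>(m, i)\<close> the level \<open>m\<close> is that of the
    parent: the selected cell is \<open>c (Suc m) i\<close>. A parent that is not bad is enough for
    maximality, since subcells of bad cells are bad.\<close>
  define Sel where "Sel = {(m, i). bad (Suc m) i \<and> \<not> bad m (i div 2)}"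
  have Sel_iff: "(m, i) \<in> Sel \<longleftrightarrow> bad (Suc m) i \<and> \<not> bad m (i div 2)" for m i
    by (simp add: Sel_def)
  have parent: "c (Suc m) i \<subseteq> c m (i div 2)" for m i
    using c_mono[of m "Suc m" _ i] by auto
  have sel_ne: "c (Suc m) i \<noteq> {}" for m i using ab by (auto simp: c_eq)
  have disj: "disjoint_family_on (\<lambda>(m, i). c (Suc m) i) Sel"
  proof -
    \<comment> \<open>If selected cells of different levels met, the parent of the finer one would
      lie inside the coarser bad cell and be bad itself.\<close>
    have False if "(m, i) \<in> Sel" "(m', i') \<in> Sel" "m < m'" "x \<in> c (Suc m) i" "x \<in> c (Suc m') i'" for m i m' i' x
    proof -
      have x: "x \<in> c m' (i' div 2)" using parent that(5) by blast
      have "c m' (i' div 2) \<subseteq> c (Suc m) i"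
        using c_mono[of "Suc m" m' _ "i' div 2"] c_unique[OF c_mono[of "Suc m" m' x "i' div 2"] that(4)]
          \<open>m < m'\<close> x by auto
      then have "bad m' (i' div 2)" using that(1) unfolding Sel_iff bad_def by blast
      then show False using that(2) by (simp add: Sel_iff)
    qed
    then show ?thesis
      unfolding disjoint_family_on_def using c_unique
      by (auto, metis linorder_neqE_nat, metis linorder_neqE_nat)
  qed
  have "\<exists>N\<in>sets lebesgue. N \<subseteq> c (Suc m) i \<and>
      emeasure lebesgue N \<le> ennreal (marking_const (Suc n) * \<eta>) * emeasure lebesgue (c (Suc m) i) \<and>
      (\<forall>x\<in>c (Suc m) i - N. marked cmp \<psi> \<epsilon> \<rho> P x)"
    if "(m, i) \<in> Sel" for m i
  proof -
    obtain p where p: "p \<in> P" "\<And>y. y \<in> c (Suc m) i \<Longrightarrow> \<psi> p y < \<rho>" and sub: "c (Suc m) i \<subseteq> {a..<b}"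
      using \<open>(m, i) \<in> Sel\<close> unfolding Sel_iff bad_def by blast
    obtain x0 where "x0 \<in> c (Suc m) i" using sel_ne by blast
    then have "c m (i div 2) \<subseteq> {a..<b}" using c_sub[of x0 m "i div 2"] sub parent by blast
    then have nb: "\<exists>y\<in>c m (i div 2). \<rho> \<le> \<psi> q y" if "q \<in> P" for q
      using \<open>(m, i) \<in> Sel\<close> that unfolding Sel_iff bad_def not_le[symmetric] by blast
    define a' where "a' = a + of_int (i div 2) * (b - a) / 2 ^ m"
    define b' where "b' = a' + (b - a) / 2 ^ m"
    have c': "c m (i div 2) = {a'..<b'}" by (simp add: c_eq a'_def b'_def)
    have ab': "a' < b'" using ab by (simp add: b'_def)
    have len: "emeasure lebesgue (c (Suc m) i) = ennreal ((b' - a') / 2)"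
      using ab by (simp add: c_eq b'_def)
    have "{a'..<b'} \<subseteq> {a..<b}" using \<open>c m (i div 2) \<subseteq> {a..<b}\<close> c' by simp
    then have aa: "a \<le> a'" "b' \<le> b"
      using ab' by (auto simp: atLeastLessThan_subset_iff)
    then have lohi: "lo \<le> a'" "b' \<le> hi" using Suc.prems by auto
    \<comment> \<open>Comparable indices have different ranks, so passing to them removes the rank
      of \<open>p\<close> and the induction hypothesis applies.\<close>
    define P' where "P' = {q \<in> P. cmp q p}"
    have sub': "rk ` P' \<subseteq> rk ` P - {rk p}" using cmp_rk by (auto simp: P'_def)
    have "card (rk ` P') \<le> card (rk ` P - {rk p})" using sub' Suc.prems(2) by (intro card_mono) auto
    also have "\<dots> \<le> n" using Suc.prems(2,3) p(1) by auto
    finally have card': "card (rk ` P') \<le> n" .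
    have fin': "finite (rk ` P')" using sub' finite_Diff[OF Suc.prems(2)] by (rule finite_subset)
    have P'0: "P' \<subseteq> P\<^sub>0" using Suc.prems(1) by (auto simp: P'_def)
    have nb': "\<exists>y\<in>{a'..<b'}. \<rho> \<le> \<psi> q y" if "q \<in> P'" for q
      using nb that unfolding c' P'_def by blast
    note IH = Suc.IH[OF P'0 fin' card' lohi(1) ab' lohi(2)]
    obtain N where N: "N \<in> sets lebesgue" "emeasure lebesgue N \<le> ennreal (?K * \<eta> * (b' - a'))"
      and NF: "\<forall>x\<in>{a'..<b'} - N. marked cmp \<psi> \<epsilon> \<rho> P' x"
      by (rule bexE[OF IH[OF nb']]) (assumption, elim conjE, rule that)
    \<comment> \<open>The power law needs a point where \<open>\<psi> p\<close> reaches
      \<open>\<rho>\<close>; it exists on the parent but not on the selected cell.\<close>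
    obtain y where y: "y \<in> {a'..<b'}" "\<rho> \<le> \<psi> p y" using nb[OF p(1)] c' by auto
    have "p \<in> P\<^sub>0" using p(1) Suc.prems(1) by blast
    from good[OF this lohi(1) ab' lohi(2) y] obtain S where S: "S \<in> sets lebesgue"
      "{x \<in> {a'..<b'}. \<psi> p x < \<epsilon>} \<subseteq> S" "emeasure lebesgue S \<le> ennreal (\<eta> * (b' - a'))"
      by (elim bexE conjE) (rule that)
    show ?thesis
    proof (intro bexI conjI ballI)
      show meas: "(N \<union> S) \<inter> c (Suc m) i \<in> sets lebesgue" using N(1) S(1) by (auto simp: c_eq)
      show "(N \<union> S) \<inter> c (Suc m) i \<subseteq> c (Suc m) i" by simp
      have "emeasure lebesgue ((N \<union> S) \<inter> c (Suc m) i) \<le> emeasure lebesgue (N \<union> S)"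
        using N(1) S(1) by (intro emeasure_mono) auto
      also have "\<dots> \<le> emeasure lebesgue N + emeasure lebesgue S"
        using N(1) S(1) by (rule emeasure_subadditive)
      also have "\<dots> \<le> ennreal (?K * \<eta> * (b' - a')) + ennreal (\<eta> * (b' - a'))"
        using N(2) S(3) by (rule add_mono)
      also have "\<dots> = ennreal (?K * \<eta> * (b' - a') + \<eta> * (b' - a'))"
        using ab' \<open>0 \<le> \<eta>\<close> marking_const_nonneg[of n] by (intro ennreal_plus[symmetric] mult_nonneg_nonneg) auto
      also have "?K * \<eta> * (b' - a') + \<eta> * (b' - a') = (marking_const (Suc n) * \<eta>) * ((b' - a') / 2)"
        by (simp add: field_simps)
      also have "ennreal \<dots> = ennreal (marking_const (Suc n) * \<eta>) * emeasure lebesgue (c (Suc m) i)"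
        unfolding len using \<open>0 \<le> \<eta>\<close> ab' marking_const_nonneg[of "Suc n"]
        by (intro ennreal_mult mult_nonneg_nonneg) auto
      finally show "emeasure lebesgue ((N \<union> S) \<inter> c (Suc m) i)
        \<le> ennreal (marking_const (Suc n) * \<eta>) * emeasure lebesgue (c (Suc m) i)" .
    next
      fix x assume x: "x \<in> c (Suc m) i - (N \<union> S) \<inter> c (Suc m) i"
      then have x': "x \<in> {a'..<b'} - N" "x \<notin> S" "x \<in> c (Suc m) i" using parent[of m i] unfolding c' by blast+
      obtain F where F: "F \<subseteq> P'" "\<forall>p\<in>F. \<forall>q\<in>F. p = q \<or> cmp p q" "\<forall>p\<in>F. \<epsilon> \<le> \<psi> p x \<and> \<psi> p x < \<rho>"
        "\<forall>q\<in>P'. (\<forall>p\<in>F. cmp q p) \<longrightarrow> \<rho> \<le> \<psi> q x" using NF[rule_format, OF x'(1)] unfolding marked_def by (elim exE conjE) (rule that)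
      have "\<epsilon> \<le> \<psi> p x" "\<psi> p x < \<rho>" using S(2) x' p(2) by (auto simp: subset_iff not_less)
      moreover have "cmp p q" "cmp q p" if "q \<in> F" for q using F(1) that cmp_sym by (auto simp: P'_def)
      \<comment> \<open>On the selected cell \<open>\<psi> p\<close> is below \<open>\<rho>\<close>,
        and outside \<open>S\<close> it is at least \<open>\<epsilon>\<close>. An index comparable
        with the enlarged flag is comparable with \<open>p\<close>, so it lies in \<open>P'\<close>
        and is covered by the maximality of \<open>F\<close>.\<close>
      ultimately show "marked cmp \<psi> \<epsilon> \<rho> P x"
        unfolding marked_def using F p(1) by (intro exI[of _ "insert p F"]) (auto simp: P'_def)
    qed
  qed
  then have "\<forall>s\<in>Sel. \<exists>N. N \<in> sets lebesgue \<and> N \<subseteq> c (Suc (fst s)) (snd s) \<and>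
      emeasure lebesgue N \<le> ennreal (marking_const (Suc n) * \<eta>) * emeasure lebesgue (c (Suc (fst s)) (snd s)) \<and>
      (\<forall>x\<in>c (Suc (fst s)) (snd s) - N. marked cmp \<psi> \<epsilon> \<rho> P x)"
    by (metis (no_types, lifting) prod.collapse)
  from bchoice[OF this] obtain N where N: "\<And>m i. (m, i) \<in> Sel \<Longrightarrow> N (m, i) \<in> sets lebesgue \<and> N (m, i) \<subseteq> c (Suc m) i \<and>
      emeasure lebesgue (N (m, i)) \<le> ennreal (marking_const (Suc n) * \<eta>) * emeasure lebesgue (c (Suc m) i) \<and>
      (\<forall>x\<in>c (Suc m) i - N (m, i). marked cmp \<psi> \<epsilon> \<rho> P x)"
    by (metis (no_types, lifting) fst_conv snd_conv)
  define C where "C = (\<lambda>s. c (Suc (fst s)) (snd s))"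
  have NC: "N s \<in> sets lebesgue" "N s \<subseteq> C s"
      "emeasure lebesgue (N s) \<le> ennreal (marking_const (Suc n) * \<eta>) * emeasure lebesgue (C s)" if "s \<in> Sel" for s
    using N[of "fst s" "snd s"] that by (auto simp: C_def)
  have dC: "disjoint_family_on C Sel" using disj by (simp add: C_def case_prod_beta')
  then have dN: "disjoint_family_on N Sel"
    using NC(2) by (fastforce simp: disjoint_family_on_def)
  have mC: "C s \<in> sets lebesgue" for s by (simp add: C_def c_eq)
  have cS: "countable Sel" by simp
  \<comment> \<open>The local bounds are proportional to the lengths of the selected cells, which
    are disjoint and contained in the interval, so their sum costs no further factor.\<close>
  have "emeasure lebesgue (\<Union>s\<in>Sel. N s) = (\<integral>\<^sup>+s. emeasure lebesgue (N s) \<partial>count_space Sel)"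
    using NC(1) cS dN by (intro emeasure_UN_countable) auto
  also have "\<dots> \<le> (\<integral>\<^sup>+s. ennreal (marking_const (Suc n) * \<eta>) * emeasure lebesgue (C s) \<partial>count_space Sel)"
    using NC(3) by (intro nn_integral_mono) auto
  also have "\<dots> = ennreal (marking_const (Suc n) * \<eta>) * (\<integral>\<^sup>+s. emeasure lebesgue (C s) \<partial>count_space Sel)"
    by (rule nn_integral_cmult) auto
  also have "(\<integral>\<^sup>+s. emeasure lebesgue (C s) \<partial>count_space Sel) = emeasure lebesgue (\<Union>s\<in>Sel. C s)"
    using mC cS dC by (intro emeasure_UN_countable[symmetric]) auto
  also have "ennreal (marking_const (Suc n) * \<eta>) * emeasure lebesgue (\<Union>s\<in>Sel. C s)
      \<le> ennreal (marking_const (Suc n) * \<eta>) * ennreal (b - a)"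
  proof (rule mult_left_mono)
    have "emeasure lebesgue (\<Union>s\<in>Sel. C s) \<le> emeasure lebesgue {a..<b}"
      by (intro emeasure_mono) (auto simp: C_def Sel_def bad_def)
    then show "emeasure lebesgue (\<Union>s\<in>Sel. C s) \<le> ennreal (b - a)" using ab by simp
  qed simp
  also have "ennreal (marking_const (Suc n) * \<eta>) * ennreal (b - a) = ennreal (marking_const (Suc n) * \<eta> * (b - a))"
    using ab \<open>0 \<le> \<eta>\<close> marking_const_nonneg[of "Suc n"] by (intro ennreal_mult[symmetric] mult_nonneg_nonneg) auto
  finally have meas: "emeasure lebesgue (\<Union>s\<in>Sel. N s) \<le> ennreal (marking_const (Suc n) * \<eta> * (b - a))" .
  show ?case
  proof (intro bexI[of _ "\<Union>s\<in>Sel. N s"] conjI ballI)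
    show "(\<Union>s\<in>Sel. N s) \<in> sets lebesgue" using NC(1) cS by (intro sets.countable_UN') auto
    show "emeasure lebesgue (\<Union>s\<in>Sel. N s) \<le> ennreal (marking_const (Suc n) * \<eta> * (b - a))" by (rule meas)
    fix x assume x: "x \<in> {a..<b} - (\<Union>s\<in>Sel. N s)"
    show "marked cmp \<psi> \<epsilon> \<rho> P x"
    proof (cases "\<exists>m. bad m (idx m x)")
      case True
      define m where "m = (LEAST m. bad m (idx m x))"
      have m: "bad m (idx m x)" unfolding m_def using True by (rule LeastI_ex)
      \<comment> \<open>Every index reaches \<open>\<rho>\<close> somewhere on the whole interval,
        so the first bad cell around \<open>x\<close> has a parent.\<close>
      have "\<not> bad 0 0" using Suc.prems(7) c0 by (force simp: bad_def)
      moreover have "idx 0 x = 0" using c_unique[OF idx[of x 0], of 0] c0 x by auto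
      ultimately obtain m' where m': "m = Suc m'" using m by (cases m) auto
      have "\<not> bad m' (idx m' x)" using not_less_Least[of m' "\<lambda>m. bad m (idx m x)"] m' by (simp add: m_def)
      moreover have "idx m' x = idx m x div 2"
        using c_unique[OF idx[of x m']] parent[of m' "idx m x"] idx[of x m] m' by auto
      ultimately have sel: "(m', idx m x) \<in> Sel" using m m' by (simp add: Sel_def)
      moreover have "x \<in> c (Suc m') (idx m x) - N (m', idx m x)" using x sel idx m' by auto
      ultimately show ?thesis using N by blast
    next
      case False
      \<comment> \<open>Otherwise, by continuity, \<open>\<psi> q\<close> would stay below
        \<open>\<rho>\<close> on a small dyadic cell around \<open>x\<close>, and that cell would be
        bad. Hence the empty flag marks \<open>x\<close>.\<close>
      have "\<rho> \<le> \<psi> q x" if q: "q \<in> P" for q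
      proof (rule ccontr)
        assume "\<not> \<rho> \<le> \<psi> q x"
        then have lt: "0 < \<rho> - \<psi> q x" by simp
        have "continuous_on {lo..<hi} (\<psi> q)" using cont q Suc.prems(1) by blast
        moreover have "x \<in> {lo..<hi}" using x Suc.prems(4,6) by auto
        ultimately obtain d where d: "0 < d" "\<And>y. y \<in> {lo..<hi} \<Longrightarrow> dist y x < d \<Longrightarrow> dist (\<psi> q y) (\<psi> q x) < \<rho> - \<psi> q x"
          using lt unfolding continuous_on_iff by blast
        obtain m where "(1 / 2) ^ m < d / (b - a)"
          using real_arch_pow_inv[of "d / (b - a)" "1 / 2"] d(1) ab by auto
        then have m: "(b - a) / 2 ^ m < d" using ab by (simp add: field_simps power_one_over)
        have sub: "c m (idx m x) \<subseteq> {a..<b}" using c_sub[of x m] idx x by auto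
        have "\<psi> q y < \<rho>" if "y \<in> c m (idx m x)" for y
        proof -
          have "\<bar>y - x\<bar> < (b - a) / 2 ^ m"
            using that idx[of x m] unfolding c_eq atLeastLessThan_iff by linarith
          then have "dist y x < d" using m by (simp add: dist_real_def)
          moreover have "y \<in> {lo..<hi}" using that sub Suc.prems(4,6) by force
          ultimately show ?thesis using d(2) by (force simp: dist_real_def)
        qed
        then have "bad m (idx m x)" using sub q by (auto simp: bad_def)
        then show False using False by blast
      qed
      then show ?thesis unfolding marked_def by (intro exI[of _ "{}"]) auto
    qed
  qed
qed

subsection \<open>Minors and integral tuples\<close>

definition minor :: "nat \<Rightarrow> (nat \<Rightarrow> nat \<Rightarrow> real) \<Rightarrow> (nat \<Rightarrow> nat) \<Rightarrow> real"
  where "minor r A f = fdet r (\<lambda>i j. A (f i) j)"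

definition mprod :: "nat \<Rightarrow> (nat \<Rightarrow> nat \<Rightarrow> real) \<Rightarrow> (nat \<Rightarrow> nat \<Rightarrow> real) \<Rightarrow> nat \<Rightarrow> nat \<Rightarrow> real"
  where "mprod k A B = (\<lambda>i j. \<Sum>p<k. A i p * B p j)"

definition max_minor :: "nat \<Rightarrow> nat \<Rightarrow> (nat \<Rightarrow> nat \<Rightarrow> real) \<Rightarrow> real"
  where "max_minor k r A = Max ((\<lambda>f. \<bar>minor r A f\<bar>) ` ({..<r} \<rightarrow>\<^sub>E {..<k}))"

lemma minor_cong:
  assumes "\<And>i j. i < r \<Longrightarrow> j < r \<Longrightarrow> A (f i) j = B (g i) j"
  shows "minor r A f = minor r B g"
  unfolding minor_def using assms by (rule fdet_cong)

lemma abs_minor_le_max_minor: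
  assumes "\<And>i. i < r \<Longrightarrow> f i < k"
  shows "\<bar>minor r A f\<bar> \<le> max_minor k r A"
proof -
  have "restrict f {..<r} \<in> {..<r} \<rightarrow>\<^sub>E {..<k}" using assms by auto
  moreover have "minor r A f = minor r A (restrict f {..<r})" by (rule minor_cong) simp
  ultimately show ?thesis unfolding max_minor_def by (intro Max_ge) (auto intro: finite_PiE)
qed

lemma max_minor_attained:
  assumes "0 < k"
  obtains f where "f \<in> {..<r} \<rightarrow>\<^sub>E {..<k}" "max_minor k r A = \<bar>minor r A f\<bar>"
proof -
  have "{..<r} \<rightarrow>\<^sub>E {..<k} \<noteq> {}" using assms by (auto simp: PiE_eq_empty_iff)
  then have "max_minor k r A \<in> (\<lambda>f. \<bar>minor r A f\<bar>) ` ({..<r} \<rightarrow>\<^sub>E {..<k})"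
    unfolding max_minor_def by (intro Max_in) (auto intro: finite_PiE)
  then show thesis using that by auto
qed

lemma max_minor_nonneg: "0 < k \<Longrightarrow> 0 \<le> max_minor k r A"
  by (metis max_minor_attained abs_ge_zero)

lemma max_minor_0 [simp]: "max_minor k 0 A = 1"
  by (simp add: max_minor_def minor_def)

lemma max_minor_cong:
  assumes "\<And>i j. i < k \<Longrightarrow> j < r \<Longrightarrow> A i j = B i j"
  shows "max_minor k r A = max_minor k r B"
  unfolding max_minor_def
  by (intro arg_cong[where f = Max] image_cong refl arg_cong[where f = abs] minor_cong)
    (auto intro!: assms)

lemma minor_mprod: "minor r (mprod r A M) f = fdet r M * minor r A f"
  unfolding minor_def mprod_def using fdet_mult[of r "\<lambda>i. A (f i)" M] by simp

text \<open>Column operations multiply all minors by the same determinant, so a change of basis acts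
  on the maximum as on a covolume.\<close>

lemma max_minor_mprod:
  assumes "0 < k"
  shows "max_minor k r (mprod r A M) = \<bar>fdet r M\<bar> * max_minor k r A"
proof (rule antisym)
  obtain f where f: "f \<in> {..<r} \<rightarrow>\<^sub>E {..<k}" "max_minor k r (mprod r A M) = \<bar>minor r (mprod r A M) f\<bar>"
    using assms by (rule max_minor_attained)
  have "\<bar>minor r A f\<bar> \<le> max_minor k r A" using f(1) by (intro abs_minor_le_max_minor) auto
  then show "max_minor k r (mprod r A M) \<le> \<bar>fdet r M\<bar> * max_minor k r A"
    unfolding f(2) minor_mprod abs_mult by (intro mult_left_mono) auto
  obtain f where f: "f \<in> {..<r} \<rightarrow>\<^sub>E {..<k}" "max_minor k r A = \<bar>minor r A f\<bar>"
    using assms by (rule max_minor_attained)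
  have "\<bar>fdet r M\<bar> * max_minor k r A = \<bar>minor r (mprod r A M) f\<bar>"
    unfolding f(2) minor_mprod abs_mult ..
  also have "\<dots> \<le> max_minor k r (mprod r A M)" using f(1) by (intro abs_minor_le_max_minor) auto
  finally show "\<bar>fdet r M\<bar> * max_minor k r A \<le> max_minor k r (mprod r A M)" .
qed

lemma mprod_assoc: "mprod k h (mprod r T M) = mprod r (mprod k h T) M"
  unfolding mprod_def
  by (intro ext, simp add: sum_distrib_left sum_distrib_right mult.assoc) (rule sum.swap)

lemma mprod_cong:
  assumes "\<And>p j. p < k \<Longrightarrow> j < r \<Longrightarrow> A p j = B p j" "j < r"
  shows "mprod k h A i j = mprod k h B i j"
  unfolding mprod_def using assms by (intro sum.cong) auto

text \<open>Expansion along the new column: \<open>Suc r\<close> terms, each an entry below \<tau>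
  times a minor of the old columns. A positive \<mu> keeps the inequality strict when these minors
  vanish.\<close>

lemma max_minor_Suc_less:
  assumes "0 < k" and "\<And>i. i < k \<Longrightarrow> \<bar>A i r\<bar> < \<tau>" and "max_minor k r A \<le> \<mu>" and "0 < \<mu>"
  shows "max_minor k (Suc r) A < real (Suc r) * (\<tau> * \<mu>)"
proof -
  obtain f where f: "f \<in> {..<Suc r} \<rightarrow>\<^sub>E {..<k}" "max_minor k (Suc r) A = \<bar>minor (Suc r) A f\<bar>"
    using assms(1) by (rule max_minor_attained)
  have fk: "f i < k" if "i < Suc r" for i using f(1) that by auto
  have "\<bar>minor (Suc r) A f\<bar> \<le> (\<Sum>i<Suc r. \<bar>A (f i) r * ((-1) ^ (i + r) * minor r A (\<lambda>i'. f (if i' < i then i' else Suc i')))\<bar>)"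
    unfolding minor_def fdet_expand_column by (rule sum_abs)
  also have "\<dots> = (\<Sum>i<Suc r. \<bar>A (f i) r\<bar> * \<bar>minor r A (\<lambda>i'. f (if i' < i then i' else Suc i'))\<bar>)"
    by (simp add: abs_mult power_abs)
  also have "\<dots> < (\<Sum>i<Suc r. \<tau> * \<mu>)"
  proof (rule sum_strict_mono)
    fix i assume i: "i \<in> {..<Suc r}"
    have "\<bar>minor r A (\<lambda>i'. f (if i' < i then i' else Suc i'))\<bar> \<le> max_minor k r A"
      by (intro abs_minor_le_max_minor fk) auto
    then have "\<bar>A (f i) r\<bar> * \<bar>minor r A (\<lambda>i'. f (if i' < i then i' else Suc i'))\<bar> \<le> \<bar>A (f i) r\<bar> * \<mu>"
      using assms(3) by (intro mult_left_mono) auto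
    also have "\<dots> < \<tau> * \<mu>" using assms(2)[OF fk] i \<open>0 < \<mu>\<close> by (intro mult_strict_right_mono) auto
    finally show "\<bar>A (f i) r\<bar> * \<bar>minor r A (\<lambda>i'. f (if i' < i then i' else Suc i'))\<bar> < \<tau> * \<mu>" .
  qed auto
  finally show ?thesis using f(2) by simp
qed

section \<open>Column spans and adjunction of a column\<close>

definition in_col_span :: "nat \<Rightarrow> nat \<Rightarrow> (nat \<Rightarrow> nat \<Rightarrow> real) \<Rightarrow> (nat \<Rightarrow> real) \<Rightarrow> bool"
  where "in_col_span k r T v \<longleftrightarrow> (\<exists>c. \<forall>p<k. v p = (\<Sum>i<r. T p i * c i))"

text \<open>Inclusion of real column spaces, expressed by a coefficient matrix because the
  determinant of this matrix is what compares sizes. The first component of a pair counts the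
  relevant columns of a total array.\<close>

definition col_span_le :: "nat \<Rightarrow> nat \<times> (nat \<Rightarrow> nat \<Rightarrow> real) \<Rightarrow> nat \<times> (nat \<Rightarrow> nat \<Rightarrow> real) \<Rightarrow> bool"
  where "col_span_le k t s \<longleftrightarrow> (\<exists>M. \<forall>p<k. \<forall>j<fst t. snd t p j = mprod (fst s) (snd s) M p j)"

definition snoc_col :: "nat \<Rightarrow> (nat \<Rightarrow> nat \<Rightarrow> real) \<Rightarrow> (nat \<Rightarrow> real) \<Rightarrow> nat \<Rightarrow> nat \<Rightarrow> real"
  where "snoc_col r T v = (\<lambda>p j. if j < r then T p j else v p)"

lemma col_span_le_refl: "col_span_le k t t"
proof -
  have "snd t p j = mprod (fst t) (snd t) (\<lambda>i j. if i = j then 1 else 0) p j" if "j < fst t" for p j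
    using that by (simp add: mprod_def if_distrib[where f = "\<lambda>x. _ * x"] sum.delta cong: if_cong)
  then show ?thesis
    unfolding col_span_le_def by (intro exI[of _ "\<lambda>i j. if i = j then 1 else 0"]) auto
qed

lemma col_span_le_trans:
  assumes "col_span_le k t s" "col_span_le k s u"
  shows "col_span_le k t u"
proof -
  obtain M N where M: "\<And>p j. p < k \<Longrightarrow> j < fst t \<Longrightarrow> snd t p j = mprod (fst s) (snd s) M p j"
    and N: "\<And>p j. p < k \<Longrightarrow> j < fst s \<Longrightarrow> snd s p j = mprod (fst u) (snd u) N p j"
    using assms unfolding col_span_le_def by blast
  have "snd t p j = mprod (fst u) (snd u) (mprod (fst s) N M) p j" if "p < k" "j < fst t" for p j
  proof -
    have "snd t p j = mprod (fst s) (mprod (fst u) (snd u) N) M p j"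
      unfolding M[OF that] mprod_def[of "fst s"] using that by (intro sum.cong) (auto simp: N)
    then show ?thesis by (simp add: mprod_assoc)
  qed
  then show ?thesis unfolding col_span_le_def by blast
qed

lemma col_span_le_in_col_span:
  assumes "col_span_le k (r, T) (s, S)" "in_col_span k r T v"
  shows "in_col_span k s S v"
proof -
  obtain M c where M: "\<And>p j. p < k \<Longrightarrow> j < r \<Longrightarrow> T p j = (\<Sum>i<s. S p i * M i j)"
    and c: "\<And>p. p < k \<Longrightarrow> v p = (\<Sum>i<r. T p i * c i)"
    using assms unfolding col_span_le_def in_col_span_def mprod_def by auto
  have "v p = (\<Sum>i<s. S p i * (\<Sum>j<r. M i j * c j))" if "p < k" for p
  proof -
    have "v p = (\<Sum>j<r. \<Sum>i<s. S p i * (M i j * c j))"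
      unfolding c[OF that] using M[OF that] by (intro sum.cong) (auto simp: sum_distrib_right mult.assoc)
    also have "\<dots> = (\<Sum>i<s. \<Sum>j<r. S p i * (M i j * c j))" by (rule sum.swap)
    finally show ?thesis by (simp add: sum_distrib_left)
  qed
  then show ?thesis
    unfolding in_col_span_def by (intro exI[of _ "\<lambda>i. \<Sum>j<r. M i j * c j"]) simp
qed

lemma col_span_le_snoc: "col_span_le k (r, T) (Suc r, snoc_col r T v)"
proof -
  have "T p j = mprod (Suc r) (snoc_col r T v) (\<lambda>i j. if i = j then 1 else 0) p j" if "j < r" for p j
    using that by (simp add: mprod_def snoc_col_def if_distrib[where f = "\<lambda>x. _ * x"] sum.delta cong: if_cong)
  then show ?thesis unfolding col_span_le_def by (intro exI[of _ "\<lambda>i j. if i = j then 1 else 0"]) auto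
qed

lemma snoc_col_span_le:
  assumes "col_span_le k (r, T) (s, S)" "in_col_span k s S v"
  shows "col_span_le k (Suc r, snoc_col r T v) (s, S)"
proof -
  obtain M c where M: "\<And>p j. p < k \<Longrightarrow> j < r \<Longrightarrow> T p j = (\<Sum>i<s. S p i * M i j)"
    and c: "\<And>p. p < k \<Longrightarrow> v p = (\<Sum>i<s. S p i * c i)"
    using assms unfolding col_span_le_def in_col_span_def mprod_def by auto
  have "snoc_col r T v p j = mprod s S (\<lambda>i j. if j < r then M i j else c i) p j" if "p < k" for p j
    using M[OF that] c[OF that] by (cases "j < r") (simp_all add: snoc_col_def mprod_def)
  then show ?thesis
    unfolding col_span_le_def by (intro exI[of _ "\<lambda>i j. if j < r then M i j else c i"]) simp
qed

lemma max_minor_pos_le: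
  assumes "0 < k" "0 < max_minor k r T"
  shows "r \<le> k"
proof -
  obtain f where f: "f \<in> {..<r} \<rightarrow>\<^sub>E {..<k}" "max_minor k r T = \<bar>minor r T f\<bar>"
    using assms(1) by (rule max_minor_attained)
  have "inj_on f {..<r}"
  proof (rule inj_onI, rule ccontr)
    fix i j assume "i \<in> {..<r}" "j \<in> {..<r}" "f i = f j" "i \<noteq> j"
    then have "minor r T f = 0" unfolding minor_def by (intro fdet_identical_rows[of i r j]) auto
    with f(2) assms(2) show False by simp
  qed
  moreover have "f ` {..<r} \<subseteq> {..<k}" using f(1) by auto
  ultimately show ?thesis using card_inj_on_le[of f "{..<r}" "{..<k}"] by simp
qed

text \<open>If every minor of the extended tuple vanished, expanding along the last row would express
  the new vector through the old ones, with cofactors that do not depend on the row.\<close>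

lemma max_minor_snoc_pos:
  assumes "0 < k" "0 < max_minor k r T" "\<not> in_col_span k r T v"
  shows "0 < max_minor k (Suc r) (snoc_col r T v)"
proof (rule ccontr)
  let ?A = "snoc_col r T v"
  assume "\<not> 0 < max_minor k (Suc r) ?A"
  then have zero: "minor (Suc r) ?A g = 0" if "\<And>i. i < Suc r \<Longrightarrow> g i < k" for g
    using abs_minor_le_max_minor[of "Suc r" g k ?A] that by fastforce
  obtain f where f: "f \<in> {..<r} \<rightarrow>\<^sub>E {..<k}" "max_minor k r T = \<bar>minor r T f\<bar>"
    using assms(1) by (rule max_minor_attained)
  define c where "c = (\<lambda>j. (-1) ^ (r + j) * fdet r (\<lambda>i' j'. ?A (f i') (if j' < j then j' else Suc j')))"
  have cr: "c r = minor r T f"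
    unfolding c_def minor_def by (simp, rule fdet_cong) (auto simp: snoc_col_def)
  then have "c r \<noteq> 0" using f(2) assms(2) by auto
  have fk: "f i < k" if "i < r" for i using PiE_mem[OF f(1), of i] that by simp
  have "v p = (\<Sum>i<r. T p i * (- c i / c r))" if "p < k" for p
  proof -
    have "(f(r := p)) i < k" if "i < Suc r" for i
      using fk[of i] that \<open>p < k\<close> by (cases "i = r") simp_all
    then have "0 = minor (Suc r) ?A (f(r := p))" by (intro zero[symmetric])
    also have "\<dots> = (\<Sum>j<Suc r. ?A p j * c j)"
      unfolding minor_def fdet_expand_row
    proof (rule sum.cong[OF refl])
      fix j
      have "fdet r (\<lambda>i' j'. ?A ((f(r := p)) i') (if j' < j then j' else Suc j'))
          = fdet r (\<lambda>i' j'. ?A (f i') (if j' < j then j' else Suc j'))"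
        by (rule fdet_cong) simp
      then show "?A ((f(r := p)) r) j * ((-1) ^ (r + j) * fdet r (\<lambda>i' j'. ?A ((f(r := p)) i') (if j' < j then j' else Suc j')))
          = ?A p j * c j" by (simp add: c_def)
    qed
    also have "\<dots> = (\<Sum>i<r. T p i * c i) + v p * c r" by (simp add: snoc_col_def)
    finally have "0 = (\<Sum>i<r. T p i * c i) + v p * c r" .
    then have "v p = - (\<Sum>i<r. T p i * c i) / c r" using \<open>c r \<noteq> 0\<close> by (simp add: field_simps)
    then show ?thesis by (simp add: sum_divide_distrib sum_negf)
  qed
  then have "in_col_span k r T v"
    unfolding in_col_span_def by (intro exI[of _ "\<lambda>i. - c i / c r"]) simp
  with assms(3) show False ..
qed

text \<open>The coefficient matrix has a determinant equal in modulus to the ratio of the largest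
  minors, so it is invertible and the spans coincide. The same factor works for every
  \<open>h\<close>: comparisons made in the integer lattice persist after any
  transformation.\<close>

lemma col_span_le_same_rank:
  assumes "0 < k" "0 < max_minor k r T" "col_span_le k (r, T) (r, S)"
  obtains M where "fdet r M \<noteq> 0" "\<And>p j. p < k \<Longrightarrow> j < r \<Longrightarrow> T p j = mprod r S M p j"
    "col_span_le k (r, S) (r, T)" "\<And>h. max_minor k r (mprod k h T) = \<bar>fdet r M\<bar> * max_minor k r (mprod k h S)"
    "max_minor k r T = \<bar>fdet r M\<bar> * max_minor k r S"
proof -
  obtain M where M: "\<And>p j. p < k \<Longrightarrow> j < r \<Longrightarrow> T p j = mprod r S M p j"
    using assms(3) by (auto simp: col_span_le_def)
  have T: "max_minor k r T = \<bar>fdet r M\<bar> * max_minor k r S"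
    unfolding max_minor_mprod[OF assms(1), symmetric] by (rule max_minor_cong) (rule M)
  then have nz: "fdet r M \<noteq> 0" using assms(2) by auto
  obtain B where B: "\<forall>i<r. \<forall>j<r. (\<Sum>l<r. M i l * B l j) = (if i = j then 1 else 0) \<and>
      (\<Sum>l<r. B i l * M l j) = (if i = j then 1 else 0)"
    using fdet_inverse[OF nz] ..
  have "S p j = mprod r T B p j" if "p < k" "j < r" for p j
  proof -
    have "mprod r T B p j = mprod r (mprod r S M) B p j"
      unfolding mprod_def[of r _ B] using that by (intro sum.cong) (auto simp: M)
    also have "\<dots> = mprod r S (mprod r M B) p j" by (simp add: mprod_assoc)
    also have "\<dots> = (\<Sum>i<r. S p i * (if i = j then 1 else 0))"
      unfolding mprod_def using that by (intro sum.cong refl) (simp add: B)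
    also have "\<dots> = S p j" using that by (simp add: if_distrib[where f = "\<lambda>x. _ * x"] sum.delta cong: if_cong)
    finally show ?thesis ..
  qed
  then have rev: "col_span_le k (r, S) (r, T)" unfolding col_span_le_def by (intro exI[of _ B]) auto
  have "max_minor k r (mprod k h T) = \<bar>fdet r M\<bar> * max_minor k r (mprod k h S)" for h
  proof -
    have "max_minor k r (mprod k h T) = max_minor k r (mprod k h (mprod r S M))"
      by (rule max_minor_cong, rule mprod_cong) (auto simp: M)
    then show ?thesis by (simp only: mprod_assoc max_minor_mprod[OF assms(1)])
  qed
  with nz M rev T show thesis by (intro that) auto
qed

definition integral_tuple :: "nat \<Rightarrow> nat \<Rightarrow> (nat \<Rightarrow> nat \<Rightarrow> real) \<Rightarrow> bool"
  where "integral_tuple k r T \<longleftrightarrow> (\<forall>p<k. \<forall>j<r. T p j \<in> \<int>) \<and> 0 < max_minor k r T"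

lemma max_minor_Ints:
  assumes "0 < k" "integral_tuple k r T"
  shows "max_minor k r T \<in> \<int>"
proof -
  obtain f where f: "f \<in> {..<r} \<rightarrow>\<^sub>E {..<k}" "max_minor k r T = \<bar>minor r T f\<bar>"
    using assms(1) by (rule max_minor_attained)
  have "T (f i) j \<in> \<int>" if "i < r" "j < r" for i j
    using assms(2) f(1) that by (auto simp: integral_tuple_def)
  then have "minor r T f \<in> \<int>" unfolding minor_def by (rule fdet_Ints)
  then show ?thesis using f(2) by simp
qed

text \<open>Stands for the rational subspaces of positive dimension: minimality of the largest minor
  replaces the choice of a basis of the corresponding primitive sublattice of the integer lattice.\<close>

definition minimal_tuples :: "nat \<Rightarrow> (nat \<times> (nat \<Rightarrow> nat \<Rightarrow> real)) set"
  where "minimal_tuples k = {(r, T). 0 < r \<and> integral_tuple k r T \<and>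
    (\<forall>S. integral_tuple k r S \<longrightarrow> col_span_le k (r, S) (r, T) \<longrightarrow> max_minor k r T \<le> max_minor k r S)}"

text \<open>Strict inclusion one way or the other. The strict inequality of ranks keeps two minimal
  bases of the same subspace from occurring in one flag.\<close>

definition comparable :: "nat \<Rightarrow> nat \<times> (nat \<Rightarrow> nat \<Rightarrow> real) \<Rightarrow> nat \<times> (nat \<Rightarrow> nat \<Rightarrow> real) \<Rightarrow> bool"
  where "comparable k s t \<longleftrightarrow> fst s < fst t \<and> col_span_le k s t \<or> fst t < fst s \<and> col_span_le k t s"

text \<open>Minimality refers to the untransformed minors, but it makes the change-of-basis
  determinant at least 1 in modulus, and this determinant does not depend on
  \<open>h\<close>.\<close>

lemma minimal_tuple_le:
  assumes "0 < k" "(r, T) \<in> minimal_tuples k" "integral_tuple k r S" "col_span_le k (r, S) (r, T)"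
  shows "max_minor k r (mprod k h T) \<le> max_minor k r (mprod k h S)"
proof -
  have T: "0 < max_minor k r T" "max_minor k r T \<le> max_minor k r S" and S: "0 < max_minor k r S"
    using assms by (auto simp: minimal_tuples_def integral_tuple_def)
  obtain M where M: "max_minor k r S = \<bar>fdet r M\<bar> * max_minor k r T"
    "max_minor k r (mprod k h S) = \<bar>fdet r M\<bar> * max_minor k r (mprod k h T)"
    using col_span_le_same_rank[OF assms(1) S assms(4)] by metis
  have "1 \<le> \<bar>fdet r M\<bar>" using T M(1) by (simp add: mult_le_cancel_right1)
  then have "1 * max_minor k r (mprod k h T) \<le> \<bar>fdet r M\<bar> * max_minor k r (mprod k h T)"
    using assms(1) by (intro mult_right_mono max_minor_nonneg)
  then show ?thesis using M(2) by simp
qed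

lemma minimal_tuple_exists:
  assumes "0 < k" "0 < r" "integral_tuple k r S"
  obtains T where "(r, T) \<in> minimal_tuples k" "col_span_le k (r, T) (r, S)" "col_span_le k (r, S) (r, T)"
proof -
  define Q where "Q = (\<lambda>T. integral_tuple k r T \<and> col_span_le k (r, T) (r, S))"
  have QS: "Q S" using assms(3) by (simp add: Q_def col_span_le_refl)
  \<comment> \<open>Largest minors of integral tuples are integers, so rounding loses nothing and
    the well-ordering of the naturals yields a minimum.\<close>
  define T where "T = arg_min (\<lambda>T. nat \<lfloor>max_minor k r T\<rfloor>) Q"
  have T: "Q T" unfolding T_def using QS by (rule arg_min_natI[where P = Q and k = S])
  have le: "max_minor k r T \<le> max_minor k r S'" if "Q S'" for S'
  proof -
    have "nat \<lfloor>max_minor k r T\<rfloor> \<le> nat \<lfloor>max_minor k r S'\<rfloor>"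
      unfolding T_def using that by (rule arg_min_nat_le[where P = Q])
    moreover have "0 \<le> \<lfloor>max_minor k r S'\<rfloor>" using max_minor_nonneg[OF assms(1)] by simp
    ultimately have "\<lfloor>max_minor k r T\<rfloor> \<le> \<lfloor>max_minor k r S'\<rfloor>" by linarith
    moreover have "max_minor k r T \<in> \<int>" "max_minor k r S' \<in> \<int>"
      using T that assms(1) by (auto simp: Q_def intro: max_minor_Ints)
    ultimately show ?thesis by (metis of_int_floor of_int_le_iff)
  qed
  have T': "integral_tuple k r T" "col_span_le k (r, T) (r, S)" using T by (simp_all add: Q_def)
  have "max_minor k r T \<le> max_minor k r S'"
    if "integral_tuple k r S'" "col_span_le k (r, S') (r, T)" for S'
    using that col_span_le_trans[OF that(2) T'(2)] by (intro le) (simp add: Q_def)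
  then have min: "(r, T) \<in> minimal_tuples k" using T'(1) assms(2) by (simp add: minimal_tuples_def)
  have "0 < max_minor k r T" using T'(1) by (simp add: integral_tuple_def)
  then have "col_span_le k (r, S) (r, T)"
    using T'(2) by (rule col_span_le_same_rank[OF assms(1)])
  with min T'(2) show thesis by (rule that)
qed

text \<open>A short integer vector \<open>v\<close> is adjoined to the largest member of the flag that does not
  contain it. The resulting lattice is too small: it either spans a member of the flag or is
  comparable with all of them.\<close>

lemma marked_no_short_vector:
  fixes h :: "real \<Rightarrow> nat \<Rightarrow> nat \<Rightarrow> real"
  assumes "0 < k" and "0 < \<tau>" and "real k * \<tau> \<le> \<rho>" and "\<rho> \<le> 1"
    and "marked (comparable k) (\<lambda>t x. max_minor k (fst t) (mprod k (h x) (snd t))) (real k * \<tau>) \<rho> (minimal_tuples k) x"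
    and "\<And>p. p < k \<Longrightarrow> v p \<in> \<int>" and "\<exists>p<k. v p \<noteq> 0"
    and "\<And>i. i < k \<Longrightarrow> \<bar>\<Sum>p<k. h x i p * v p\<bar> < \<tau>"
  shows False
proof -
  define \<psi> where "\<psi> t = max_minor k (fst t) (mprod k (h x) (snd t))" for t
  have "\<exists>F\<subseteq>minimal_tuples k. (\<forall>s\<in>F. \<forall>t\<in>F. s = t \<or> comparable k s t) \<and>
      (\<forall>t\<in>F. real k * \<tau> \<le> \<psi> t \<and> \<psi> t < \<rho>) \<and>
      (\<forall>t\<in>minimal_tuples k. (\<forall>s\<in>F. comparable k t s) \<longrightarrow> \<rho> \<le> \<psi> t)"
    using assms(5) unfolding marked_def \<psi>_def .
  then obtain F where F0: "F \<subseteq> minimal_tuples k" "\<forall>s\<in>F. \<forall>t\<in>F. s = t \<or> comparable k s t"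
    "\<forall>t\<in>F. real k * \<tau> \<le> \<psi> t \<and> \<psi> t < \<rho>"
    "\<forall>t\<in>minimal_tuples k. (\<forall>s\<in>F. comparable k t s) \<longrightarrow> \<rho> \<le> \<psi> t"
    by (elim exE conjE) (rule that)
  have F: "F \<subseteq> minimal_tuples k" "\<And>s t. s \<in> F \<Longrightarrow> t \<in> F \<Longrightarrow> s = t \<or> comparable k s t"
    "\<And>t. t \<in> F \<Longrightarrow> real k * \<tau> \<le> \<psi> t" "\<And>t. t \<in> F \<Longrightarrow> \<psi> t < \<rho>"
    "\<And>t. t \<in> minimal_tuples k \<Longrightarrow> (\<And>s. s \<in> F \<Longrightarrow> comparable k t s) \<Longrightarrow> \<rho> \<le> \<psi> t"
    using F0 by simp_all
  have Fint: "integral_tuple k (fst t) (snd t)" "0 < fst t" if "t \<in> F" for t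
    using F(1) that by (auto simp: minimal_tuples_def)
  define F' where "F' = {t \<in> F. \<not> in_col_span k (fst t) (snd t) v}"
  obtain r T where T: "integral_tuple k r T" "\<not> in_col_span k r T v" "\<psi> (r, T) \<le> 1"
    "\<And>t. t \<in> F \<Longrightarrow> t \<notin> F' \<Longrightarrow> r < fst t \<and> col_span_le k (r, T) t"
    "\<And>t. t \<in> F' \<Longrightarrow> fst t \<le> r \<and> col_span_le k t (r, T)"
  proof (cases "F' = {}")
    case True
    \<comment> \<open>If every member of the flag contains \<open>v\<close>, the rank-zero tuple
      takes the place of the largest member avoiding \<open>v\<close>: its span is zero,
      \<open>v\<close> is not, and its size is 1.\<close>
    show thesis
    proof (rule that[of 0 "\<lambda>_ _. 0"])
      show "integral_tuple k 0 (\<lambda>_ _. 0)" by (simp add: integral_tuple_def)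
      show "\<not> in_col_span k 0 (\<lambda>_ _. 0) v" using assms(7) by (auto simp: in_col_span_def)
      show "\<psi> (0, \<lambda>_ _. 0) \<le> 1" by (simp add: \<psi>_def)
      show "0 < fst t \<and> col_span_le k (0, \<lambda>_ _. 0) t" if "t \<in> F" for t
        using Fint[OF that] by (simp add: col_span_le_def)
    qed (use True in auto)
  next
    case False
    have "fst t \<le> k" if "t \<in> F'" for t
      using max_minor_pos_le[OF assms(1)] Fint[of t] that by (auto simp: F'_def integral_tuple_def)
    then have "fst ` F' \<subseteq> {..k}" by (simp add: image_subset_iff)
    then have fin: "finite (fst ` F')" by (rule finite_subset) simp
    have "Max (fst ` F') \<in> fst ` F'" using fin False by (intro Max_in) auto
    then obtain t where t: "t \<in> F'" "fst t = Max (fst ` F')" by (metis imageE)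
    have tF: "t \<in> F" "\<not> in_col_span k (fst t) (snd t) v" using t(1) by (auto simp: F'_def)
    show thesis
    proof (rule that[of "fst t" "snd t"])
      show "integral_tuple k (fst t) (snd t)" using Fint[OF tF(1)] by simp
      show "\<not> in_col_span k (fst t) (snd t) v" by (rule tF)
      show "\<psi> (fst t, snd t) \<le> 1" using F(4)[OF tF(1)] assms(4) by simp
      fix s
      \<comment> \<open>A member whose span contains \<open>v\<close> cannot lie below
        \<open>t\<close>, whose span does not; by comparability it lies strictly above.\<close>
      { assume s: "s \<in> F" "s \<notin> F'"
        then have sv: "in_col_span k (fst s) (snd s) v" by (simp add: F'_def)
        then have "\<not> col_span_le k s t"
          using col_span_le_in_col_span[of k "fst s" "snd s" "fst t" "snd t" v] tF(2) by auto
        moreover have "s \<noteq> t" using s t by auto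
        ultimately show "fst t < fst s \<and> col_span_le k (fst t, snd t) s"
          using F(2)[OF s(1) tF(1)] by (auto simp: comparable_def) }
      { assume s: "s \<in> F'"
        then have le: "fst s \<le> fst t" using t(2) fin by simp
        have "s = t \<or> comparable k s t" using F(2) s tF(1) by (simp add: F'_def)
        then show "fst s \<le> fst t \<and> col_span_le k s (fst t, snd t)"
          using le col_span_le_refl[of k t] by (auto simp: comparable_def) }
    qed
  qed
  define T1 where "T1 = snoc_col r T v"
  have pos: "0 < max_minor k (Suc r) T1"
    unfolding T1_def using assms(1) T(1,2) by (intro max_minor_snoc_pos) (auto simp: integral_tuple_def)
  then have T1: "integral_tuple k (Suc r) T1"
    using T(1) assms(6) by (auto simp: integral_tuple_def T1_def snoc_col_def)
  have "Suc r \<le> k" using assms(1) pos by (rule max_minor_pos_le)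
  \<comment> \<open>The old tuple has size at most 1 and the new column has entries below
    \<open>\<tau>\<close> after applying \<open>h x\<close>; the expansion has at most
    \<open>k\<close> terms.\<close>
  have small: "\<psi> (Suc r, T1) < real k * \<tau>"
  proof -
    have "max_minor k (Suc r) (mprod k (h x) T1) < real (Suc r) * (\<tau> * 1)"
    proof (rule max_minor_Suc_less[OF assms(1)])
      show "\<bar>mprod k (h x) T1 i r\<bar> < \<tau>" if "i < k" for i
        using assms(8)[OF that] by (simp add: mprod_def T1_def snoc_col_def)
      have "max_minor k r (mprod k (h x) T1) = max_minor k r (mprod k (h x) T)"
        by (rule max_minor_cong, rule mprod_cong) (auto simp: T1_def snoc_col_def)
      then show "max_minor k r (mprod k (h x) T1) \<le> 1" using T(3) by (simp add: \<psi>_def)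
    qed simp
    also have "\<dots> \<le> real k * (\<tau> * 1)" using \<open>Suc r \<le> k\<close> assms(2) by (intro mult_right_mono) auto
    finally show ?thesis by (simp add: \<psi>_def)
  qed
  have above: "Suc r \<le> fst t \<and> col_span_le k (Suc r, T1) t" if "t \<in> F" "t \<notin> F'" for t
  proof -
    have "in_col_span k (fst t) (snd t) v" using that by (simp add: F'_def)
    then have "col_span_le k (Suc r, snoc_col r T v) (fst t, snd t)"
      using T(4)[OF that] by (intro snoc_col_span_le) auto
    then show ?thesis using T(4)[OF that] by (simp add: T1_def)
  qed
  \<comment> \<open>A flag member of rank \<open>Suc r\<close> above \<open>T1\<close> would span
    the same space, hence by minimality have size at most that of \<open>T1\<close>, below the lower
    bound for members of the flag.\<close>
  have neq: "fst t \<noteq> Suc r" if "t \<in> F" "t \<notin> F'" for t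
  proof
    assume "fst t = Suc r"
    then have t: "t = (Suc r, snd t)" by (simp add: prod_eq_iff)
    then have "(Suc r, snd t) \<in> minimal_tuples k" using F(1) that(1) by (metis subsetD)
    then have "\<psi> t \<le> \<psi> (Suc r, T1)"
      using minimal_tuple_le[OF assms(1) _ T1, of "snd t" "h x"] above[OF that] t \<open>fst t = Suc r\<close> by (simp add: \<psi>_def)
    with F(3)[OF that(1)] small show False by simp
  qed
  obtain S where S: "(Suc r, S) \<in> minimal_tuples k" "col_span_le k (Suc r, S) (Suc r, T1)"
    "col_span_le k (Suc r, T1) (Suc r, S)"
    using minimal_tuple_exists[OF assms(1) _ T1] by auto
  \<comment> \<open>The minimal tuple \<open>S\<close> with the span of \<open>T1\<close> fits
    strictly between the two halves of the flag, so maximality forces its size up to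
    \<open>\<rho>\<close>.\<close>
  have "\<rho> \<le> \<psi> (Suc r, S)"
  proof (rule F(5)[OF S(1)])
    fix t assume t: "t \<in> F"
    show "comparable k (Suc r, S) t"
    proof (cases "t \<in> F'")
      case True
      have "col_span_le k (r, T) (Suc r, T1)" unfolding T1_def by (rule col_span_le_snoc)
      then have "col_span_le k t (Suc r, S)"
        using T(5)[OF True] S(3) by (meson col_span_le_trans)
      then show ?thesis using T(5)[OF True] by (simp add: comparable_def)
    next
      case False
      have "col_span_le k (Suc r, S) t" using above[OF t False] S(2) by (meson col_span_le_trans)
      then show ?thesis using above[OF t False] neq[OF t False] by (simp add: comparable_def)
    qed
  qed
  moreover have "\<psi> (Suc r, S) \<le> \<psi> (Suc r, T1)"
    using minimal_tuple_le[OF assms(1) S(1) T1 S(3)] by (simp add: \<psi>_def)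
  ultimately show False using small assms(3) by simp
qed

subsection \<open>Lower bounds from non-vanishing Wronskians\<close>

text \<open>Right multiplication by the inverse of the block with the largest minor turns that block
  into the identity. By Cramer's rule the other entries become quotients of minors by the largest
  one, so they are at most 1. The discarded determinant is a non-zero integer, hence at least 1 in
  modulus.\<close>

lemma normalized_tuple:
  assumes "0 < k" "integral_tuple k r T"
  shows "\<exists>f\<in>{..<r} \<rightarrow>\<^sub>E {..<k}. \<exists>S. 1 \<le> \<bar>fdet r (\<lambda>i l. T (f i) l)\<bar> \<and> (\<forall>p j. \<bar>S p j\<bar> \<le> 1) \<and>
    (\<forall>i<r. \<forall>j<r. S (f i) j = (if i = j then 1 else 0)) \<and>
    (\<forall>p<k. \<forall>l<r. T p l = mprod r S (\<lambda>i l. T (f i) l) p l)"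
proof -
  obtain f where f: "f \<in> {..<r} \<rightarrow>\<^sub>E {..<k}" "max_minor k r T = \<bar>minor r T f\<bar>"
    using assms(1) by (rule max_minor_attained)
  have fk: "f i < k" if "i < r" for i using PiE_mem[OF f(1), of i] that by simp
  define A where "A = (\<lambda>i l. T (f i) l)"
  have mA: "minor r T f = fdet r A" by (simp add: minor_def A_def)
  have pos: "0 < \<bar>fdet r A\<bar>" using assms(2) f(2) by (simp add: integral_tuple_def mA)
  have "fdet r A \<in> \<int>"
    unfolding A_def by (rule fdet_Ints) (use assms(2) fk in \<open>auto simp: integral_tuple_def\<close>)
  then have one: "1 \<le> \<bar>fdet r A\<bar>" using pos by (auto elim!: Ints_cases)
  \<comment> \<open>Zero outside the matrix range, so that the bound by 1 holds at all indices and
    \<open>S\<close> is a point of a full product of intervals.\<close>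
  define S where "S = (\<lambda>p j. if p < k \<and> j < r then minor r T (f(j := p)) / fdet r A else 0)"
  obtain B where B: "\<forall>i<r. \<forall>j<r. (\<Sum>l<r. A i l * B l j) = (if i = j then 1 else 0) \<and>
      (\<Sum>l<r. B i l * A l j) = (if i = j then 1 else 0)"
    using fdet_inverse[of r A] pos by auto
  have row: "(\<Sum>j<r. (\<Sum>m<r. T p m * B m j) * A j l) = T p l" if "l < r" for p l
  proof -
    have "(\<Sum>j<r. (\<Sum>m<r. T p m * B m j) * A j l) = (\<Sum>j<r. \<Sum>m<r. T p m * (B m j * A j l))"
      by (simp add: sum_distrib_right mult.assoc)
    also have "\<dots> = (\<Sum>m<r. T p m * (\<Sum>j<r. B m j * A j l))"
      unfolding sum_distrib_left by (rule sum.swap)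
    also have "\<dots> = (\<Sum>m<r. T p m * (if m = l then 1 else 0))"
      using B that by (intro sum.cong refl) simp
    also have "\<dots> = T p l" using that by (simp add: if_distrib[where f = "\<lambda>x. _ * x"] sum.delta cong: if_cong)
    finally show ?thesis .
  qed
  have S_eq: "S p j = (\<Sum>m<r. T p m * B m j)" if "p < k" "j < r" for p j
  proof -
    have "minor r T (f(j := p)) = fdet r (\<lambda>i l. if i = j then \<Sum>m<r. (\<Sum>m'<r. T p m' * B m' m) * A m l else A i l)"
      unfolding minor_def by (rule fdet_cong) (simp add: row[unfolded A_def] A_def)
    also have "\<dots> = (\<Sum>m<r. T p m * B m j) * fdet r A" using that(2) by (rule fdet_cramer)
    finally show ?thesis using that pos by (simp add: S_def)
  qed
  show ?thesis
  proof (intro bexI[of _ f] exI[of _ S] conjI allI impI)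
    show "f \<in> {..<r} \<rightarrow>\<^sub>E {..<k}" by (rule f)
    show "1 \<le> \<bar>fdet r (\<lambda>i l. T (f i) l)\<bar>" using one by (simp add: A_def)
    show "\<bar>S p j\<bar> \<le> 1" for p j
    proof (cases "p < k \<and> j < r")
      case True
      have "\<bar>minor r T (f(j := p))\<bar> \<le> max_minor k r T"
        using True fk by (intro abs_minor_le_max_minor) simp
      then show ?thesis using True pos f(2) by (simp add: S_def mA)
    qed (auto simp: S_def)
    show "S (f i) j = (if i = j then 1 else 0)" if "i < r" "j < r" for i j
      using S_eq[OF fk[OF that(1)] that(2)] B that by (simp add: A_def)
    show "T p l = mprod r S (\<lambda>i l. T (f i) l) p l" if "p < k" "l < r" for p l
      using row[OF that(2), of p] S_eq[OF that(1)] by (simp add: mprod_def A_def)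
  qed
qed

text \<open>The sets where some \<open>D t y\<close> exceeds \<open>1 / (n + 1)\<close> in modulus
  are open, increase with \<open>n\<close> and cover \<open>K\<close>; one of them already contains
  \<open>K\<close>.\<close>

lemma compact_family_lower_bound:
  fixes D :: "'a :: topological_space \<Rightarrow> 'b \<Rightarrow> real"
  assumes "compact K" and "\<And>y. y \<in> Y \<Longrightarrow> continuous_on UNIV (\<lambda>t. D t y)"
    and "\<And>t. t \<in> K \<Longrightarrow> \<exists>y\<in>Y. D t y \<noteq> 0"
  shows "\<exists>\<delta>>0. \<forall>t\<in>K. \<exists>y\<in>Y. \<delta> \<le> \<bar>D t y\<bar>"
proof -
  define O' where "O' = (\<lambda>n :: nat. \<Union>y\<in>Y. {t. 1 / real (Suc n) < \<bar>D t y\<bar>})"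
  have "open (O' n)" for n
    unfolding O'_def using assms(2)
    by (intro open_UN ballI open_Collect_less continuous_intros)
  moreover have "K \<subseteq> (\<Union>n\<in>UNIV. O' n)"
  proof
    fix t assume "t \<in> K"
    then obtain y where y: "y \<in> Y" "D t y \<noteq> 0" using assms(3) by blast
    then obtain n where "1 / real (Suc n) < \<bar>D t y\<bar>"
      using reals_Archimedean[of "\<bar>D t y\<bar>"] by (auto simp: inverse_eq_divide)
    then show "t \<in> (\<Union>n\<in>UNIV. O' n)" using y by (auto simp: O'_def)
  qed
  ultimately obtain C where C: "finite C" "K \<subseteq> (\<Union>n\<in>C. O' n)"
    using compactE_image[OF assms(1), of UNIV O'] by metis
  define m where "m = Max (insert 0 C)"
  have "\<exists>y\<in>Y. 1 / real (Suc m) \<le> \<bar>D t y\<bar>" if "t \<in> K" for t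
  proof -
    obtain n y where n: "n \<in> C" "y \<in> Y" "1 / real (Suc n) < \<bar>D t y\<bar>"
      using subsetD[OF C(2) \<open>t \<in> K\<close>] unfolding O'_def by blast
    have "n \<le> m" unfolding m_def using C(1) n(1) by (intro Max_ge) auto
    then have "1 / real (Suc m) \<le> 1 / real (Suc n)" by (intro divide_left_mono) auto
    then show ?thesis using n by (intro bexI[of _ y]) auto
  qed
  then show ?thesis by (intro exI[of _ "1 / real (Suc m)"]) auto
qed

lemma compact_unit_cube: "compact {t :: 'i \<Rightarrow> real. \<forall>q. \<bar>t q\<bar> \<le> 1}"
proof -
  have "compactin (product_topology (\<lambda>_. euclidean) UNIV) (PiE UNIV (\<lambda>_ :: 'i. {-1..1 :: real}))"
    by (simp add: compactin_PiE)
  moreover have "PiE UNIV (\<lambda>_ :: 'i. {-1..1 :: real}) = {t. \<forall>q. \<bar>t q\<bar> \<le> 1}"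
    by (auto simp: PiE_def Pi_def abs_le_iff minus_le_iff)
  ultimately show ?thesis by (simp add: euclidean_product_topology)
qed

lemma has_derivative_zero_on_open:
  fixes f :: "real \<Rightarrow> real"
  assumes "(f has_real_derivative d) (at y)" "open S" "y \<in> S" "\<And>x. x \<in> S \<Longrightarrow> f x = c"
  shows "d = 0"
proof -
  have "((\<lambda>_. c) has_real_derivative d) (at y)"
    using assms by (rule has_field_derivative_transform_within_open)
  then show ?thesis using DERIV_const DERIV_unique by blast
qed

text \<open>On an interval where the preceding Wronskian has no zero, the normalised cofactors of the last
  row of the first vanishing Wronskian are constant.\<close>

lemma vanishing_wronskian_dependent:
  fixes U :: "nat \<Rightarrow> nat \<Rightarrow> real \<Rightarrow> real"
  assumes "a < b"
    and dU: "\<And>i j y. j < r \<Longrightarrow> y \<in> {a<..<b} \<Longrightarrow> (U i j has_real_derivative U (Suc i) j y) (at y)"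
    and zero: "\<And>y. y \<in> {a<..<b} \<Longrightarrow> fdet r (\<lambda>i j. U i j y) = 0"
  shows "\<exists>c. \<exists>y\<in>{a<..<b}. (\<exists>j<r. c j \<noteq> 0) \<and> (\<forall>i. (\<Sum>j<r. c j * U i j y) = 0)"
proof -
  define W where "W = (\<lambda>s y. fdet s (\<lambda>i j. U i j y))"
  \<comment> \<open>The least number of leading functions whose Wronskian vanishes identically; it
    is positive because the empty determinant is 1.\<close>
  define n where "n = (LEAST n. \<forall>y\<in>{a<..<b}. W n y = 0)"
  have Wr: "\<forall>y\<in>{a<..<b}. W r y = 0" using zero by (simp add: W_def)
  then have Wn: "\<forall>y\<in>{a<..<b}. W n y = 0" unfolding n_def by (rule LeastI)
  have "n \<le> r" unfolding n_def using Wr by (rule Least_le)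
  have "n \<noteq> 0"
  proof
    assume "n = 0"
    then show False using Wn[rule_format, of "(a + b) / 2"] \<open>a < b\<close> by (simp add: W_def)
  qed
  then obtain s where s: "n = Suc s" by (cases n) auto
  then have sr: "s < r" using \<open>n \<le> r\<close> by simp
  have "\<not> (\<forall>y\<in>{a<..<b}. W s y = 0)"
    using not_less_Least[of s "\<lambda>n. \<forall>y\<in>{a<..<b}. W n y = 0"] s by (simp add: n_def)
  then obtain y1 where y1: "y1 \<in> {a<..<b}" "W s y1 \<noteq> 0" by blast
  have fdU: "(\<lambda>y. U i j y) field_differentiable (at y)" if "j < r" "y \<in> {a<..<b}" for i j y
    using dU[OF that] by (auto simp: field_differentiable_def)
  have "W s field_differentiable (at y)" if "y \<in> {a<..<b}" for y
    unfolding W_def using that sr by (intro field_differentiable_fdet fdU) auto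
  then have "continuous_on {a<..<b} (W s)"
    by (intro continuous_at_imp_continuous_on ballI field_differentiable_imp_continuous_at) auto
  then have "open ({a<..<b} \<inter> W s -` (- {0}))"
    by (intro continuous_open_preimage open_Compl) auto
  moreover have "y1 \<in> {a<..<b} \<inter> W s -` (- {0})" using y1 by simp
  ultimately obtain d where d: "0 < d" "ball y1 d \<subseteq> {a<..<b} \<inter> W s -` (- {0})"
    unfolding open_contains_ball by blast
  define I where "I = ball y1 d"
  have I: "open I" "convex I" "y1 \<in> I" "\<And>y. y \<in> I \<Longrightarrow> y \<in> {a<..<b}" "\<And>y. y \<in> I \<Longrightarrow> W s y \<noteq> 0"
    using d unfolding I_def by (simp, simp, simp, blast, blast)
  define C where "C = (\<lambda>j y. (-1) ^ (s + j) * fdet s (\<lambda>i' j'. U i' (if j' < j then j' else Suc j') y))"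
  have Cs: "C s y = W s y" for y
    unfolding C_def W_def by (simp, rule fdet_cong) auto
  \<comment> \<open>Replace the last row by row \<open>i\<close>. For \<open>i < s\<close> a row is
    repeated, and for \<open>i = s\<close> the determinant is the vanishing Wronskian.\<close>
  have CU: "(\<Sum>j<Suc s. U i j y * C j y) = 0" if "i \<le> s" "y \<in> I" for i y
  proof -
    define A where "A = (\<lambda>i' j. U (if i' = s then i else i') j y)"
    have "fdet (Suc s) A = (\<Sum>j<Suc s. A s j * ((-1) ^ (s + j) * fdet s (\<lambda>i' j'. A i' (if j' < j then j' else Suc j'))))"
      by (rule fdet_expand_row)
    also have "\<dots> = (\<Sum>j<Suc s. U i j y * C j y)"
    proof (rule sum.cong[OF refl])
      fix j
      have "fdet s (\<lambda>i' j'. A i' (if j' < j then j' else Suc j'))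
          = fdet s (\<lambda>i' j'. U i' (if j' < j then j' else Suc j') y)"
        by (rule fdet_cong) (simp add: A_def)
      then show "A s j * ((-1) ^ (s + j) * fdet s (\<lambda>i' j'. A i' (if j' < j then j' else Suc j')))
          = U i j y * C j y" by (simp add: C_def A_def)
    qed
    also have "fdet (Suc s) A = 0"
    proof (cases "i = s")
      case True
      then have "A = (\<lambda>i j. U i j y)" by (auto simp: A_def)
      then show ?thesis using Wn I(4)[OF that(2)] s by (simp add: W_def)
    next
      case False
      then show ?thesis
        using that(1) by (intro fdet_identical_rows[of i "Suc s" s]) (auto simp: A_def)
    qed
    finally show ?thesis by simp
  qed
  define q where "q = (\<lambda>j y. C j y / C s y)"
  have qs: "q s y = 1" if "y \<in> I" for y using I(5)[OF that] by (simp add: q_def Cs)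
  have qU: "(\<Sum>j<Suc s. q j y * U i j y) = 0" if "i \<le> s" "y \<in> I" for i y
  proof -
    have "(\<Sum>j<Suc s. q j y * U i j y) = (\<Sum>j<Suc s. U i j y * C j y) / C s y"
      unfolding sum_divide_distrib by (intro sum.cong) (auto simp: q_def)
    then show ?thesis using CU[OF that] by simp
  qed
  have "q j field_differentiable (at y)" if "j < Suc s" "y \<in> I" for j y
  proof -
    have "C l field_differentiable (at y)" if "l < Suc s" for l
      unfolding C_def using that sr I(4)[OF \<open>y \<in> I\<close>]
      by (intro field_differentiable_mult field_differentiable_const field_differentiable_fdet fdU) auto
    moreover have "C s y \<noteq> 0" using I(5)[OF that(2)] unfolding Cs .
    ultimately show ?thesis
      unfolding q_def using that(1) by (intro field_differentiable_divide) simp_all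
  qed
  then have dq: "(q j has_real_derivative deriv (q j) y) (at y)" if "j < Suc s" "y \<in> I" for j y
    using that by (simp add: field_differentiable_derivI)
  have q'0: "deriv (q j) y = 0" if "j < Suc s" "y \<in> I" for j y
  proof -
    have "(q s has_real_derivative deriv (q s) y) (at y)" using that(2) by (intro dq) simp
    then have last: "deriv (q s) y = 0"
      using I(1) \<open>y \<in> I\<close> by (rule has_derivative_zero_on_open) (auto simp: qs)
    \<comment> \<open>Differentiate the relation of order \<open>i\<close> and subtract the one of
      order \<open>Suc i\<close>. Since \<open>q s\<close> is constant, \<open>s\<close> equations
      for \<open>s\<close> derivatives remain, with determinant \<open>W s\<close>, which has no
      zero on \<open>I\<close>.\<close>
    have "(\<Sum>j<s. U i j y * deriv (q j) y) = 0" if "i < s" for i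
    proof -
      have "((\<lambda>y. \<Sum>j<Suc s. q j y * U i j y) has_real_derivative
          (\<Sum>j<Suc s. deriv (q j) y * U i j y + U (Suc i) j y * q j y)) (at y)"
        using \<open>y \<in> I\<close> I(4) sr by (intro DERIV_sum DERIV_mult dq dU) auto
      then have "(\<Sum>j<Suc s. deriv (q j) y * U i j y + U (Suc i) j y * q j y) = 0"
        using I(1) \<open>y \<in> I\<close> by (rule has_derivative_zero_on_open) (use qU \<open>i < s\<close> in auto)
      moreover have "(\<Sum>j<Suc s. U (Suc i) j y * q j y) = 0"
        using qU[of "Suc i" y] \<open>i < s\<close> \<open>y \<in> I\<close> by (simp add: mult.commute)
      ultimately have "(\<Sum>j<Suc s. deriv (q j) y * U i j y) = 0"
        by (simp only: sum.distrib)
      then show ?thesis using last by (simp add: mult.commute)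
    qed
    moreover have "fdet s (\<lambda>i j. U i j y) \<noteq> 0" using I(5)[OF \<open>y \<in> I\<close>] by (simp add: W_def)
    ultimately have "deriv (q l) y = 0" if "l < s" for l
      using that fdet_kernel[of s "\<lambda>i j. U i j y" "\<lambda>j. deriv (q j) y" l] by blast
    then show ?thesis using that(1) last by (cases "j = s") auto
  qed
  have qc: "q j y = q j y1" if "j < Suc s" "y \<in> I" for j y
  proof -
    have "\<exists>c. \<forall>x\<in>I. q j x = c"
    proof (rule has_field_derivative_zero_constant[OF I(2)])
      fix x assume "x \<in> I"
      then show "(q j has_field_derivative 0) (at x within I)"
        using dq[OF that(1)] q'0[OF that(1)] by (metis has_field_derivative_at_within)
    qed
    then show ?thesis using that(2) I(3) by auto
  qed
  define c where "c = (\<lambda>j. if j < Suc s then q j y1 else 0)"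
  \<comment> \<open>With constant coefficients the relation may be differentiated indefinitely on
    the open set \<open>I\<close>, beyond the orders covered by the determinant.\<close>
  have "(\<Sum>j<r. c j * U i j y) = 0" if "y \<in> I" for i y
    using that
  proof (induction i arbitrary: y)
    case 0
    have "(\<Sum>j<r. c j * U 0 j y) = (\<Sum>j<Suc s. c j * U 0 j y)"
      using sr by (intro sum.mono_neutral_right) (auto simp: c_def)
    also have "\<dots> = (\<Sum>j<Suc s. q j y * U 0 j y)"
      using 0 by (intro sum.cong) (auto simp: c_def qc)
    finally show ?case using qU[of 0 y] 0 by simp
  next
    case (Suc i)
    have "((\<lambda>y. \<Sum>j<r. c j * U i j y) has_real_derivative (\<Sum>j<r. c j * U (Suc i) j y)) (at y)"
      using Suc.prems I(4) by (intro DERIV_sum DERIV_cmult dU) auto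
    then show ?case
      using I(1) Suc.prems by (rule has_derivative_zero_on_open) (rule Suc.IH)
  qed
  moreover have "\<exists>j<r. c j \<noteq> 0" using sr qs[OF I(3)] by (intro exI[of _ s]) (auto simp: c_def)
  ultimately show ?thesis using I(3) y1 by (intro exI[of _ c] bexI[of _ y1]) auto
qed

text \<open>The minor of the first \<open>r\<close> rows is the Wronskian of \<open>r\<close>
  combinations of the given functions. Were it zero throughout, these combinations would satisfy a
  linear relation to all orders at some point, producing a kernel vector of the full Wronskian
  matrix there. Compactness makes the bound uniform over normalised tuples.\<close>

lemma uniform_wronskian_bound:
  fixes G :: "nat \<Rightarrow> nat \<Rightarrow> real \<Rightarrow> real"
  assumes "0 < k" and "a < b"
    and dG: "\<And>i p y. p < k \<Longrightarrow> y \<in> {a<..<b} \<Longrightarrow> (G i p has_real_derivative G (Suc i) p y) (at y)"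
    and nz: "\<And>y. y \<in> {a<..<b} \<Longrightarrow> fdet k (\<lambda>i p. G i p y) \<noteq> 0"
  shows "\<exists>\<delta>>0. \<forall>T. integral_tuple k r T \<longrightarrow>
    (\<exists>y\<in>{a<..<b}. \<delta> \<le> \<bar>minor r (mprod k (\<lambda>i p. G i p y) T) (\<lambda>i. i)\<bar>)"
proof -
  define D where "D = (\<lambda>(t :: nat \<times> nat \<Rightarrow> real) y. fdet r (\<lambda>i j. \<Sum>p<k. G i p y * t (p, j)))"
  \<comment> \<open>Real matrices with entries at most 1 and an identity block in the rows
    \<open>f\<close>; the block keeps the columns independent and is a closed condition.\<close>
  define K where "K = (\<lambda>f :: nat \<Rightarrow> nat. {t :: nat \<times> nat \<Rightarrow> real. \<forall>q. \<bar>t q\<bar> \<le> 1} \<inter>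
    (\<Inter>i<r. \<Inter>j<r. {t. t (f i, j) = (if i = j then 1 else 0)}))"
  have K: "compact (K f)" for f
    unfolding K_def
    by (intro compact_Int_closed compact_unit_cube closed_INT ballI closed_Collect_eq
        continuous_on_product_coordinates continuous_on_const)
  have contD: "continuous_on UNIV (\<lambda>t. D t y)" for y
    unfolding D_def by (intro continuous_on_fdet continuous_intros continuous_on_product_coordinates)
  have nzD: "\<exists>y\<in>{a<..<b}. D t y \<noteq> 0" if f: "f \<in> {..<r} \<rightarrow>\<^sub>E {..<k}" and t: "t \<in> K f" for f t
  proof (rule ccontr)
    assume "\<not> (\<exists>y\<in>{a<..<b}. D t y \<noteq> 0)"
    then have zero: "fdet r (\<lambda>i j. \<Sum>p<k. G i p y * t (p, j)) = 0" if "y \<in> {a<..<b}" for y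
      using that by (auto simp: D_def)
    have dU: "((\<lambda>y. \<Sum>p<k. G i p y * t (p, j)) has_real_derivative (\<Sum>p<k. G (Suc i) p y * t (p, j))) (at y)"
      if "y \<in> {a<..<b}" for i j y
      using that by (intro DERIV_sum DERIV_cmult_right dG) auto
    have "\<exists>c. \<exists>y\<in>{a<..<b}. (\<exists>j<r. c j \<noteq> 0) \<and>
        (\<forall>i. (\<Sum>j<r. c j * (\<Sum>p<k. G i p y * t (p, j))) = 0)"
      by (rule vanishing_wronskian_dependent[OF \<open>a < b\<close>]) (rule dU zero, assumption)+
    then obtain c where "\<exists>y\<in>{a<..<b}. (\<exists>j<r. c j \<noteq> 0) \<and>
        (\<forall>i. (\<Sum>j<r. c j * (\<Sum>p<k. G i p y * t (p, j))) = 0)" ..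
    then obtain y where c: "y \<in> {a<..<b}" "\<exists>j<r. c j \<noteq> 0"
      "\<forall>i. (\<Sum>j<r. c j * (\<Sum>p<k. G i p y * t (p, j))) = 0"
      by (elim bexE conjE) (rule that)
    \<comment> \<open>The relations of orders \<open>i < k\<close> say that the matrix
      \<open>t\<close> applied to \<open>c\<close> lies in the kernel of an invertible
      matrix.\<close>
    have "(\<Sum>j<r. t (p, j) * c j) = 0" if "p < k" for p
    proof (rule fdet_kernel[OF nz[OF c(1)] _ that, where c = "\<lambda>p. \<Sum>j<r. t (p, j) * c j"])
      fix i assume "i < k"
      have "(\<Sum>p<k. G i p y * (\<Sum>j<r. t (p, j) * c j)) = (\<Sum>p<k. \<Sum>j<r. c j * (G i p y * t (p, j)))"
        by (simp add: sum_distrib_left mult_ac)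
      also have "\<dots> = (\<Sum>j<r. \<Sum>p<k. c j * (G i p y * t (p, j)))" by (rule sum.swap)
      also have "\<dots> = 0" using c(3)[rule_format, of i] by (simp add: sum_distrib_left)
      finally show "(\<Sum>p<k. G i p y * (\<Sum>j<r. t (p, j) * c j)) = 0" .
    qed
    moreover obtain j where j: "j < r" "c j \<noteq> 0" using c(2) by blast
    ultimately have "(\<Sum>l<r. t (f j, l) * c l) = 0" using PiE_mem[OF f, of j] by simp
    \<comment> \<open>In row \<open>f j\<close> the identity block isolates the coefficient
      \<open>c j\<close>, which is not zero.\<close>
    also have "(\<Sum>l<r. t (f j, l) * c l) = (\<Sum>l<r. if l = j then c j else 0)"
      using t j(1) by (intro sum.cong) (auto simp: K_def)
    also have "\<dots> = c j" using j(1) by simp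
    finally show False using j(2) by simp
  qed
  have "\<forall>f\<in>{..<r} \<rightarrow>\<^sub>E {..<k}. \<exists>\<delta>>0. \<forall>t\<in>K f. \<exists>y\<in>{a<..<b}. \<delta> \<le> \<bar>D t y\<bar>"
    by (intro ballI compact_family_lower_bound K contD nzD)
  from bchoice[OF this] obtain \<delta> where \<delta>': "\<forall>f\<in>{..<r} \<rightarrow>\<^sub>E {..<k}.
      0 < \<delta> f \<and> (\<forall>t\<in>K f. \<exists>y\<in>{a<..<b}. \<delta> f \<le> \<bar>D t y\<bar>)" ..
  have \<delta>: "0 < \<delta> f" "\<And>t. t \<in> K f \<Longrightarrow> \<exists>y\<in>{a<..<b}. \<delta> f \<le> \<bar>D t y\<bar>"
    if "f \<in> {..<r} \<rightarrow>\<^sub>E {..<k}" for f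
    using \<delta>'[rule_format, OF that] by simp_all
  define d where "d = Min (\<delta> ` ({..<r} \<rightarrow>\<^sub>E {..<k}))"
  have fin: "finite (\<delta> ` ({..<r} \<rightarrow>\<^sub>E {..<k}))" by (intro finite_imageI finite_PiE) auto
  have "{..<r} \<rightarrow>\<^sub>E {..<k} \<noteq> {}" using \<open>0 < k\<close> by (auto simp: PiE_eq_empty_iff)
  then have "0 < d" unfolding d_def using fin \<delta>(1) by (subst Min_gr_iff) auto
  moreover have "\<exists>y\<in>{a<..<b}. d \<le> \<bar>minor r (mprod k (\<lambda>i p. G i p y) T) (\<lambda>i. i)\<bar>"
    if "integral_tuple k r T" for T
  proof -
    from normalized_tuple[OF \<open>0 < k\<close> that] obtain f S where f: "f \<in> {..<r} \<rightarrow>\<^sub>E {..<k}"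
        "1 \<le> \<bar>fdet r (\<lambda>i l. T (f i) l)\<bar>"
      and S: "\<forall>p j. \<bar>S p j\<bar> \<le> 1" "\<forall>i<r. \<forall>j<r. S (f i) j = (if i = j then 1 else 0)"
      and T: "\<forall>p<k. \<forall>l<r. T p l = mprod r S (\<lambda>i l. T (f i) l) p l"
      by (elim bexE exE conjE) (rule that)
    have "(\<lambda>(p, j). S p j) \<in> K f" using S by (auto simp: K_def)
    then obtain y where y: "y \<in> {a<..<b}" "\<delta> f \<le> \<bar>D (\<lambda>(p, j). S p j) y\<bar>" using \<delta>(2)[OF f(1)] by blast
    have "minor r (mprod k (\<lambda>i p. G i p y) T) (\<lambda>i. i)
        = minor r (mprod k (\<lambda>i p. G i p y) (mprod r S (\<lambda>i l. T (f i) l))) (\<lambda>i. i)"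
      by (rule minor_cong, rule mprod_cong) (use T in simp_all)
    also have "\<dots> = fdet r (\<lambda>i l. T (f i) l) * D (\<lambda>(p, j). S p j) y"
      unfolding mprod_assoc minor_mprod by (simp add: minor_def D_def mprod_def)
    finally have "\<bar>minor r (mprod k (\<lambda>i p. G i p y) T) (\<lambda>i. i)\<bar>
        = \<bar>fdet r (\<lambda>i l. T (f i) l)\<bar> * \<bar>D (\<lambda>(p, j). S p j) y\<bar>" by (simp add: abs_mult)
    moreover have "1 * \<bar>D (\<lambda>(p, j). S p j) y\<bar> \<le> \<bar>fdet r (\<lambda>i l. T (f i) l)\<bar> * \<bar>D (\<lambda>(p, j). S p j) y\<bar>"
      using f(2) by (intro mult_right_mono) auto
    moreover have "d \<le> \<delta> f" unfolding d_def using fin f(1) by (intro Min_le) auto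
    ultimately show ?thesis using y by (intro bexI[of _ y]) auto
  qed
  ultimately show ?thesis by blast
qed

subsection \<open>The non-divergence estimate\<close>

lemma fdet_scale_rows: "fdet r (\<lambda>i j. d i * A i j) = (\<Prod>i<r. d i) * fdet r A"
  unfolding fdet_leibniz
  by (simp add: prod.distrib sum_distrib_left lessThan_atLeast0 mult_ac)

lemma minor_mprod_scale:
  "minor r (mprod k (\<lambda>i p. d i * h i p) T) f = (\<Prod>i<r. d (f i)) * minor r (mprod k h T) f"
proof -
  have "minor r (mprod k (\<lambda>i p. d i * h i p) T) f = fdet r (\<lambda>i j. d (f i) * mprod k h T (f i) j)"
    unfolding minor_def by (rule fdet_cong) (simp add: mprod_def sum_distrib_left mult.assoc)
  then show ?thesis by (simp add: fdet_scale_rows minor_def)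
qed

text \<open>A Cauchy-Binet formula over all maps instead of increasing ones. One factor involves
  only \<open>T\<close>, the other is a product of entries of \<open>h\<close>; this places all
  minors in the span of finitely many products.\<close>

lemma minor_mprod_expand:
  "minor r (mprod k h T) f =
    (\<Sum>q\<in>{..<r} \<rightarrow>\<^sub>E {..<k}. fdet r (\<lambda>i j. T (q i) j) * (\<Prod>i<r. h (f i) (q i)))"
proof -
  have "minor r (mprod k h T) f =
      (\<Sum>\<sigma> | \<sigma> permutes {..<r}. signof \<sigma> * (\<Prod>i<r. \<Sum>p<k. h (f i) p * T p (\<sigma> i)))"
    by (simp add: minor_def mprod_def fdet_leibniz lessThan_atLeast0)
  also have "\<dots> = (\<Sum>\<sigma> | \<sigma> permutes {..<r}. \<Sum>q\<in>{..<r} \<rightarrow>\<^sub>E {..<k}.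
      signof \<sigma> * (\<Prod>i<r. T (q i) (\<sigma> i)) * (\<Prod>i<r. h (f i) (q i)))"
    by (subst prod_sum_PiE) (auto simp: sum_distrib_left prod.distrib mult_ac intro!: sum.cong)
  also have "\<dots> = (\<Sum>q\<in>{..<r} \<rightarrow>\<^sub>E {..<k}. \<Sum>\<sigma> | \<sigma> permutes {..<r}.
      signof \<sigma> * (\<Prod>i<r. T (q i) (\<sigma> i)) * (\<Prod>i<r. h (f i) (q i)))"
    by (rule sum.swap)
  also have "\<dots> = (\<Sum>q\<in>{..<r} \<rightarrow>\<^sub>E {..<k}. fdet r (\<lambda>i j. T (q i) j) * (\<Prod>i<r. h (f i) (q i)))"
    by (simp add: fdet_leibniz sum_distrib_right lessThan_atLeast0)
  finally show ?thesis .
qed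

lemma continuous_on_Max:
  fixes f :: "'i \<Rightarrow> 'a :: topological_space \<Rightarrow> real"
  assumes "finite I" "I \<noteq> {}" "\<And>i. i \<in> I \<Longrightarrow> continuous_on S (f i)"
  shows "continuous_on S (\<lambda>x. Max ((\<lambda>i. f i x) ` I))"
  using assms
proof (induction I rule: finite_ne_induct)
  case (insert i I)
  then have "continuous_on S (\<lambda>x. max (f i x) (Max ((\<lambda>i. f i x) ` I)))"
    by (intro continuous_on_max) auto
  then show ?case using insert.hyps by simp
qed simp

lemma continuous_on_minor_mprod:
  assumes "\<And>i p. i < k \<Longrightarrow> p < k \<Longrightarrow> continuous_on S (\<lambda>x. h x i p)" and "\<And>i. i < r \<Longrightarrow> f i < k"
  shows "continuous_on S (\<lambda>x. minor r (mprod k (h x) T) f)"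
  unfolding minor_def mprod_def
  by (intro continuous_on_fdet continuous_on_sum continuous_on_mult continuous_on_const assms) auto

lemma continuous_on_max_minor_mprod:
  assumes "0 < k" and "\<And>i p. i < k \<Longrightarrow> p < k \<Longrightarrow> continuous_on S (\<lambda>x. h x i p)"
  shows "continuous_on S (\<lambda>x. max_minor k r (mprod k (h x) T))"
  unfolding max_minor_def
proof (rule continuous_on_Max)
  show "{..<r} \<rightarrow>\<^sub>E {..<k} \<noteq> {}" using \<open>0 < k\<close> by (auto simp: PiE_eq_empty_iff)
  show "continuous_on S (\<lambda>x. \<bar>minor r (mprod k (h x) T) f\<bar>)" if "f \<in> {..<r} \<rightarrow>\<^sub>E {..<k}" for f
    using PiE_mem[OF that] assms(2) by (intro continuous_on_rabs continuous_on_minor_mprod) auto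
qed (simp add: finite_PiE)

text \<open>Every maximal minor is the determinant times that of a row-selection matrix, so a
  positive largest minor forces a non-zero integer determinant.\<close>

lemma integral_square_fdet:
  assumes "0 < k" "integral_tuple k k T"
  shows "1 \<le> \<bar>fdet k T\<bar>"
proof -
  obtain f where f: "f \<in> {..<k} \<rightarrow>\<^sub>E {..<k}" "max_minor k k T = \<bar>minor k T f\<bar>"
    using assms(1) by (rule max_minor_attained)
  have "minor k T f = fdet k (\<lambda>i j. \<Sum>p<k. (if f i = p then 1 else 0) * T p j)"
    unfolding minor_def
  proof (rule fdet_cong)
    fix i j assume "i < k"
    then show "T (f i) j = (\<Sum>p<k. (if f i = p then 1 else 0) * T p j)"
      using PiE_mem[OF f(1), of i] by (simp add: if_distrib[where f = "\<lambda>x. x * _"] sum.delta cong: if_cong)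
  qed
  also have "\<dots> = fdet k (\<lambda>i p. if f i = p then 1 else 0) * fdet k T" by (rule fdet_mult)
  finally have "fdet k T \<noteq> 0" using f(2) assms(2) by (auto simp: integral_tuple_def)
  moreover have "fdet k T \<in> \<int>" using assms(2) by (intro fdet_Ints) (auto simp: integral_tuple_def)
  ultimately show ?thesis by (auto elim!: Ints_cases)
qed

lemma geometric_mean_pos:
  assumes "\<And>i. i \<in> {1..k} \<Longrightarrow> 0 < \<theta> i"
  shows "0 < geometric_mean k \<theta>"
proof -
  have "0 < (\<Prod>i=1..k. \<theta> i)" using assms by (intro prod_pos) auto
  then show ?thesis unfolding geometric_mean_def by (metis less_irrefl powr_gt_zero)
qed

lemma powr_inverse_power:
  fixes x :: real
  assumes "0 < x" "0 < n"
  shows "(x powr (1 / real n)) ^ n = x"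
  using assms by (simp add: powr_realpow[symmetric] powr_powr)

lemma geometric_mean_power:
  assumes "0 < k" "\<And>i. i \<in> {1..k} \<Longrightarrow> 0 < \<theta> i"
  shows "geometric_mean k \<theta> ^ k = (\<Prod>i=1..k. \<theta> i)"
proof -
  have "0 < (\<Prod>i=1..k. \<theta> i)" using assms by (intro prod_pos) auto
  then show ?thesis unfolding geometric_mean_def using assms(1) by (rule powr_inverse_power)
qed

lemma Theta_tilde_ge:
  assumes "1 \<le> r" "r < k"
  shows "(\<Prod>i=1..r. \<theta> i) / geometric_mean k \<theta> ^ r \<le> Theta_tilde k \<theta>"
  unfolding Theta_tilde_def using assms by (intro Max_ge) auto

lemma Theta_tilde_pos:
  assumes "2 \<le> k" "\<And>i. i \<in> {1..k} \<Longrightarrow> 0 < \<theta> i"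
  shows "0 < Theta_tilde k \<theta>"
proof -
  have "0 < (\<Prod>i=1..1. \<theta> i) / geometric_mean k \<theta> ^ 1"
    using assms geometric_mean_pos[of k \<theta>] by (intro divide_pos_pos) auto
  also have "\<dots> \<le> Theta_tilde k \<theta>" using assms(1) by (intro Theta_tilde_ge) auto
  finally show ?thesis .
qed

lemma power_mult_le_imp_le_powr:
  fixes A s L :: real
  assumes "0 < n" "0 \<le> s" "0 \<le> A" "0 \<le> L" "s ^ n \<le> A * L ^ n"
  shows "s \<le> A powr (1 / real n) * L"
proof -
  have "(A powr (1 / real n)) ^ n = A"
    using assms(1,3) powr_inverse_power[of A n] by (cases "A = 0") auto
  then have "s ^ n \<le> (A powr (1 / real n) * L) ^ n" using assms(5) by (simp add: power_mult_distrib)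
  then show ?thesis using assms(1,4) by (subst (asm) power_mono_iff) (use assms(2) in auto)
qed

text \<open>The functions enter only through the constants \<open>n\<close>, \<open>C\<close>,
  \<open>c\<^sub>0\<close> and \<open>\<delta>\<close>. The scaling \<open>d\<close> in
  \<open>good\<close> is arbitrary because it will depend on \<open>\<theta>\<close>, whereas
  \<open>n\<close> and \<open>C\<close> must not.\<close>

lemma nondivergence_bound:
  fixes G :: "nat \<Rightarrow> nat \<Rightarrow> real \<Rightarrow> real" and \<theta> :: "nat \<Rightarrow> real"
  assumes k: "2 \<le> k" and ab: "a < b" and "0 < n" "1 \<le> C" "0 < c\<^sub>0" "0 < \<delta>"
    and contG: "\<And>i p. i < k \<Longrightarrow> p < k \<Longrightarrow> continuous_on {a..<b} (G i p)"
    and good: "\<And>r f d T a' b' y \<epsilon>. r \<le> k \<Longrightarrow> f \<in> {..<r} \<rightarrow>\<^sub>E {..<k} \<Longrightarrow> a \<le> a' \<Longrightarrow> b' \<le> b \<Longrightarrow>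
      y \<in> {a'..<b'} \<Longrightarrow> 0 < \<epsilon> \<Longrightarrow>
      \<bar>minor r (mprod k (\<lambda>i p. d i * G i p y) T) f\<bar> *
        measure lebesgue {x \<in> {a'..<b'}. \<bar>minor r (mprod k (\<lambda>i p. d i * G i p x) T) f\<bar> < \<epsilon>} ^ n
        \<le> C * \<epsilon> * (b' - a') ^ n"
    and c0: "\<And>y. y \<in> {a..<b} \<Longrightarrow> c\<^sub>0 \<le> \<bar>fdet k (\<lambda>i p. G i p y)\<bar>"
    and \<delta>: "\<And>r T. 1 \<le> r \<Longrightarrow> r < k \<Longrightarrow> integral_tuple k r T \<Longrightarrow>
      \<exists>y\<in>{a<..<b}. \<delta> \<le> \<bar>minor r (mprod k (\<lambda>i p. G i p y) T) (\<lambda>i. i)\<bar>"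
    and \<theta>: "\<And>i. i \<in> {1..k} \<Longrightarrow> 0 < \<theta> i"
  shows "\<exists>N\<in>lmeasurable. {x \<in> {a..<b}. \<exists>v. (\<forall>p<k. v p \<in> \<int>) \<and> (\<exists>p<k. v p \<noteq> 0) \<and>
      (\<forall>i<k. \<bar>\<Sum>p<k. G i p x * v p\<bar> < \<theta> (Suc i))} \<subseteq> N \<and>
    measure lebesgue N \<le> marking_const k * (C * real k) powr (1 / real n) * (1 + (1 / c\<^sub>0) powr (1 / real n)) *
      (1 + (Theta_tilde k \<theta> / \<delta>) powr (1 / real n)) * geometric_mean k \<theta> powr (1 / real n) * (b - a)"
proof -
  define \<alpha> where "\<alpha> = 1 / real n"
  define \<tau> where "\<tau> = geometric_mean k \<theta>"
  define \<Theta> where "\<Theta> = Theta_tilde k \<theta>"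
  \<comment> \<open>The bound 1 is needed when a short vector is adjoined, \<open>c\<^sub>0\<close>
    comes from rank \<open>k\<close>, and \<open>\<delta> / \<Theta>\<close> from the smaller
    ranks.\<close>
  define \<rho> where "\<rho> = min 1 (min c\<^sub>0 (\<delta> / \<Theta>))"
  define \<epsilon> where "\<epsilon> = real k * \<tau>"
  \<comment> \<open>The proportion obtained by taking roots in the power law for a function that
    reaches \<open>\<rho>\<close>, with sublevel \<open>\<epsilon>\<close>.\<close>
  define \<eta> where "\<eta> = (C * \<epsilon> / \<rho>) powr \<alpha>"
  define d where "d = (\<lambda>i. \<tau> / \<theta> (Suc i))"
  define h where "h = (\<lambda>x i p. d i * G i p x)"
  define \<psi> where "\<psi> = (\<lambda>t x. max_minor k (fst t) (mprod k (h x) (snd t)))"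
  define Bad where "Bad = {x \<in> {a..<b}. \<exists>v. (\<forall>p<k. v p \<in> \<int>) \<and> (\<exists>p<k. v p \<noteq> 0) \<and>
      (\<forall>i<k. \<bar>\<Sum>p<k. G i p x * v p\<bar> < \<theta> (Suc i))}"
  have k0: "0 < k" using k by simp
  have \<tau>: "0 < \<tau>" unfolding \<tau>_def using \<theta> by (rule geometric_mean_pos)
  have \<Theta>: "0 < \<Theta>" unfolding \<Theta>_def using k \<theta> by (rule Theta_tilde_pos)
  have \<rho>: "0 < \<rho>" "\<rho> \<le> 1" "\<rho> \<le> c\<^sub>0" "\<rho> \<le> \<delta> / \<Theta>"
    using \<open>0 < c\<^sub>0\<close> \<open>0 < \<delta>\<close> \<Theta> by (auto simp: \<rho>_def)
  have \<epsilon>: "0 < \<epsilon>" using k0 \<tau> by (simp add: \<epsilon>_def)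
  have \<alpha>: "0 < \<alpha>" using \<open>0 < n\<close> by (simp add: \<alpha>_def)
  have \<eta>_le: "\<eta> \<le> (C * real k) powr \<alpha> * \<tau> powr \<alpha> * ((1 + (1 / c\<^sub>0) powr \<alpha>) * (1 + (\<Theta> / \<delta>) powr \<alpha>))"
  proof -
    have "\<eta> = (C * real k) powr \<alpha> * \<tau> powr \<alpha> * (1 / \<rho>) powr \<alpha>"
      unfolding \<eta>_def \<epsilon>_def using \<open>1 \<le> C\<close> \<tau> \<rho>(1)
      by (simp add: powr_mult[symmetric] mult.assoc)
    moreover have "(1 / \<rho>) powr \<alpha> \<le> (1 + (1 / c\<^sub>0) powr \<alpha>) * (1 + (\<Theta> / \<delta>) powr \<alpha>)"
    proof -
      have "(1 / \<rho>) powr \<alpha> = 1 \<or> (1 / \<rho>) powr \<alpha> = (1 / c\<^sub>0) powr \<alpha> \<or> (1 / \<rho>) powr \<alpha> = (\<Theta> / \<delta>) powr \<alpha>"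
        by (auto simp: \<rho>_def min_def)
      moreover have "0 \<le> (1 / c\<^sub>0) powr \<alpha> * (\<Theta> / \<delta>) powr \<alpha>" by simp
      moreover have "0 \<le> (1 / c\<^sub>0) powr \<alpha>" "0 \<le> (\<Theta> / \<delta>) powr \<alpha>" by simp_all
      ultimately show ?thesis unfolding ring_distribs by linarith
    qed
    ultimately show ?thesis by (simp add: mult_left_mono)
  qed
  have "\<exists>N\<in>lmeasurable. Bad \<subseteq> N \<and> measure lebesgue N \<le> marking_const k * \<eta> * (b - a)"
  proof (cases "\<epsilon> \<le> \<rho>")
    case False
    \<comment> \<open>When \<open>\<epsilon>\<close> exceeds \<open>\<rho>\<close> the claimed bound
      is at least the length of the interval, so the whole interval may be taken.\<close>
    have "1 \<le> \<eta>"
    proof -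
      have "1 * \<rho> \<le> C * \<epsilon>" using False \<open>1 \<le> C\<close> \<rho>(1) by (intro mult_mono) auto
      then have "1 \<le> C * \<epsilon> / \<rho>" using \<rho>(1) by (simp add: field_simps)
      then show ?thesis unfolding \<eta>_def using \<alpha> by (intro ge_one_powr_ge_zero) auto
    qed
    moreover have "1 \<le> marking_const k"
      using k0 marking_const_nonneg[of "k - 1"] by (cases k) auto
    ultimately have "1 * 1 \<le> marking_const k * \<eta>" by (intro mult_mono) auto
    then have "1 * (b - a) \<le> marking_const k * \<eta> * (b - a)" using ab by (intro mult_right_mono) auto
    moreover have "{a..<b} \<in> lmeasurable" by (rule bounded_set_imp_lmeasurable) auto
    ultimately show ?thesis using ab by (intro bexI[of _ "{a..<b}"]) (auto simp: Bad_def)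
  next
    case True
    have cont: "continuous_on {a..<b} (\<psi> t)" for t
      unfolding \<psi>_def h_def using k0 contG
      by (intro continuous_on_max_minor_mprod continuous_on_mult continuous_on_const) auto
    have good': "\<exists>S\<in>sets lebesgue. {x \<in> {a'..<b'}. \<psi> t x < \<epsilon>} \<subseteq> S \<and> emeasure lebesgue S \<le> ennreal (\<eta> * (b' - a'))"
      if t: "t \<in> minimal_tuples k" and ab': "a \<le> a'" "a' < b'" "b' \<le> b" and y: "y \<in> {a'..<b'}" "\<rho> \<le> \<psi> t y" for t a' b' y
    proof -
      define r where "r = fst t"
      have r: "r \<le> k"
        using t max_minor_pos_le[OF k0, of r "snd t"] by (auto simp: minimal_tuples_def integral_tuple_def r_def)
      \<comment> \<open>A minor attaining the maximum at \<open>y\<close> is kept fixed: it reaches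
        \<open>\<rho>\<close> there, and its sublevel set contains that of the maximum.\<close>
      obtain f where f: "f \<in> {..<r} \<rightarrow>\<^sub>E {..<k}" "\<psi> t y = \<bar>minor r (mprod k (h y) (snd t)) f\<bar>"
        unfolding \<psi>_def r_def using k0 by (rule max_minor_attained)
      define m where "m = (\<lambda>x. minor r (mprod k (h x) (snd t)) f)"
      define S where "S = {x \<in> {a'..<b'}. \<bar>m x\<bar> < \<epsilon>}"
      have fk: "f i < k" if "i < r" for i using PiE_mem[OF f(1), of i] that by simp
      have "continuous_on {a..<b} m"
        unfolding m_def h_def using contG fk
        by (intro continuous_on_minor_mprod continuous_on_mult continuous_on_const) auto
      then have "continuous_on {a'..<b'} m" by (rule continuous_on_subset) (use ab' in auto)
      then have S: "S \<in> lmeasurable" unfolding S_def by (rule sublevel_lmeasurable)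
      have "\<rho> * measure lebesgue S ^ n \<le> \<bar>m y\<bar> * measure lebesgue S ^ n"
        using y(2) f(2) by (intro mult_right_mono) (auto simp: m_def)
      also have "\<dots> \<le> C * \<epsilon> * (b' - a') ^ n"
        unfolding S_def m_def h_def using r f(1) ab'(1,3) y(1) \<epsilon> by (rule good)
      finally have "measure lebesgue S ^ n \<le> (C * \<epsilon> / \<rho>) * (b' - a') ^ n"
        using \<rho>(1) by (simp add: field_simps)
      then have "measure lebesgue S \<le> \<eta> * (b' - a')"
        unfolding \<eta>_def \<alpha>_def using \<open>0 < n\<close> \<open>1 \<le> C\<close> \<epsilon> \<rho>(1) ab'
        by (intro power_mult_le_imp_le_powr) auto
      then have "emeasure lebesgue S \<le> ennreal (\<eta> * (b' - a'))"
        using S by (simp add: emeasure_eq_measure2 ennreal_leI)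
      moreover have "\<bar>m x\<bar> \<le> \<psi> t x" for x
        using fk unfolding m_def \<psi>_def r_def by (intro abs_minor_le_max_minor)
      then have "{x \<in> {a'..<b'}. \<psi> t x < \<epsilon>} \<subseteq> S"
        unfolding S_def using le_less_trans by blast
      ultimately show ?thesis using S by (intro bexI[of _ S]) (auto intro: fmeasurableD)
    qed
    have low: "\<exists>y\<in>{a..<b}. \<rho> \<le> \<psi> t y" if t: "t \<in> minimal_tuples k" for t
    proof -
      obtain r T where rT: "t = (r, T)" by (cases t)
      have T: "integral_tuple k r T" "1 \<le> r" using t by (auto simp: minimal_tuples_def rT)
      then have "r \<le> k" using max_minor_pos_le[OF k0, of r T] by (simp add: integral_tuple_def)
      have ge: "(\<Prod>i<r. d i) * \<bar>minor r (mprod k (\<lambda>i p. G i p y) T) (\<lambda>i. i)\<bar> \<le> \<psi> t y" for y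
      proof -
        have "\<bar>minor r (mprod k (h y) T) (\<lambda>i. i)\<bar> \<le> \<psi> t y"
          unfolding \<psi>_def rT fst_conv snd_conv using \<open>r \<le> k\<close> by (intro abs_minor_le_max_minor) auto
        moreover have "0 \<le> (\<Prod>i<r. d i)"
          using \<tau> \<theta> \<open>r \<le> k\<close> by (intro prod_nonneg) (auto simp: d_def intro!: divide_nonneg_nonneg less_imp_le)
        ultimately show ?thesis by (simp add: h_def minor_mprod_scale abs_mult)
      qed
      have prod_d: "(\<Prod>i<r. d i) = \<tau> ^ r / (\<Prod>i=1..r. \<theta> i)"
        by (simp add: d_def prod_dividef prod.atLeast1_atMost_eq)
      have prod_pos: "0 < (\<Prod>i=1..r. \<theta> i)" using \<theta> \<open>r \<le> k\<close> by (intro prod_pos) auto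
      show ?thesis
      proof (cases "r = k")
        case True
        \<comment> \<open>In full rank the scaling factors cancel, since \<open>\<tau>\<close> is
          the geometric mean; the integer determinant of \<open>T\<close> is at least 1 in
          modulus.\<close>
        have "\<tau> ^ r = (\<Prod>i=1..r. \<theta> i)"
          unfolding \<tau>_def True using k0 \<theta> by (rule geometric_mean_power)
        then have "(\<Prod>i<r. d i) = 1"
          unfolding prod_d using prod_pos by (metis divide_self less_irrefl)
        moreover have "minor r (mprod k (\<lambda>i p. G i p a) T) (\<lambda>i. i) = fdet k T * fdet k (\<lambda>i p. G i p a)"
          unfolding True minor_mprod by (simp add: minor_def)
        moreover have "1 * c\<^sub>0 \<le> \<bar>fdet k T\<bar> * \<bar>fdet k (\<lambda>i p. G i p a)\<bar>"
          using integral_square_fdet[OF k0] T True c0[of a] ab \<open>0 < c\<^sub>0\<close> by (intro mult_mono) auto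
        ultimately have "c\<^sub>0 \<le> \<psi> t a" using ge[of a] by (simp add: abs_mult)
        then show ?thesis using ab \<rho>(3) by (intro bexI[of _ a]) auto
      next
        case False
        then have "r < k" using \<open>r \<le> k\<close> by simp
        obtain y where y: "y \<in> {a<..<b}" "\<delta> \<le> \<bar>minor r (mprod k (\<lambda>i p. G i p y) T) (\<lambda>i. i)\<bar>"
          using \<delta>[OF T(2) \<open>r < k\<close> T(1)] by blast
        have "(\<Prod>i=1..r. \<theta> i) / \<tau> ^ r \<le> \<Theta>"
          unfolding \<Theta>_def \<tau>_def using T(2) \<open>r < k\<close> by (rule Theta_tilde_ge)
        then have "1 / \<Theta> \<le> (\<Prod>i<r. d i)"
          unfolding prod_d using \<Theta> \<tau> prod_pos by (simp add: field_simps)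
        then have "1 / \<Theta> * \<delta> \<le> (\<Prod>i<r. d i) * \<bar>minor r (mprod k (\<lambda>i p. G i p y) T) (\<lambda>i. i)\<bar>"
          using y(2) \<Theta> \<open>0 < \<delta>\<close> by (intro mult_mono) (auto intro: order_trans[rotated])
        then have "\<rho> \<le> \<psi> t y" using ge[of y] \<rho>(4) by simp
        then show ?thesis using y(1) by (intro bexI[of _ y]) auto
      qed
    qed
    have rk: "fst ` minimal_tuples k \<subseteq> {1..k}"
    proof
      fix r assume "r \<in> fst ` minimal_tuples k"
      then obtain T where "0 < r" "0 < max_minor k r T"
        by (auto simp: minimal_tuples_def integral_tuple_def)
      then show "r \<in> {1..k}" using max_minor_pos_le[OF k0] by auto
    qed
    then have fin: "finite (fst ` minimal_tuples k)" by (rule finite_subset) simp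
    have "card (fst ` minimal_tuples k) \<le> card {1..k}" using rk by (intro card_mono) auto
    then have card: "card (fst ` minimal_tuples k) \<le> k" by simp
    have \<eta>0: "0 \<le> \<eta>" by (simp add: \<eta>_def)
    have sym: "comparable k s t \<Longrightarrow> comparable k t s" and irr: "comparable k s t \<Longrightarrow> fst s \<noteq> fst t" for s t
      by (auto simp: comparable_def)
    have "\<exists>N\<in>sets lebesgue. emeasure lebesgue N \<le> ennreal (marking_const k * \<eta> * (b - a)) \<and>
        (\<forall>x\<in>{a..<b} - N. marked (comparable k) \<psi> \<epsilon> \<rho> (minimal_tuples k) x)"
    proof (rule marked_points[where P\<^sub>0 = "minimal_tuples k" and rk = fst and lo = a and hi = b])
      show "comparable k t s" if "comparable k s t" for s t using that by (rule sym)
      show "fst s \<noteq> fst t" if "comparable k s t" for s t using that by (rule irr)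
      show "continuous_on {a..<b} (\<psi> t)" for t by (rule cont)
      show "\<exists>S\<in>sets lebesgue. {x \<in> {a'..<b'}. \<psi> t x < \<epsilon>} \<subseteq> S \<and> emeasure lebesgue S \<le> ennreal (\<eta> * (b' - a'))"
        if "t \<in> minimal_tuples k" "a \<le> a'" "a' < b'" "b' \<le> b" "y \<in> {a'..<b'}" "\<rho> \<le> \<psi> t y" for t a' b' y
        using that by (rule good')
      show "\<exists>y\<in>{a..<b}. \<rho> \<le> \<psi> t y" if "t \<in> minimal_tuples k" for t using that by (rule low)
    qed (use \<eta>0 fin card ab in auto)
    then obtain N where N: "N \<in> sets lebesgue" "emeasure lebesgue N \<le> ennreal (marking_const k * \<eta> * (b - a))"
      and marked: "\<forall>x\<in>{a..<b} - N. marked (comparable k) \<psi> \<epsilon> \<rho> (minimal_tuples k) x"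
      by (elim bexE conjE) (rule that)
    have "emeasure lebesgue N < \<infinity>" using N(2) by (rule le_less_trans) simp
    then have Nm: "N \<in> lmeasurable" using N(1) by (intro fmeasurableI)
    have "measure lebesgue N \<le> marking_const k * \<eta> * (b - a)"
      using N(2) Nm \<eta>0 ab marking_const_nonneg[of k]
      by (simp add: emeasure_eq_measure2 ennreal_le_iff)
    moreover have "Bad \<subseteq> N"
    proof (rule subsetI, rule ccontr)
      fix x assume "x \<in> Bad" "x \<notin> N"
      then obtain v where x: "x \<in> {a..<b} - N" and v: "\<And>p. p < k \<Longrightarrow> v p \<in> \<int>" "\<exists>p<k. v p \<noteq> 0"
        "\<And>i. i < k \<Longrightarrow> \<bar>\<Sum>p<k. G i p x * v p\<bar> < \<theta> (Suc i)"
        by (auto simp: Bad_def)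
      show False
      proof (rule marked_no_short_vector[OF k0 \<tau> _ \<rho>(2), where h = h and x = x and v = v])
        show "real k * \<tau> \<le> \<rho>" using True by (simp add: \<epsilon>_def)
        show "marked (comparable k) (\<lambda>t x. max_minor k (fst t) (mprod k (h x) (snd t))) (real k * \<tau>) \<rho>
            (minimal_tuples k) x"
          using marked x unfolding \<psi>_def \<epsilon>_def by blast
        \<comment> \<open>The scaling \<open>d i\<close> turns the individual bound
          \<open>\<theta> (Suc i)\<close> into the common bound \<open>\<tau>\<close>.\<close>
        show "\<bar>\<Sum>p<k. h x i p * v p\<bar> < \<tau>" if "i < k" for i
        proof -
          have "(\<Sum>p<k. h x i p * v p) = d i * (\<Sum>p<k. G i p x * v p)"
            by (simp add: h_def sum_distrib_left mult.assoc)
          moreover have "0 < d i" using \<tau> \<theta>[of "Suc i"] that by (simp add: d_def)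
          moreover have "d i * \<bar>\<Sum>p<k. G i p x * v p\<bar> < d i * \<theta> (Suc i)"
            using \<open>0 < d i\<close> v(3)[OF that] by (intro mult_strict_left_mono)
          moreover have "d i * \<theta> (Suc i) = \<tau>" using \<theta>[of "Suc i"] that by (simp add: d_def)
          ultimately show ?thesis by (simp add: abs_mult)
        qed
      qed (use v in auto)
    qed
    ultimately show ?thesis using Nm by blast
  qed
  then obtain N where N: "N \<in> lmeasurable" "Bad \<subseteq> N" "measure lebesgue N \<le> marking_const k * \<eta> * (b - a)" by blast
  note N(3)
  also have "marking_const k * \<eta> * (b - a) \<le> marking_const k * ((C * real k) powr \<alpha> * \<tau> powr \<alpha> *
      ((1 + (1 / c\<^sub>0) powr \<alpha>) * (1 + (\<Theta> / \<delta>) powr \<alpha>))) * (b - a)"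
    using \<eta>_le ab marking_const_nonneg[of k] by (intro mult_right_mono mult_left_mono) auto
  also have "\<dots> = marking_const k * (C * real k) powr \<alpha> * (1 + (1 / c\<^sub>0) powr \<alpha>) *
      (1 + (\<Theta> / \<delta>) powr \<alpha>) * \<tau> powr \<alpha> * (b - a)"
    by (simp only: mult_ac)
  finally show ?thesis
    using N(1,2) unfolding Bad_def \<alpha>_def \<tau>_def \<Theta>_def by blast
qed

subsection \<open>Real analytic functions\<close>

lemma real_analytic_on_power_series:
  assumes "real_analytic_on f S" "x0 \<in> S"
  shows "\<exists>R>0. \<exists>F. ereal R \<le> fps_conv_radius F \<and> (\<forall>x. \<bar>x - x0\<bar> < R \<longrightarrow> f x = eval_fps F (x - x0))"
proof -
  obtain r c where r: "0 < r" "\<forall>y\<in>ball x0 r. (\<lambda>n. c n * (y - x0) ^ n) sums f y"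
    using assms unfolding real_analytic_on_def by blast
  have "x0 + r / 2 \<in> ball x0 r" using r(1) by (simp add: dist_real_def)
  then have "summable (\<lambda>n. c n * (r / 2) ^ n)" using r(2) by (force simp: sums_iff)
  then have "ereal (norm (r / 2)) \<le> conv_radius c" by (rule conv_radius_geI)
  then have "ereal (r / 2) \<le> fps_conv_radius (Abs_fps c)" using r(1) by (simp add: fps_conv_radius_def)
  moreover have "f x = eval_fps (Abs_fps c) (x - x0)" if "\<bar>x - x0\<bar> < r / 2" for x
  proof -
    have "x \<in> ball x0 r" using that r(1) by (simp add: dist_real_def abs_minus_commute[of x0])
    then show ?thesis using r(2) by (simp add: eval_fps_def sums_iff)
  qed
  ultimately show ?thesis using r(1) by (intro exI[of _ "r / 2"] exI[of _ "Abs_fps c"] conjI) auto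
qed

lemma deriv_funpow_eval_fps:
  fixes F :: "real fps"
  assumes "ereal R \<le> fps_conv_radius F" and "\<And>x. \<bar>x - x0\<bar> < R \<Longrightarrow> f x = eval_fps F (x - x0)"
    and "\<bar>x - x0\<bar> < R"
  shows "(deriv ^^ i) f x = eval_fps ((fps_deriv ^^ i) F) (x - x0)"
    and "((deriv ^^ i) f has_real_derivative (deriv ^^ Suc i) f x) (at x)"
proof -
  \<comment> \<open>The equality is assumed on the whole ball, since differentiating at
    \<open>x\<close> requires it on a neighbourhood; the induction therefore varies
    \<open>x\<close>.\<close>
  have step: "((deriv ^^ i) f has_real_derivative eval_fps ((fps_deriv ^^ Suc i) F) (x - x0)) (at x)"
    if eq: "\<And>y. \<bar>y - x0\<bar> < R \<Longrightarrow> (deriv ^^ i) f y = eval_fps ((fps_deriv ^^ i) F) (y - x0)"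
      and x: "\<bar>x - x0\<bar> < R" for i x
  proof -
    have "ereal (norm (x - x0)) < ereal R" using x by simp
    also have "\<dots> \<le> fps_conv_radius ((fps_deriv ^^ i) F)"
      using assms(1) fps_conv_radius_deriv_funpow by (rule order_trans)
    finally have "(eval_fps ((fps_deriv ^^ i) F) has_real_derivative
        eval_fps ((fps_deriv ^^ Suc i) F) (x - x0)) (at (x - x0))"
      by (simp add: has_field_derivative_eval_fps)
    then have "((\<lambda>y. eval_fps ((fps_deriv ^^ i) F) (y - x0)) has_real_derivative
        eval_fps ((fps_deriv ^^ Suc i) F) (x - x0)) (at x)"
      using DERIV_shift[of "eval_fps ((fps_deriv ^^ i) F)" _ x "- x0"] by simp
    then show ?thesis
    proof (rule has_field_derivative_transform_within_open)
      show "open (ball x0 R)" by simp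
      show "x \<in> ball x0 R" using x by (simp add: dist_real_def abs_minus_commute)
      show "eval_fps ((fps_deriv ^^ i) F) (y - x0) = (deriv ^^ i) f y" if "y \<in> ball x0 R" for y
        using that by (intro eq[symmetric]) (simp add: dist_real_def abs_minus_commute)
    qed
  qed
  have eq: "(deriv ^^ i) f x = eval_fps ((fps_deriv ^^ i) F) (x - x0)" if "\<bar>x - x0\<bar> < R" for i x
    using that
  proof (induction i arbitrary: x)
    case 0
    then show ?case by (simp add: assms(2))
  next
    case (Suc i)
    show ?case using DERIV_imp_deriv[OF step[OF Suc.IH Suc.prems]] by simp
  qed
  show "(deriv ^^ i) f x = eval_fps ((fps_deriv ^^ i) F) (x - x0)" using assms(3) by (rule eq)
  show "((deriv ^^ i) f has_real_derivative (deriv ^^ Suc i) f x) (at x)"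
    using step[OF eq assms(3), of i] eq[OF assms(3), of "Suc i"] by simp
qed

lemma fps_conv_radius_prod:
  fixes F :: "'i \<Rightarrow> real fps"
  assumes "\<And>i. i \<in> I \<Longrightarrow> r \<le> fps_conv_radius (F i)"
  shows "r \<le> fps_conv_radius (\<Prod>i\<in>I. F i)"
  using assms
proof (induction I rule: infinite_finite_induct)
  case (insert i I)
  have "r \<le> fps_conv_radius (F i * (\<Prod>i\<in>I. F i))"
    using insert by (intro order_trans[OF _ fps_conv_radius_mult]) auto
  then show ?case using insert.hyps by simp
qed auto

lemma eval_fps_prod:
  fixes F :: "'i \<Rightarrow> real fps"
  assumes "\<And>i. i \<in> I \<Longrightarrow> r \<le> fps_conv_radius (F i)" and "ereal (norm z) < r"
  shows "eval_fps (\<Prod>i\<in>I. F i) z = (\<Prod>i\<in>I. eval_fps (F i) z)"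
  using assms
proof (induction I rule: infinite_finite_induct)
  case (insert i I)
  have "ereal (norm z) < fps_conv_radius (F i)"
    using insert.prems by (intro less_le_trans[OF insert.prems(2)]) auto
  moreover have "ereal (norm z) < fps_conv_radius (\<Prod>i\<in>I. F i)"
    using insert.prems by (intro less_le_trans[OF insert.prems(2)] fps_conv_radius_prod) auto
  ultimately show ?case using insert by (simp add: eval_fps_mult)
qed auto

text \<open>All minors of all ranks are combinations of one finite family of products of
  derivatives. The scaling \<open>d\<close> and the array \<open>T\<close> affect only the
  coefficients, over which the sublevel estimate is uniform.\<close>

lemma minor_sublevel_measure:
  fixes F :: "nat \<Rightarrow> real fps" and G :: "nat \<Rightarrow> nat \<Rightarrow> real \<Rightarrow> real"
  assumes "0 < R" and rad: "\<And>p. p < k \<Longrightarrow> ereal R \<le> fps_conv_radius (F p)"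
    and G: "\<And>i p x. p < k \<Longrightarrow> \<bar>x - x0\<bar> < R \<Longrightarrow> G i p x = eval_fps ((fps_deriv ^^ i) (F p)) (x - x0)"
  shows "\<exists>R'>0. R' \<le> R \<and> (\<exists>n>0. \<exists>C\<ge>1. \<forall>r f d T a b y \<epsilon>. r \<le> k \<longrightarrow> f \<in> {..<r} \<rightarrow>\<^sub>E {..<k} \<longrightarrow>
    {a..<b} \<subseteq> {x0 - R'<..<x0 + R'} \<longrightarrow> y \<in> {a..<b} \<longrightarrow> 0 < \<epsilon> \<longrightarrow>
      \<bar>minor r (mprod k (\<lambda>i p. d i * G i p y) T) f\<bar> *
        measure lebesgue {x \<in> {a..<b}. \<bar>minor r (mprod k (\<lambda>i p. d i * G i p x) T) f\<bar> < \<epsilon>} ^ n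
        \<le> C * \<epsilon> * (b - a) ^ n)"
proof -
  define A where "A = (SIGMA r:{..k}. ({..<r} \<rightarrow>\<^sub>E {..<k}) \<times> ({..<r} \<rightarrow>\<^sub>E {..<k}))"
  define \<Phi> where "\<Phi> = (\<lambda>(r :: nat, f, q). \<Prod>i<r. (fps_deriv ^^ (f i :: nat)) (F (q i)))"
  have finA: "finite A" unfolding A_def by (intro finite_SigmaI finite_cartesian_product finite_PiE) auto
  have rad': "ereal R \<le> fps_conv_radius ((fps_deriv ^^ m) (F p))" if "p < k" for m p
    using rad[OF that] fps_conv_radius_deriv_funpow by (rule order_trans)
  have rad\<Phi>: "ereal R \<le> fps_conv_radius (\<Phi> s)" if "s \<in> A" for s
  proof -
    obtain r f q where s: "s = (r, f, q)" by (cases s)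
    then have q: "q \<in> {..<r} \<rightarrow>\<^sub>E {..<k}" using that by (simp add: A_def)
    show ?thesis unfolding s \<Phi>_def prod.case
      using PiE_mem[OF q] by (intro fps_conv_radius_prod rad') auto
  qed
  have "\<exists>R'>0. R' \<le> R \<and> (\<exists>n>0. \<exists>C\<ge>1. \<forall>c a b \<epsilon> y f. {a..<b} \<subseteq> {x0 - R'<..<x0 + R'} \<longrightarrow>
    y \<in> {a..<b} \<longrightarrow> 0 < \<epsilon> \<longrightarrow> (\<forall>x\<in>{a..<b}. f x = (\<Sum>s\<in>A. c s * eval_fps (\<Phi> s) (x - x0))) \<longrightarrow>
      \<bar>f y\<bar> * measure lebesgue {x \<in> {a..<b}. \<bar>f x\<bar> < \<epsilon>} ^ n \<le> C * \<epsilon> * (b - a) ^ n)"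
    by (rule analytic_span_sublevel_measure[OF finA rad\<Phi> \<open>0 < R\<close>])
  then obtain R' n C where R': "0 < R'" "R' \<le> R" "0 < n" "1 \<le> C"
    and good: "\<forall>c a b \<epsilon> y f. {a..<b} \<subseteq> {x0 - R'<..<x0 + R'} \<longrightarrow> y \<in> {a..<b} \<longrightarrow> 0 < \<epsilon> \<longrightarrow>
      (\<forall>x\<in>{a..<b}. f x = (\<Sum>s\<in>A. c s * eval_fps (\<Phi> s) (x - x0))) \<longrightarrow>
      \<bar>f y\<bar> * measure lebesgue {x \<in> {a..<b}. \<bar>f x\<bar> < \<epsilon>} ^ n \<le> C * \<epsilon> * (b - a) ^ n"
    by (elim exE conjE) (rule that)
  have le: "\<bar>minor r (mprod k (\<lambda>i p. d i * G i p y) T) f\<bar> *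
        measure lebesgue {x \<in> {a..<b}. \<bar>minor r (mprod k (\<lambda>i p. d i * G i p x) T) f\<bar> < \<epsilon>} ^ n
        \<le> C * \<epsilon> * (b - a) ^ n"
    if r: "r \<le> k" and f: "f \<in> {..<r} \<rightarrow>\<^sub>E {..<k}" and sub: "{a..<b} \<subseteq> {x0 - R'<..<x0 + R'}"
      and y: "y \<in> {a..<b}" "0 < \<epsilon>" for r f d T a b y \<epsilon>
  proof (rule good[rule_format, OF sub y])
    let ?Q = "{..<r} \<rightarrow>\<^sub>E {..<k}"
    \<comment> \<open>Coefficients supported on the block of the given \<open>r\<close> and
      \<open>f\<close>, so that one index set \<open>A\<close> serves all minors.\<close>
    define c where "c = (\<lambda>(r', f', q). if r' = r \<and> f' = f then (\<Prod>i<r. d (f i)) * fdet r (\<lambda>i j. T (q i :: nat) j) else 0)"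
    fix x assume "x \<in> {a..<b}"
    then have x: "\<bar>x - x0\<bar> < R" using sub R'(2) by force
    have "minor r (mprod k (\<lambda>i p. d i * G i p x) T) f
        = (\<Sum>q\<in>?Q. (\<Prod>i<r. d (f i)) * (fdet r (\<lambda>i j. T (q i) j) * (\<Prod>i<r. G (f i) (q i) x)))"
      unfolding minor_mprod_scale minor_mprod_expand sum_distrib_left ..
    also have "\<dots> = (\<Sum>q\<in>?Q. c (r, f, q) * eval_fps (\<Phi> (r, f, q)) (x - x0))"
    proof (rule sum.cong[OF refl])
      fix q assume q: "q \<in> ?Q"
      have "eval_fps (\<Phi> (r, f, q)) (x - x0) = (\<Prod>i<r. eval_fps ((fps_deriv ^^ f i) (F (q i))) (x - x0))"
        unfolding \<Phi>_def prod.case using PiE_mem[OF q] x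
        by (intro eval_fps_prod[where r = "ereal R"] rad') auto
      also have "\<dots> = (\<Prod>i<r. G (f i) (q i) x)"
        using PiE_mem[OF q] x by (intro prod.cong refl G[symmetric]) auto
      finally show "(\<Prod>i<r. d (f i)) * (fdet r (\<lambda>i j. T (q i) j) * (\<Prod>i<r. G (f i) (q i) x))
          = c (r, f, q) * eval_fps (\<Phi> (r, f, q)) (x - x0)"
        by (simp add: c_def)
    qed
    also have "\<dots> = (\<Sum>s\<in>(\<lambda>q. (r, f, q)) ` ?Q. c s * eval_fps (\<Phi> s) (x - x0))"
      by (subst sum.reindex) (auto simp: inj_on_def)
    also have "\<dots> = (\<Sum>s\<in>A. c s * eval_fps (\<Phi> s) (x - x0))"
    proof (rule sum.mono_neutral_left[OF finA])
      show "(\<lambda>q. (r, f, q)) ` ?Q \<subseteq> A" using r f by (auto simp: A_def)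
      show "\<forall>s\<in>A - (\<lambda>q. (r, f, q)) ` ?Q. c s * eval_fps (\<Phi> s) (x - x0) = 0"
        by (auto simp: A_def c_def)
    qed
    finally show "minor r (mprod k (\<lambda>i p. d i * G i p x) T) f = (\<Sum>s\<in>A. c s * eval_fps (\<Phi> s) (x - x0))" .
  qed
  show ?thesis
  proof (intro exI conjI allI impI)
    show "0 < R'" "R' \<le> R" "0 < n" "1 \<le> C" by (fact R')+
    fix r f d T a b y \<epsilon>
    assume "r \<le> k" "f \<in> {..<r} \<rightarrow>\<^sub>E {..<k}" "{a..<b} \<subseteq> {x0 - R'<..<x0 + R'}" "y \<in> {a..<b}" "(0 :: real) < \<epsilon>"
    then show "\<bar>minor r (mprod k (\<lambda>i p. d i * G i p y) T) f\<bar> *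
        measure lebesgue {x \<in> {a..<b}. \<bar>minor r (mprod k (\<lambda>i p. d i * G i p x) T) f\<bar> < \<epsilon>} ^ n
        \<le> C * \<epsilon> * (b - a) ^ n"
      by (rule le)
  qed
qed

section \<open>Arbitrary intervals and the set of small combinations\<close>

lemma bounded_interval_endpoints:
  fixes J :: "real set"
  assumes "is_interval J" "J \<noteq> {}" "J \<subseteq> {l<..<u}"
  obtains a b where "a \<le> b" "l \<le> a" "b \<le> u" "{a<..<b} \<subseteq> J" "J \<subseteq> {a..b}"
proof
  have bdd: "bdd_below J" "bdd_above J"
    using assms(3) by (auto intro!: bdd_belowI[of _ l] bdd_aboveI[of _ u] simp: subset_iff less_imp_le)
  show "Inf J \<le> Sup J" using assms(2) bdd(2,1) by (rule cInf_le_cSup)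
  show "l \<le> Inf J" using assms(2,3) by (intro cInf_greatest) auto
  show "Sup J \<le> u" using assms(2,3) by (intro cSup_least) auto
  show "J \<subseteq> {Inf J..Sup J}" using bdd by (auto intro: cInf_lower cSup_upper)
  show "{Inf J<..<Sup J} \<subseteq> J"
  proof
    fix x assume "x \<in> {Inf J<..<Sup J}"
    then obtain y z where "y \<in> J" "y < x" "z \<in> J" "x < z"
      using bdd assms(2) by (auto simp: cInf_less_iff less_cSup_iff)
    then show "x \<in> J" using mem_is_interval_1_I[OF assms(1), of y z x] by simp
  qed
qed

lemma small_combination_set_eq:
  "small_combination_set k g \<theta> J = {x \<in> J. \<exists>v. (\<forall>p<k. v p \<in> \<int>) \<and> (\<exists>p<k. v p \<noteq> 0) \<and>
    (\<forall>i<k. \<bar>\<Sum>p<k. (deriv ^^ i) (g (Suc p)) x * v p\<bar> < \<theta> (Suc i))}"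
proof -
  have ex: "(\<exists>j\<in>{1..k}. P j) \<longleftrightarrow> (\<exists>p<k. P (Suc p))" for P :: "nat \<Rightarrow> bool"
    by (metis One_nat_def Suc_le_eq Suc_le_mono atLeastAtMost_iff le0 not0_implies_Suc not_one_le_zero)
  have all: "(\<forall>j\<in>{1..k}. P j) \<longleftrightarrow> (\<forall>p<k. P (Suc p))" for P :: "nat \<Rightarrow> bool"
    using ex[of "\<lambda>j. \<not> P j"] by blast
  have iff: "(\<exists>a :: nat \<Rightarrow> int. (\<exists>p<k. a (Suc p) \<noteq> 0) \<and>
        (\<forall>i<k. \<bar>\<Sum>p<k. real_of_int (a (Suc p)) * (deriv ^^ i) (g (Suc p)) x\<bar> < \<theta> (Suc i))) \<longleftrightarrow>
      (\<exists>v. (\<forall>p<k. v p \<in> \<int>) \<and> (\<exists>p<k. v p \<noteq> 0) \<and>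
        (\<forall>i<k. \<bar>\<Sum>p<k. (deriv ^^ i) (g (Suc p)) x * v p\<bar> < \<theta> (Suc i)))" (is "?L \<longleftrightarrow> ?R") for x
  proof
    assume ?L
    then obtain a :: "nat \<Rightarrow> int" where a: "\<exists>p<k. a (Suc p) \<noteq> 0"
      "\<forall>i<k. \<bar>\<Sum>p<k. real_of_int (a (Suc p)) * (deriv ^^ i) (g (Suc p)) x\<bar> < \<theta> (Suc i)" by blast
    then show ?R by (intro exI[of _ "\<lambda>p. real_of_int (a (Suc p))"]) (simp add: mult.commute)
  next
    assume ?R
    then obtain v where v: "\<forall>p<k. v p \<in> \<int>" "\<exists>p<k. v p \<noteq> 0"
      "\<forall>i<k. \<bar>\<Sum>p<k. (deriv ^^ i) (g (Suc p)) x * v p\<bar> < \<theta> (Suc i)" by blast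
    have eq: "real_of_int \<lfloor>v p\<rfloor> = v p" if "p < k" for p using v(1) that by simp
    have "\<exists>p<k. \<lfloor>v p\<rfloor> \<noteq> 0" using v(2) eq by force
    moreover have "(\<Sum>p<k. real_of_int \<lfloor>v p\<rfloor> * (deriv ^^ i) (g (Suc p)) x)
        = (\<Sum>p<k. (deriv ^^ i) (g (Suc p)) x * v p)" for i
      by (intro sum.cong) (auto simp: eq mult.commute)
    ultimately show ?L using v(3) by (intro exI[of _ "\<lambda>j. \<lfloor>v (j - 1)\<rfloor>"]) simp
  qed
  show ?thesis
    by (simp only: small_combination_set_def ex all sum.atLeast1_atMost_eq[folded One_nat_def]
        diff_Suc_1 iff)
qed

text \<open>For each integer vector the inequalities cut out an open set, and countably many vectors
  matter once they are restricted to the first \<open>k\<close> coordinates.\<close>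

lemma small_combination_set_lmeasurable:
  assumes "J \<in> lmeasurable" "J \<subseteq> B" "open B"
    and cont: "\<And>i p. i < k \<Longrightarrow> p < k \<Longrightarrow> continuous_on B ((deriv ^^ i) (g (Suc p)))"
  shows "small_combination_set k g \<theta> J \<in> lmeasurable"
proof -
  define V where "V = {v \<in> {..<k} \<rightarrow>\<^sub>E (\<int> :: real set). \<exists>p<k. v p \<noteq> 0}"
  define O' where "O' = (\<lambda>v. B \<inter> (\<Inter>i<k. {x \<in> B. \<bar>\<Sum>p<k. (deriv ^^ i) (g (Suc p)) x * v p\<bar> < \<theta> (Suc i)}))"
  have "countable ({..<k} \<rightarrow>\<^sub>E (\<int> :: real set))" by (intro countable_PiE) (auto simp: Ints_def)
  then have V: "countable V" by (rule countable_subset[rotated]) (auto simp: V_def)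
  have "open (O' v)" for v
  proof -
    have "open {x \<in> B. \<bar>\<Sum>p<k. (deriv ^^ i) (g (Suc p)) x * v p\<bar> < \<theta> (Suc i)}" if "i < k" for i
    proof -
      have "continuous_on B (\<lambda>x. \<bar>\<Sum>p<k. (deriv ^^ i) (g (Suc p)) x * v p\<bar>)"
        using cont that by (intro continuous_intros) auto
      then have "open (B \<inter> (\<lambda>x. \<bar>\<Sum>p<k. (deriv ^^ i) (g (Suc p)) x * v p\<bar>) -` {..<\<theta> (Suc i)})"
        using assms(3) by (intro continuous_open_preimage) auto
      moreover have "B \<inter> (\<lambda>x. \<bar>\<Sum>p<k. (deriv ^^ i) (g (Suc p)) x * v p\<bar>) -` {..<\<theta> (Suc i)}
          = {x \<in> B. \<bar>\<Sum>p<k. (deriv ^^ i) (g (Suc p)) x * v p\<bar> < \<theta> (Suc i)}" by auto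
      ultimately show ?thesis by simp
    qed
    then show ?thesis unfolding O'_def using assms(3) by (intro open_Int open_INT) auto
  qed
  then have "open (\<Union>v\<in>V. O' v)" by blast
  then have "(\<Union>v\<in>V. O' v) \<in> sets lebesgue" by (simp add: borel_open)
  moreover have "small_combination_set k g \<theta> J = J \<inter> (\<Union>v\<in>V. O' v)"
  proof (rule equalityI; rule subsetI)
    fix x assume "x \<in> small_combination_set k g \<theta> J"
    then obtain v where x: "x \<in> J" and v: "\<forall>p<k. v p \<in> \<int>" "\<exists>p<k. v p \<noteq> 0"
      "\<forall>i<k. \<bar>\<Sum>p<k. (deriv ^^ i) (g (Suc p)) x * v p\<bar> < \<theta> (Suc i)"
      unfolding small_combination_set_eq by blast
    have "restrict v {..<k} \<in> V" using v(1,2) by (auto simp: V_def)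
    moreover have "x \<in> O' (restrict v {..<k})" using v(3) x assms(2) by (auto simp: O'_def)
    ultimately show "x \<in> J \<inter> (\<Union>v\<in>V. O' v)" using x by blast
  next
    fix x assume "x \<in> J \<inter> (\<Union>v\<in>V. O' v)"
    then obtain v where v: "v \<in> V" "x \<in> O' v" and x: "x \<in> J" by blast
    have "\<forall>p<k. v p \<in> \<int>" "\<exists>p<k. v p \<noteq> 0" using v(1) by (auto simp: V_def)
    moreover have "\<forall>i<k. \<bar>\<Sum>p<k. (deriv ^^ i) (g (Suc p)) x * v p\<bar> < \<theta> (Suc i)"
      using v(2) by (simp add: O'_def)
    ultimately show "x \<in> small_combination_set k g \<theta> J"
      using x unfolding small_combination_set_eq by blast
  qed
  ultimately show ?thesis using assms(1) by (simp add: fmeasurable_Int_fmeasurable)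
qed

theorem theorem5p8:
  fixes k :: nat and g :: "nat \<Rightarrow> real \<Rightarrow> real" and U :: "real set" and x\<^sub>0 :: real
  assumes "k \<ge> 2"
    and "is_interval U"
    and "\<And>j. j \<in> {1..k} \<Longrightarrow> real_analytic_on (g j) U"
    and "lin_indep_functions_on k g U"
    and "x\<^sub>0 \<in> U"
    and "wronskian k g x\<^sub>0 \<noteq> 0"
  shows "\<exists>\<rho> > 0. (x\<^sub>0 \<in> interior U \<longrightarrow> {x\<^sub>0 - \<rho> <..< x\<^sub>0 + \<rho>} \<subseteq> U) \<and>
    (\<exists>K\<^sub>0 > 0. \<exists>\<alpha> > 0.
      \<forall>J. is_interval J \<and> J \<subseteq> {x\<^sub>0 - \<rho> <..< x\<^sub>0 + \<rho>} \<longrightarrow>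
        (\<exists>\<delta> > 0. \<forall>\<theta> :: nat \<Rightarrow> real. (\<forall>i\<in>{1..k}. \<theta> i > 0) \<longrightarrow>
           small_combination_set k g \<theta> J \<in> lmeasurable \<and>
           measure lebesgue (small_combination_set k g \<theta> J)
             \<le> K\<^sub>0 * (1 + (Theta_tilde k \<theta> / \<delta>) powr \<alpha>)
                  * geometric_mean k \<theta> powr \<alpha> * measure lebesgue J))"
proof -
  have k0: "0 < k" using assms(1) by simp
  define G where "G = (\<lambda>i p. (deriv ^^ i) (g (Suc p)))"
  have "\<forall>p\<in>{..<k}. \<exists>R>0. \<exists>F. ereal R \<le> fps_conv_radius F \<and>
      (\<forall>x. \<bar>x - x\<^sub>0\<bar> < R \<longrightarrow> g (Suc p) x = eval_fps F (x - x\<^sub>0))"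
  proof
    fix p assume "p \<in> {..<k}"
    then have "real_analytic_on (g (Suc p)) U" by (intro assms(3)) auto
    then show "\<exists>R>0. \<exists>F. ereal R \<le> fps_conv_radius F \<and>
        (\<forall>x. \<bar>x - x\<^sub>0\<bar> < R \<longrightarrow> g (Suc p) x = eval_fps F (x - x\<^sub>0))"
      using assms(5) by (rule real_analytic_on_power_series)
  qed
  from bchoice[OF this] obtain Rp where Rp: "\<forall>p\<in>{..<k}. 0 < Rp p \<and> (\<exists>F. ereal (Rp p) \<le> fps_conv_radius F \<and>
      (\<forall>x. \<bar>x - x\<^sub>0\<bar> < Rp p \<longrightarrow> g (Suc p) x = eval_fps F (x - x\<^sub>0)))" ..
  then have "\<forall>p\<in>{..<k}. \<exists>F. ereal (Rp p) \<le> fps_conv_radius F \<and>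
      (\<forall>x. \<bar>x - x\<^sub>0\<bar> < Rp p \<longrightarrow> g (Suc p) x = eval_fps F (x - x\<^sub>0))" by simp
  from bchoice[OF this] obtain F where F: "\<forall>p\<in>{..<k}. ereal (Rp p) \<le> fps_conv_radius (F p) \<and>
      (\<forall>x. \<bar>x - x\<^sub>0\<bar> < Rp p \<longrightarrow> g (Suc p) x = eval_fps (F p) (x - x\<^sub>0))" ..
  define R where "R = Min (Rp ` {..<k})"
  have R: "0 < R" "\<And>p. p < k \<Longrightarrow> R \<le> Rp p"
  proof -
    show "0 < R" unfolding R_def using Rp k0 by (subst Min_gr_iff) auto
    show "R \<le> Rp p" if "p < k" for p unfolding R_def using that by (intro Min_le) auto
  qed
  have rad: "ereal R \<le> fps_conv_radius (F p)" if "p < k" for p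
  proof -
    have "ereal R \<le> ereal (Rp p)" using R(2)[OF that] by simp
    also have "\<dots> \<le> fps_conv_radius (F p)" using F that by simp
    finally show ?thesis .
  qed
  have gF: "g (Suc p) x = eval_fps (F p) (x - x\<^sub>0)" if "p < k" "\<bar>x - x\<^sub>0\<bar> < R" for p x
    using F R(2)[OF that(1)] that by simp
  have GF: "G i p x = eval_fps ((fps_deriv ^^ i) (F p)) (x - x\<^sub>0)" if "p < k" "\<bar>x - x\<^sub>0\<bar> < R" for i p x
    unfolding G_def using rad[OF that(1)] gF[OF that(1)] that(2) by (rule deriv_funpow_eval_fps)
  have dG: "(G i p has_real_derivative G (Suc i) p x) (at x)" if "p < k" "\<bar>x - x\<^sub>0\<bar> < R" for i p x
    unfolding G_def using rad[OF that(1)] gF[OF that(1)] that(2) by (rule deriv_funpow_eval_fps)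
  define B where "B = {x\<^sub>0 - R<..<x\<^sub>0 + R}"
  have contG: "continuous_on B (G i p)" if "p < k" for i p
  proof (intro continuous_at_imp_continuous_on ballI)
    fix x assume "x \<in> B"
    then have "\<bar>x - x\<^sub>0\<bar> < R" by (auto simp: B_def)
    then show "isCont (G i p) x" using dG[OF that] DERIV_isCont by blast
  qed
  define W where "W = (\<lambda>x. fdet k (\<lambda>i p. G i p x))"
  have W0: "W x\<^sub>0 \<noteq> 0" using assms(6) by (simp add: W_def fdet_def wronskian_def G_def)
  have "W field_differentiable (at x\<^sub>0)"
    unfolding W_def
  proof (rule field_differentiable_fdet)
    show "G i p field_differentiable (at x\<^sub>0)" if "p < k" for i p
      using dG[OF that, of x\<^sub>0 i] R(1) by (auto simp: field_differentiable_def)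
  qed
  then have "isCont W x\<^sub>0" by (rule field_differentiable_imp_continuous_at)
  then obtain R1 where R1: "0 < R1" "\<And>x. \<bar>x - x\<^sub>0\<bar> < R1 \<Longrightarrow> \<bar>W x - W x\<^sub>0\<bar> < \<bar>W x\<^sub>0\<bar> / 2"
    using W0 unfolding continuous_at_eps_delta dist_real_def by (metis half_gt_zero zero_less_abs_iff)
  define c\<^sub>0 where "c\<^sub>0 = \<bar>W x\<^sub>0\<bar> / 2"
  have c0: "0 < c\<^sub>0" using W0 by (simp add: c\<^sub>0_def)
  have c0W: "c\<^sub>0 \<le> \<bar>W x\<bar>" if "\<bar>x - x\<^sub>0\<bar> < R1" for x
    using R1(2)[OF that] unfolding c\<^sub>0_def by linarith
  have "\<exists>R'>0. R' \<le> R \<and> (\<exists>n>0. \<exists>C\<ge>1. \<forall>r f d T a b y \<epsilon>. r \<le> k \<longrightarrow> f \<in> {..<r} \<rightarrow>\<^sub>E {..<k} \<longrightarrow>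
      {a..<b} \<subseteq> {x\<^sub>0 - R'<..<x\<^sub>0 + R'} \<longrightarrow> y \<in> {a..<b} \<longrightarrow> 0 < \<epsilon> \<longrightarrow>
        \<bar>minor r (mprod k (\<lambda>i p. d i * G i p y) T) f\<bar> *
          measure lebesgue {x \<in> {a..<b}. \<bar>minor r (mprod k (\<lambda>i p. d i * G i p x) T) f\<bar> < \<epsilon>} ^ n
          \<le> C * \<epsilon> * (b - a) ^ n)"
    by (rule minor_sublevel_measure[OF R(1) rad GF])
  then obtain R' n C where R': "0 < R'" "R' \<le> R" and n: "0 < n" and C: "1 \<le> C"
    and good: "\<forall>r f d T a b y \<epsilon>. r \<le> k \<longrightarrow> f \<in> {..<r} \<rightarrow>\<^sub>E {..<k} \<longrightarrow>
      {a..<b} \<subseteq> {x\<^sub>0 - R'<..<x\<^sub>0 + R'} \<longrightarrow> y \<in> {a..<b} \<longrightarrow> 0 < \<epsilon> \<longrightarrow>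
        \<bar>minor r (mprod k (\<lambda>i p. d i * G i p y) T) f\<bar> *
          measure lebesgue {x \<in> {a..<b}. \<bar>minor r (mprod k (\<lambda>i p. d i * G i p x) T) f\<bar> < \<epsilon>} ^ n
          \<le> C * \<epsilon> * (b - a) ^ n"
    by (elim exE conjE) (rule that)
  have "\<exists>e>0. x\<^sub>0 \<in> interior U \<longrightarrow> ball x\<^sub>0 e \<subseteq> U"
    by (cases "x\<^sub>0 \<in> interior U") (auto simp: mem_interior intro: exI[of _ 1])
  then obtain e where e: "0 < e" "x\<^sub>0 \<in> interior U \<longrightarrow> ball x\<^sub>0 e \<subseteq> U" by blast
  \<comment> \<open>Halving keeps the closed end points of every \<open>J\<close> strictly inside
    the neighbourhoods where the power law and the Wronskian bound hold.\<close>
  define \<rho> where "\<rho> = min e (min R' R1 / 2)"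
  define \<alpha> where "\<alpha> = 1 / real n"
  \<comment> \<open>The factors come from the length of flags, from the power law at level
    \<open>real k * \<tau>\<close>, and from the threshold in rank \<open>k\<close>; none of them
    involves \<open>J\<close>.\<close>
  define K\<^sub>0 where "K\<^sub>0 = marking_const k * (C * real k) powr \<alpha> * (1 + (1 / c\<^sub>0) powr \<alpha>)"
  have \<rho>: "0 < \<rho>" using e(1) R'(1) R1(1) by (simp add: \<rho>_def)
  have near: "\<bar>x - x\<^sub>0\<bar> < R'" "\<bar>x - x\<^sub>0\<bar> < R" "\<bar>x - x\<^sub>0\<bar> < R1" if "x\<^sub>0 - \<rho> \<le> x" "x \<le> x\<^sub>0 + \<rho>" for x
    using that \<rho> R' R1(1) unfolding \<rho>_def by (auto simp: min_def split: if_splits)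
  have "0 < marking_const k" using k0 marking_const_nonneg[of "k - 1"] by (cases k) auto
  then have K0: "0 < K\<^sub>0"
    using C k0 unfolding K\<^sub>0_def by (intro mult_pos_pos) (auto intro: add_pos_nonneg)
  have main: "\<exists>\<delta> > 0. \<forall>\<theta> :: nat \<Rightarrow> real. (\<forall>i\<in>{1..k}. \<theta> i > 0) \<longrightarrow>
      small_combination_set k g \<theta> J \<in> lmeasurable \<and>
      measure lebesgue (small_combination_set k g \<theta> J)
        \<le> K\<^sub>0 * (1 + (Theta_tilde k \<theta> / \<delta>) powr \<alpha>) * geometric_mean k \<theta> powr \<alpha> * measure lebesgue J"
    if J: "is_interval J" "J \<subseteq> {x\<^sub>0 - \<rho> <..< x\<^sub>0 + \<rho>}" "J \<noteq> {}" for J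
  proof -
    obtain a b where ab: "a \<le> b" "x\<^sub>0 - \<rho> \<le> a" "b \<le> x\<^sub>0 + \<rho>" "{a<..<b} \<subseteq> J" "J \<subseteq> {a..b}"
      using J(1,3,2) by (rule bounded_interval_endpoints)
    have Jeq: "J = {a<..<b} \<union> (J \<inter> {a, b})" using ab(4,5) by force
    have "J \<inter> {a, b} \<in> sets lebesgue" by (intro negligible_imp_sets negligible_finite) auto
    then have Js: "J \<in> sets lebesgue" by (subst Jeq) auto
    have Jm: "J \<in> lmeasurable"
      using Js ab(5) by (intro bounded_set_imp_lmeasurable bounded_subset[OF bounded_closed_interval]) auto
    have "measure lebesgue {a<..<b} \<le> measure lebesgue J"
      using ab(4) Jm by (intro measure_mono_fmeasurable) auto
    then have lenJ: "b - a \<le> measure lebesgue J" using ab(1) by simp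
    have "J \<subseteq> B" using near(2) J(2) by (force simp: B_def)
    moreover have "continuous_on B ((deriv ^^ i) (g (Suc p)))" if "p < k" for i p
      using contG[OF that, of i] unfolding G_def .
    ultimately have meas: "small_combination_set k g \<theta> J \<in> lmeasurable" for \<theta>
      using Jm by (intro small_combination_set_lmeasurable[of J B]) (auto simp: B_def)
    have sub: "small_combination_set k g \<theta> J \<subseteq> J" for \<theta> by (auto simp: small_combination_set_def)
    \<comment> \<open>The constant is fixed here, before \<open>\<theta>\<close>. If
      \<open>J\<close> is a single point, any positive value will do because the set is
      null.\<close>
    have "\<exists>\<delta>>0. a < b \<longrightarrow> (\<forall>r T. 1 \<le> r \<longrightarrow> r < k \<longrightarrow> integral_tuple k r T \<longrightarrow>
      (\<exists>y\<in>{a<..<b}. \<delta> \<le> \<bar>minor r (mprod k (\<lambda>i p. G i p y) T) (\<lambda>i. i)\<bar>))"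
    proof (cases "a < b")
      case True
      have "\<forall>r\<in>{..<k}. \<exists>\<delta>>0. \<forall>T. integral_tuple k r T \<longrightarrow>
        (\<exists>y\<in>{a<..<b}. \<delta> \<le> \<bar>minor r (mprod k (\<lambda>i p. G i p y) T) (\<lambda>i. i)\<bar>)"
      proof
        fix r
        show "\<exists>\<delta>>0. \<forall>T. integral_tuple k r T \<longrightarrow>
          (\<exists>y\<in>{a<..<b}. \<delta> \<le> \<bar>minor r (mprod k (\<lambda>i p. G i p y) T) (\<lambda>i. i)\<bar>)"
        proof (rule uniform_wronskian_bound[OF k0 True])
          fix y assume "y \<in> {a<..<b}"
          then have y: "\<bar>y - x\<^sub>0\<bar> < R" "\<bar>y - x\<^sub>0\<bar> < R1" using near[of y] ab(2,3) by auto
          show "(G i p has_real_derivative G (Suc i) p y) (at y)" if "p < k" for i p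
            using that y(1) by (rule dG)
          show "fdet k (\<lambda>i p. G i p y) \<noteq> 0" using c0W[OF y(2)] c0 by (auto simp: W_def)
        qed
      qed
      from bchoice[OF this] obtain \<delta> where \<delta>: "\<forall>r\<in>{..<k}. 0 < \<delta> r \<and> (\<forall>T. integral_tuple k r T \<longrightarrow>
        (\<exists>y\<in>{a<..<b}. \<delta> r \<le> \<bar>minor r (mprod k (\<lambda>i p. G i p y) T) (\<lambda>i. i)\<bar>))" ..
      have "0 < Min (\<delta> ` {..<k})" using \<delta> k0 by (subst Min_gr_iff) auto
      moreover have "\<exists>y\<in>{a<..<b}. Min (\<delta> ` {..<k}) \<le> \<bar>minor r (mprod k (\<lambda>i p. G i p y) T) (\<lambda>i. i)\<bar>"
        if "r < k" "integral_tuple k r T" for r T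
      proof -
        have "Min (\<delta> ` {..<k}) \<le> \<delta> r" using that(1) by (intro Min_le) auto
        moreover have "\<exists>y\<in>{a<..<b}. \<delta> r \<le> \<bar>minor r (mprod k (\<lambda>i p. G i p y) T) (\<lambda>i. i)\<bar>"
          using \<delta> that by simp
        ultimately show ?thesis by (meson order_trans)
      qed
      ultimately show ?thesis by blast
    next
      case False
      then show ?thesis by (intro exI[of _ 1]) auto
    qed
    then obtain \<delta> where \<delta>: "0 < \<delta>" "\<And>r T. a < b \<Longrightarrow> 1 \<le> r \<Longrightarrow> r < k \<Longrightarrow> integral_tuple k r T \<Longrightarrow>
      \<exists>y\<in>{a<..<b}. \<delta> \<le> \<bar>minor r (mprod k (\<lambda>i p. G i p y) T) (\<lambda>i. i)\<bar>" by blast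
    have "measure lebesgue (small_combination_set k g \<theta> J)
        \<le> K\<^sub>0 * (1 + (Theta_tilde k \<theta> / \<delta>) powr \<alpha>) * geometric_mean k \<theta> powr \<alpha> * measure lebesgue J"
      if \<theta>: "\<forall>i\<in>{1..k}. \<theta> i > 0" for \<theta>
    proof (cases "a < b")
      case False
      then have "J \<subseteq> {a}" using ab(1,5) by auto
      then have "small_combination_set k g \<theta> J \<subseteq> {a}" using sub by (rule order_trans[rotated])
      then have "negligible (small_combination_set k g \<theta> J)"
        by (rule negligible_subset[OF negligible_sing])
      then have "measure lebesgue (small_combination_set k g \<theta> J) = 0"
        by (rule negligible_imp_measure0)
      then show ?thesis using K0 by simp
    next
      case True
      have "\<exists>N\<in>lmeasurable. {x \<in> {a..<b}. \<exists>v. (\<forall>p<k. v p \<in> \<int>) \<and> (\<exists>p<k. v p \<noteq> 0) \<and>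
          (\<forall>i<k. \<bar>\<Sum>p<k. G i p x * v p\<bar> < \<theta> (Suc i))} \<subseteq> N \<and>
        measure lebesgue N \<le> K\<^sub>0 * (1 + (Theta_tilde k \<theta> / \<delta>) powr \<alpha>) * geometric_mean k \<theta> powr \<alpha> * (b - a)"
        unfolding K\<^sub>0_def \<alpha>_def
      proof (rule nondivergence_bound[OF assms(1) True n C c0 \<delta>(1)])
        have near': "\<bar>y - x\<^sub>0\<bar> < R'" "\<bar>y - x\<^sub>0\<bar> < R" "\<bar>y - x\<^sub>0\<bar> < R1" if "y \<in> {a..<b}" for y
          using near[of y] that ab(2,3) by auto
        show "continuous_on {a..<b} (G i p)" if "p < k" for i p
        proof (rule continuous_on_subset[OF contG[OF that]])
          show "{a..<b} \<subseteq> B" using near'(2) by (force simp: B_def)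
        qed
        show "c\<^sub>0 \<le> \<bar>fdet k (\<lambda>i p. G i p y)\<bar>" if "y \<in> {a..<b}" for y
          using c0W[OF near'(3)[OF that]] by (simp add: W_def)
        show "\<exists>y\<in>{a<..<b}. \<delta> \<le> \<bar>minor r (mprod k (\<lambda>i p. G i p y) T) (\<lambda>i. i)\<bar>"
          if "1 \<le> r" "r < k" "integral_tuple k r T" for r T
          using True that by (rule \<delta>(2))
        show "0 < \<theta> i" if "i \<in> {1..k}" for i using \<theta> that by simp
        show "\<bar>minor r (mprod k (\<lambda>i p. d i * G i p y) T) f\<bar> *
            measure lebesgue {x \<in> {a'..<b'}. \<bar>minor r (mprod k (\<lambda>i p. d i * G i p x) T) f\<bar> < \<epsilon>} ^ n
            \<le> C * \<epsilon> * (b' - a') ^ n"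
          if "r \<le> k" "f \<in> {..<r} \<rightarrow>\<^sub>E {..<k}" "a \<le> a'" "b' \<le> b" "y \<in> {a'..<b'}" "0 < \<epsilon>" for r f d T a' b' y \<epsilon>
        proof -
          have "{a'..<b'} \<subseteq> {x\<^sub>0 - R'<..<x\<^sub>0 + R'}"
          proof
            fix x assume "x \<in> {a'..<b'}"
            then have "x \<in> {a..<b}" using that by auto
            then show "x \<in> {x\<^sub>0 - R'<..<x\<^sub>0 + R'}" using near'(1)[of x] by auto
          qed
          then show ?thesis using good that by simp
        qed
      qed
      then obtain N where N: "N \<in> lmeasurable"
        "{x \<in> {a..<b}. \<exists>v. (\<forall>p<k. v p \<in> \<int>) \<and> (\<exists>p<k. v p \<noteq> 0) \<and>
          (\<forall>i<k. \<bar>\<Sum>p<k. G i p x * v p\<bar> < \<theta> (Suc i))} \<subseteq> N"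
        "measure lebesgue N \<le> K\<^sub>0 * (1 + (Theta_tilde k \<theta> / \<delta>) powr \<alpha>) * geometric_mean k \<theta> powr \<alpha> * (b - a)"
        by (elim bexE conjE) (rule that)
      \<comment> \<open>The estimate on the half-open interval misses at most the right end point of
        \<open>J\<close>, a null set.\<close>
      have "{b} \<in> lmeasurable" by (rule bounded_set_imp_lmeasurable) auto
      have "small_combination_set k g \<theta> J \<subseteq> N \<union> {b}"
      proof
        fix x assume x: "x \<in> small_combination_set k g \<theta> J"
        then have "x \<in> {a..b}" using sub ab(5) by blast
        moreover have "x \<in> N" if "x \<in> {a..<b}"
          using x that N(2) unfolding small_combination_set_eq G_def by blast
        ultimately show "x \<in> N \<union> {b}" by force
      qed
      then have "measure lebesgue (small_combination_set k g \<theta> J) \<le> measure lebesgue (N \<union> {b})"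
        using meas fmeasurable.Un[OF N(1) \<open>{b} \<in> lmeasurable\<close>]
        by (intro measure_mono_fmeasurable) (auto simp: fmeasurableD)
      also have "\<dots> \<le> measure lebesgue N + measure lebesgue {b}"
        using N(1) by (intro measure_Un_le) auto
      also have "\<dots> = measure lebesgue N" by simp
      also note N(3)
      also have "K\<^sub>0 * (1 + (Theta_tilde k \<theta> / \<delta>) powr \<alpha>) * geometric_mean k \<theta> powr \<alpha> * (b - a)
          \<le> K\<^sub>0 * (1 + (Theta_tilde k \<theta> / \<delta>) powr \<alpha>) * geometric_mean k \<theta> powr \<alpha> * measure lebesgue J"
        using lenJ K0 by (intro mult_left_mono) auto
      finally show ?thesis .
    qed
    then show ?thesis using \<delta>(1) meas by blast
  qed
  have bound: "\<exists>\<delta> > 0. \<forall>\<theta> :: nat \<Rightarrow> real. (\<forall>i\<in>{1..k}. \<theta> i > 0) \<longrightarrow>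
      small_combination_set k g \<theta> J \<in> lmeasurable \<and>
      measure lebesgue (small_combination_set k g \<theta> J)
        \<le> K\<^sub>0 * (1 + (Theta_tilde k \<theta> / \<delta>) powr \<alpha>) * geometric_mean k \<theta> powr \<alpha> * measure lebesgue J"
    if "is_interval J \<and> J \<subseteq> {x\<^sub>0 - \<rho> <..< x\<^sub>0 + \<rho>}" for J
  proof (cases "J = {}")
    case True
    then show ?thesis by (intro exI[of _ 1]) (simp add: small_combination_set_def)
  next
    case False
    then show ?thesis using that by (intro main) auto
  qed
  have inside: "x\<^sub>0 \<in> interior U \<longrightarrow> {x\<^sub>0 - \<rho> <..< x\<^sub>0 + \<rho>} \<subseteq> U"
  proof
    assume "x\<^sub>0 \<in> interior U"
    with e(2) have "ball x\<^sub>0 e \<subseteq> U" ..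
    moreover have "\<rho> \<le> e" by (simp add: \<rho>_def)
    ultimately show "{x\<^sub>0 - \<rho> <..< x\<^sub>0 + \<rho>} \<subseteq> U"
      by (auto simp: subset_iff ball_eq_greaterThanLessThan)
  qed
  have "0 < \<alpha>" using n by (simp add: \<alpha>_def)
  show ?thesis
    by (rule exI[of _ \<rho>], rule conjI[OF \<rho>], rule conjI[OF inside], rule exI[of _ K\<^sub>0],
        rule conjI[OF K0], rule exI[of _ \<alpha>], rule conjI[OF \<open>0 < \<alpha>\<close>], intro allI impI, rule bound)
qed

end
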